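(* Let $\Lambda$ be an artin algebra, and let all modules be $\Lambda$-modules of finite length. Let $W$ be a module with $\operatorname{Ext}^1(W,W)=0$ and assume there is given an exact sequence $0\to U\to V\to W\to 0$. Then the cokernel of any monomorphism $U\to V$ is a degeneration of $W$.
   Context: For finite length modules $X,Y$, the module $Y$ is called a degeneration of $X$ if there is an exact sequence $0\to U'\to X\oplus U'\to Y\to 0$ with $U'$ of finite length. *)

theory Defs
  imports "HOL-Algebra.Module" "HOL-Algebra.Ideal" "HOL-Algebra.Elementary_Groups"
begin

section \<open>Left modules over a ring that need not be commutative\<close>

text \<open>The library locale \<^locale>\<open>module\<close> demands a commutative ring of scalars. The record type and the
  locale \<^locale>\<open>submodule\<close> do not, and are reused. The multiplicative fields of the record are
  junk and are left undefined below.\<close>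

locale left_module = R?: ring R + M?: abelian_group M
  for R :: "('a, 'r) ring_scheme" (structure) and M :: "('a, 'b, 'm) module_scheme" (structure) +
  assumes smult_closed [simp, intro]:
      "\<lbrakk>a \<in> carrier R; x \<in> carrier M\<rbrakk> \<Longrightarrow> a \<odot>\<^bsub>M\<^esub> x \<in> carrier M"
    and smult_l_distr:
      "\<lbrakk>a \<in> carrier R; b \<in> carrier R; x \<in> carrier M\<rbrakk> \<Longrightarrow>
        (a \<oplus> b) \<odot>\<^bsub>M\<^esub> x = a \<odot>\<^bsub>M\<^esub> x \<oplus>\<^bsub>M\<^esub> b \<odot>\<^bsub>M\<^esub> x"
    and smult_r_distr:
      "\<lbrakk>a \<in> carrier R; x \<in> carrier M; y \<in> carrier M\<rbrakk> \<Longrightarrow>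
        a \<odot>\<^bsub>M\<^esub> (x \<oplus>\<^bsub>M\<^esub> y) = a \<odot>\<^bsub>M\<^esub> x \<oplus>\<^bsub>M\<^esub> a \<odot>\<^bsub>M\<^esub> y"
    and smult_assoc1:
      "\<lbrakk>a \<in> carrier R; b \<in> carrier R; x \<in> carrier M\<rbrakk> \<Longrightarrow>
        (a \<otimes> b) \<odot>\<^bsub>M\<^esub> x = a \<odot>\<^bsub>M\<^esub> (b \<odot>\<^bsub>M\<^esub> x)"
    and smult_one [simp]: "x \<in> carrier M \<Longrightarrow> \<one> \<odot>\<^bsub>M\<^esub> x = x"

text \<open>Finite length: existence of a composition series.\<close>

definition finite_length :: "('a, 'r) ring_scheme \<Rightarrow> ('a, 'b, 'm) module_scheme \<Rightarrow> bool" where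
  "finite_length R M \<longleftrightarrow>
    (\<exists>n F. F 0 = {\<zero>\<^bsub>M\<^esub>} \<and> F n = carrier M \<and>
      (\<forall>i\<le>n. submodule (F i) R M) \<and>
      (\<forall>i<n. F i \<subset> F (Suc i) \<and>
        (\<forall>N. submodule N R M \<and> F i \<subseteq> N \<and> N \<subseteq> F (Suc i) \<longrightarrow> N = F i \<or> N = F (Suc i))))"

definition mod_hom ::
  "('a, 'r) ring_scheme \<Rightarrow> ('a, 'b, 'm) module_scheme \<Rightarrow> ('a, 'c, 'n) module_scheme \<Rightarrow> ('b \<Rightarrow> 'c) set"
  where
  "mod_hom R M N = {f \<in> carrier M \<rightarrow> carrier N.
     (\<forall>x\<in>carrier M. \<forall>y\<in>carrier M. f (x \<oplus>\<^bsub>M\<^esub> y) = f x \<oplus>\<^bsub>N\<^esub> f y) \<and>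
     (\<forall>a\<in>carrier R. \<forall>x\<in>carrier M. f (a \<odot>\<^bsub>M\<^esub> x) = a \<odot>\<^bsub>N\<^esub> f x)}"

definition mod_mono ::
  "('a, 'r) ring_scheme \<Rightarrow> ('a, 'b, 'm) module_scheme \<Rightarrow> ('a, 'c, 'n) module_scheme \<Rightarrow> ('b \<Rightarrow> 'c) set"
  where "mod_mono R M N = {f \<in> mod_hom R M N. inj_on f (carrier M)}"

text \<open>Exactness of \<open>0 \<rightarrow> X \<rightarrow> Y \<rightarrow> Z \<rightarrow> 0\<close> with maps \<open>f\<close> and \<open>g\<close>.\<close>

definition short_exact ::
  "('a, 'r) ring_scheme \<Rightarrow> ('a, 'b, 'm) module_scheme \<Rightarrow> ('a, 'c, 'n) module_scheme \<Rightarrow>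
    ('a, 'd, 'k) module_scheme \<Rightarrow> ('b \<Rightarrow> 'c) \<Rightarrow> ('c \<Rightarrow> 'd) \<Rightarrow> bool" where
  "short_exact R X Y Z f g \<longleftrightarrow>
     f \<in> mod_mono R X Y \<and> g \<in> mod_hom R Y Z \<and>
     f ` carrier X = a_kernel Y Z g \<and> g ` carrier Y = carrier Z"

definition direct_sum ::
  "('a, 'b, 'm) module_scheme \<Rightarrow> ('a, 'c, 'n) module_scheme \<Rightarrow> ('a, 'b \<times> 'c) module" where
  "direct_sum M N = \<lparr>carrier = carrier M \<times> carrier N, mult = undefined, one = undefined,
     zero = (\<zero>\<^bsub>M\<^esub>, \<zero>\<^bsub>N\<^esub>),
     add = (\<lambda>(x, y) (x', y'). (x \<oplus>\<^bsub>M\<^esub> x', y \<oplus>\<^bsub>N\<^esub> y')),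
     smult = (\<lambda>a (x, y). (a \<odot>\<^bsub>M\<^esub> x, a \<odot>\<^bsub>N\<^esub> y))\<rparr>"

definition quotient_module :: "('a, 'b, 'm) module_scheme \<Rightarrow> 'b set \<Rightarrow> ('a, 'b set) module" where
  "quotient_module M N = \<lparr>carrier = a_rcosets\<^bsub>M\<^esub> N, mult = undefined, one = undefined,
     zero = N, add = set_add M,
     smult = (\<lambda>a C. \<Union>x\<in>C. N +>\<^bsub>M\<^esub> (a \<odot>\<^bsub>M\<^esub> x))\<rparr>"

definition cokernel_module ::
  "('a, 'b, 'm) module_scheme \<Rightarrow> ('a, 'c, 'n) module_scheme \<Rightarrow> ('b \<Rightarrow> 'c) \<Rightarrow> ('a, 'c set) module" where
  "cokernel_module M N h = quotient_module N (h ` carrier M)"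


section \<open>Artin algebras\<close>

definition artinian_cring :: "('k, 'r) ring_scheme \<Rightarrow> bool" where
  "artinian_cring k \<longleftrightarrow> cring k \<and>
     (\<forall>I :: nat \<Rightarrow> 'k set. (\<forall>n. ideal (I n) k \<and> I (Suc n) \<subseteq> I n) \<longrightarrow> (\<exists>N. \<forall>n\<ge>N. I n = I N))"

text \<open>\<open>\<phi>\<close> is the structure map of the \<open>k\<close>-algebra \<open>\<Lambda>\<close>.\<close>

definition artin_algebra ::
  "('k, 'r) ring_scheme \<Rightarrow> ('k \<Rightarrow> 'a) \<Rightarrow> ('a, 's) ring_scheme \<Rightarrow> bool" where
  "artin_algebra k \<phi> \<Lambda> \<longleftrightarrow>
     artinian_cring k \<and> ring \<Lambda> \<and> \<phi> \<in> ring_hom k \<Lambda> \<and>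
     (\<forall>c\<in>carrier k. \<forall>x\<in>carrier \<Lambda>. \<phi> c \<otimes>\<^bsub>\<Lambda>\<^esub> x = x \<otimes>\<^bsub>\<Lambda>\<^esub> \<phi> c) \<and>
     (\<exists>S. finite S \<and> S \<subseteq> carrier \<Lambda> \<and>
       (\<forall>x\<in>carrier \<Lambda>. \<exists>c\<in>S \<rightarrow> carrier k. x = (\<Oplus>\<^bsub>\<Lambda>\<^esub>s\<in>S. \<phi> (c s) \<otimes>\<^bsub>\<Lambda>\<^esub> s)))"


section \<open>The group \<open>Ext\<^sup>1\<close>\<close>

text \<open>Homomorphisms are made extensional so that a homomorphism is one element of the group.\<close>

definition hom_group ::
  "('a, 'r) ring_scheme \<Rightarrow> ('a, 'b, 'm) module_scheme \<Rightarrow> ('a, 'c, 'n) module_scheme \<Rightarrow> ('b \<Rightarrow> 'c) monoid"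
  where
  "hom_group R M N = \<lparr>carrier = mod_hom R M N \<inter> extensional (carrier M),
     mult = (\<lambda>f g. \<lambda>x\<in>carrier M. f x \<oplus>\<^bsub>N\<^esub> g x),
     one = (\<lambda>x\<in>carrier M. \<zero>\<^bsub>N\<^esub>)\<rparr>"

text \<open>The free module on the set \<open>carrier X\<close>, and the kernel of its canonical surjection onto \<open>X\<close>.\<close>

definition free_cover :: "('a, 'r) ring_scheme \<Rightarrow> ('a, 'b, 'm) module_scheme \<Rightarrow> ('a, 'b \<Rightarrow> 'a) module"
  where
  "free_cover R X = \<lparr>carrier = {c. (\<forall>x\<in>carrier X. c x \<in> carrier R) \<and>
       (\<forall>x. x \<notin> carrier X \<longrightarrow> c x = \<zero>\<^bsub>R\<^esub>) \<and> finite {x. c x \<noteq> \<zero>\<^bsub>R\<^esub>}},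
     mult = undefined, one = undefined,
     zero = (\<lambda>x. \<zero>\<^bsub>R\<^esub>),
     add = (\<lambda>c d x. if x \<in> carrier X then c x \<oplus>\<^bsub>R\<^esub> d x else \<zero>\<^bsub>R\<^esub>),
     smult = (\<lambda>a c x. if x \<in> carrier X then a \<otimes>\<^bsub>R\<^esub> c x else \<zero>\<^bsub>R\<^esub>)\<rparr>"

definition free_cover_map ::
  "('a, 'r) ring_scheme \<Rightarrow> ('a, 'b, 'm) module_scheme \<Rightarrow> ('b \<Rightarrow> 'a) \<Rightarrow> 'b" where
  "free_cover_map R X c = (\<Oplus>\<^bsub>X\<^esub>x\<in>{x. c x \<noteq> \<zero>\<^bsub>R\<^esub>}. c x \<odot>\<^bsub>X\<^esub> x)"

definition syzygy :: "('a, 'r) ring_scheme \<Rightarrow> ('a, 'b, 'm) module_scheme \<Rightarrow> ('a, 'b \<Rightarrow> 'a) module"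
  where
  "syzygy R X = (free_cover R X)\<lparr>carrier := a_kernel (free_cover R X) X (free_cover_map R X)\<rparr>"

text \<open>With \<open>P\<close> the free cover and \<open>K\<close> the syzygy of \<open>X\<close>, the first right derived functor of
  \<open>Hom(-, Y)\<close> at \<open>X\<close> is the cokernel of the restriction map \<open>Hom(P, Y) \<rightarrow> Hom(K, Y)\<close>.\<close>

definition Ext1 ::
  "('a, 'r) ring_scheme \<Rightarrow> ('a, 'b, 'm) module_scheme \<Rightarrow> ('a, 'c, 'n) module_scheme \<Rightarrow>
    (('b \<Rightarrow> 'a) \<Rightarrow> 'c) set monoid" where
  "Ext1 R X Y = hom_group R (syzygy R X) Y Mod
     ((\<lambda>f. restrict f (carrier (syzygy R X))) ` carrier (hom_group R (free_cover R X) Y))"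


section \<open>Degenerations\<close>

text \<open>An existential quantifier cannot range over modules of all types. Over a ring with elements of
  type \<open>'a\<close> every module of finite length has an isomorphic copy with elements of type
  \<open>nat \<Rightarrow> 'a\<close>, so the quantifier over \<open>U'\<close> ranges over that type. The lemma \<open>degenerationI\<close>
  below shows that a module \<open>U'\<close> of any other type would do as well.\<close>

definition degeneration ::
  "('a, 'r) ring_scheme \<Rightarrow> ('a, 'b, 'm) module_scheme \<Rightarrow> ('a, 'c, 'n) module_scheme \<Rightarrow> bool" where
  "degeneration R X Y \<longleftrightarrow>
     left_module R X \<and> finite_length R X \<and> left_module R Y \<and> finite_length R Y \<and>
     (\<exists>(U' :: ('a, nat \<Rightarrow> 'a) module) f g.
        left_module R U' \<and> finite_length R U' \<and> short_exact R U' (direct_sum X U') Y f g)"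

lemma (in left_module) module_submoduleI:
  assumes "H \<subseteq> carrier M" "\<zero>\<^bsub>M\<^esub> \<in> H"
    and add: "\<And>a b. \<lbrakk>a \<in> H; b \<in> H\<rbrakk> \<Longrightarrow> a \<oplus>\<^bsub>M\<^esub> b \<in> H"
    and smult: "\<And>a x. \<lbrakk>a \<in> carrier R; x \<in> H\<rbrakk> \<Longrightarrow> a \<odot>\<^bsub>M\<^esub> x \<in> H"
  shows "submodule H R M"
proof -
  have inv: "\<ominus>\<^bsub>M\<^esub> x \<in> H" if "x \<in> H" for x
  proof -
    have x: "x \<in> carrier M" using that assms(1) by auto
    have z: "\<zero> \<odot>\<^bsub>M\<^esub> x = \<zero>\<^bsub>M\<^esub>"
    proof -
      have "\<zero> \<odot>\<^bsub>M\<^esub> x \<oplus>\<^bsub>M\<^esub> \<zero> \<odot>\<^bsub>M\<^esub> x = \<zero> \<odot>\<^bsub>M\<^esub> x"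
        using smult_l_distr[of \<zero> \<zero> x] x by simp
      then show ?thesis using x by (metis M.add.r_cancel_one' R.zero_closed smult_closed)
    qed
    have "(\<ominus> \<one>) \<odot>\<^bsub>M\<^esub> x \<oplus>\<^bsub>M\<^esub> x = (\<ominus> \<one> \<oplus> \<one>) \<odot>\<^bsub>M\<^esub> x"
      using x smult_l_distr[of "\<ominus> \<one>" \<one> x] by simp
    also have "\<dots> = \<zero>\<^bsub>M\<^esub>" using z by (simp add: R.l_neg)
    finally have "\<ominus>\<^bsub>M\<^esub> x = (\<ominus> \<one>) \<odot>\<^bsub>M\<^esub> x" using x by (simp add: M.minus_equality)
    then show ?thesis using smult[of "\<ominus> \<one>" x] that by simp
  qed
  show ?thesis
    by (intro submodule.intro subgroup.intro submodule_axioms.intro)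
      (use assms inv in \<open>simp_all add: a_inv_def\<close>)
qed

lemma (in left_module) finite_length_embeds:
  assumes "finite_length R M"
  shows "\<exists>j :: 'b \<Rightarrow> nat \<Rightarrow> 'a. inj_on j (carrier M)"
proof -
  obtain n F where F0: "F 0 = {\<zero>\<^bsub>M\<^esub>}" and Fn: "F n = carrier M"
    and sub: "\<And>i. i \<le> n \<Longrightarrow> submodule (F i) R M"
    and lt: "\<And>i. i < n \<Longrightarrow> F i \<subset> F (Suc i)"
    and simple: "\<And>i N. \<lbrakk>i < n; submodule N R M; F i \<subseteq> N; N \<subseteq> F (Suc i)\<rbrakk> \<Longrightarrow> N = F i \<or> N = F (Suc i)"
    using assms unfolding finite_length_def by metis
  define x where "x i = (SOME y. y \<in> F (Suc i) - F i)" for i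
  have x: "x i \<in> F (Suc i)" "x i \<notin> F i" if "i < n" for i
  proof -
    have "\<exists>y. y \<in> F (Suc i) - F i" using lt[OF that] by auto
    from someI_ex[OF this] show "x i \<in> F (Suc i)" "x i \<notin> F i" by (auto simp: x_def)
  qed
  have Fsub: "F i \<subseteq> carrier M" if "i \<le> n" for i
    using subgroup.subset[OF submodule.axioms(1)[OF sub[OF that]]] by simp
  define s :: "nat \<Rightarrow> (nat \<Rightarrow> 'a) \<Rightarrow> 'b"
    where "s i c = rec_nat \<zero>\<^bsub>M\<^esub> (\<lambda>j y. y \<oplus>\<^bsub>M\<^esub> c j \<odot>\<^bsub>M\<^esub> x j) i" for i c
  have s0: "s 0 c = \<zero>\<^bsub>M\<^esub>" and sS: "s (Suc i) c = s i c \<oplus>\<^bsub>M\<^esub> c i \<odot>\<^bsub>M\<^esub> x i" for i c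
    by (simp_all add: s_def)
  have s_upd: "s i (c(k := a)) = s i c" if "i \<le> k" for i c k a
    using that by (induction i) (auto simp: s0 sS)
  have gen: "F i \<subseteq> range (s i)" if "i \<le> n" for i
    using that
  proof (induction i)
    case 0
    then show ?case by (auto simp: F0 s0)
  next
    case (Suc i)
    then have i: "i < n" and le: "i \<le> n" by auto
    interpret S: submodule "F i" R M using sub[OF le] .
    interpret T: submodule "F (Suc i)" R M using sub[OF Suc.prems] .
    have xM: "x i \<in> carrier M" using x(1)[OF i] Fsub[OF Suc.prems] by auto
    have zx: "\<zero> \<odot>\<^bsub>M\<^esub> x i = \<zero>\<^bsub>M\<^esub>"
    proof -
      have "\<zero> \<odot>\<^bsub>M\<^esub> x i \<oplus>\<^bsub>M\<^esub> \<zero> \<odot>\<^bsub>M\<^esub> x i = \<zero> \<odot>\<^bsub>M\<^esub> x i"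
        using smult_l_distr[of \<zero> \<zero> "x i"] xM by simp
      then show ?thesis using xM by (metis M.add.r_cancel_one' R.zero_closed smult_closed)
    qed
    define N where "N = {y \<oplus>\<^bsub>M\<^esub> a \<odot>\<^bsub>M\<^esub> x i | y a. y \<in> F i \<and> a \<in> carrier R}"
    have FM: "\<And>y. y \<in> F i \<Longrightarrow> y \<in> carrier M" using Fsub[OF le] by auto
    have zF: "\<zero>\<^bsub>M\<^esub> \<in> F i" using S.one_closed by simp
    have FN: "F i \<subseteq> N"
    proof
      fix y assume y: "y \<in> F i"
      then have "y = y \<oplus>\<^bsub>M\<^esub> \<zero> \<odot>\<^bsub>M\<^esub> x i" using FM zx by simp
      then show "y \<in> N" using y unfolding N_def by blast
    qed
    have xN: "x i \<in> N"
    proof -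
      have "x i = \<zero>\<^bsub>M\<^esub> \<oplus>\<^bsub>M\<^esub> \<one> \<odot>\<^bsub>M\<^esub> x i" using xM by simp
      then show ?thesis using zF unfolding N_def by blast
    qed
    have NF: "N \<subseteq> F (Suc i)"
    proof
      fix z assume "z \<in> N"
      then obtain y a where z: "z = y \<oplus>\<^bsub>M\<^esub> a \<odot>\<^bsub>M\<^esub> x i" "y \<in> F i" "a \<in> carrier R"
        unfolding N_def by blast
      then have "y \<in> F (Suc i)" "a \<odot>\<^bsub>M\<^esub> x i \<in> F (Suc i)"
        using lt[OF i] T.smult_closed x(1)[OF i] by auto
      then show "z \<in> F (Suc i)" using T.m_closed[of y "a \<odot>\<^bsub>M\<^esub> x i"] z by simp
    qed
    have "submodule N R M"
    proof (rule module_submoduleI)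
      show "N \<subseteq> carrier M" using NF Fsub[OF Suc.prems] by auto
      show "\<zero>\<^bsub>M\<^esub> \<in> N" using FN zF by auto
    next
      fix u v assume "u \<in> N" "v \<in> N"
      then obtain y a z b where u: "u = y \<oplus>\<^bsub>M\<^esub> a \<odot>\<^bsub>M\<^esub> x i" "y \<in> F i" "a \<in> carrier R"
        and v: "v = z \<oplus>\<^bsub>M\<^esub> b \<odot>\<^bsub>M\<^esub> x i" "z \<in> F i" "b \<in> carrier R"
        unfolding N_def by blast
      have "u \<oplus>\<^bsub>M\<^esub> v = (y \<oplus>\<^bsub>M\<^esub> z) \<oplus>\<^bsub>M\<^esub> (a \<oplus> b) \<odot>\<^bsub>M\<^esub> x i"
        using u v FM xM by (simp add: smult_l_distr M.a_ac)
      moreover have "y \<oplus>\<^bsub>M\<^esub> z \<in> F i" using S.m_closed[of y z] u v by simp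
      ultimately show "u \<oplus>\<^bsub>M\<^esub> v \<in> N" using u v unfolding N_def by blast
    next
      fix r u assume r: "r \<in> carrier R" and "u \<in> N"
      then obtain y a where u: "u = y \<oplus>\<^bsub>M\<^esub> a \<odot>\<^bsub>M\<^esub> x i" "y \<in> F i" "a \<in> carrier R"
        unfolding N_def by blast
      have "r \<odot>\<^bsub>M\<^esub> u = r \<odot>\<^bsub>M\<^esub> y \<oplus>\<^bsub>M\<^esub> (r \<otimes> a) \<odot>\<^bsub>M\<^esub> x i"
        using u r FM xM by (simp add: smult_r_distr smult_assoc1)
      moreover have "r \<odot>\<^bsub>M\<^esub> y \<in> F i" using S.smult_closed r u by simp
      ultimately show "r \<odot>\<^bsub>M\<^esub> u \<in> N" using u r unfolding N_def by blast
    qed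
    then have N: "F (Suc i) = N" using simple[OF i _ FN NF] xN x(2)[OF i] by auto
    show ?case
    proof
      fix z assume "z \<in> F (Suc i)"
      then obtain y a where z: "z = y \<oplus>\<^bsub>M\<^esub> a \<odot>\<^bsub>M\<^esub> x i" "y \<in> F i"
        unfolding N N_def by blast
      obtain c where "y = s i c" using Suc.IH[OF le] z by auto
      then have "z = s (Suc i) (c(i := a))" using z s_upd[of i i c a] by (simp add: sS)
      then show "z \<in> range (s (Suc i))" by blast
    qed
  qed
  have "inj_on (inv_into UNIV (s n)) (carrier M)"
    using gen[of n] Fn by (auto intro!: inj_on_inv_into)
  then show ?thesis by blast
qed

definition copy_module :: "('b \<Rightarrow> 'c) \<Rightarrow> ('a, 'b, 'm) module_scheme \<Rightarrow> ('a, 'c) module" where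
  "copy_module j M = (let i = inv_into (carrier M) j in
     \<lparr>carrier = j ` carrier M, mult = undefined, one = undefined, zero = j \<zero>\<^bsub>M\<^esub>,
      add = (\<lambda>x y. j (i x \<oplus>\<^bsub>M\<^esub> i y)), smult = (\<lambda>a x. j (a \<odot>\<^bsub>M\<^esub> i x))\<rparr>)"

context left_module
begin

context
  fixes j :: "'b \<Rightarrow> 'c" and i M'
  assumes inj: "inj_on j (carrier M)"
  defines "M' \<equiv> copy_module j M" and "i \<equiv> inv_into (carrier M) j"
begin

lemma copy_simps:
  "carrier M' = j ` carrier M" "\<zero>\<^bsub>M'\<^esub> = j \<zero>\<^bsub>M\<^esub>"
  "x \<in> carrier M \<Longrightarrow> i (j x) = x"
  "\<lbrakk>x \<in> carrier M; y \<in> carrier M\<rbrakk> \<Longrightarrow> j x \<oplus>\<^bsub>M'\<^esub> j y = j (x \<oplus>\<^bsub>M\<^esub> y)"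
  "x \<in> carrier M \<Longrightarrow> a \<odot>\<^bsub>M'\<^esub> j x = j (a \<odot>\<^bsub>M\<^esub> x)"
  using inj by (simp_all add: M'_def i_def copy_module_def Let_def)

lemma left_module_copy: "left_module R M'"
proof -
  have ab: "abelian_group M'"
  proof (rule abelian_groupI)
    fix x assume "x \<in> carrier M'"
    then obtain y where y: "y \<in> carrier M" "x = j y" by (auto simp: copy_simps)
    then have "j (\<ominus>\<^bsub>M\<^esub> y) \<oplus>\<^bsub>M'\<^esub> x = \<zero>\<^bsub>M'\<^esub>" by (simp add: copy_simps M.l_neg)
    then show "\<exists>y\<in>carrier M'. y \<oplus>\<^bsub>M'\<^esub> x = \<zero>\<^bsub>M'\<^esub>" using y by (auto simp: copy_simps)
  qed (auto simp: copy_simps M.a_ac)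
  show ?thesis
    by (intro left_module.intro left_module_axioms.intro ab R.ring_axioms)
      (auto simp: copy_simps smult_l_distr smult_r_distr smult_assoc1)
qed

lemma submodule_copy:
  assumes "submodule N R M"
  shows "submodule (j ` N) R M'"
proof -
  interpret N: submodule N R M by fact
  have NM: "N \<subseteq> carrier M" using N.subset by simp
  show ?thesis
  proof (rule left_module.module_submoduleI[OF left_module_copy])
    show "j ` N \<subseteq> carrier M'" using NM by (auto simp: copy_simps)
    show "\<zero>\<^bsub>M'\<^esub> \<in> j ` N" using N.one_closed by (simp add: copy_simps)
    show "a \<oplus>\<^bsub>M'\<^esub> b \<in> j ` N" if "a \<in> j ` N" "b \<in> j ` N" for a b
      using that NM N.m_closed by (auto simp: copy_simps subset_iff)
    show "a \<odot>\<^bsub>M'\<^esub> b \<in> j ` N" if "a \<in> carrier R" "b \<in> j ` N" for a b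
      using that NM by (auto simp: copy_simps subset_iff)
  qed
qed

lemma submodule_copy':
  assumes "submodule N R M'"
  shows "submodule (i ` N) R M" "N = j ` i ` N" "N \<subseteq> carrier M'"
proof -
  interpret N: submodule N R M' by fact
  show NM: "N \<subseteq> carrier M'" using N.subset by simp
  show "N = j ` i ` N" using NM by (force simp: copy_simps)
  show "submodule (i ` N) R M"
  proof (rule module_submoduleI)
    show "i ` N \<subseteq> carrier M" using NM by (auto simp: copy_simps)
    have "i \<zero>\<^bsub>M'\<^esub> = \<zero>\<^bsub>M\<^esub>" "\<zero>\<^bsub>M'\<^esub> \<in> N"
      using N.one_closed by (auto simp: copy_simps)
    then show "\<zero>\<^bsub>M\<^esub> \<in> i ` N" by force
  next
    fix a b assume "a \<in> i ` N" "b \<in> i ` N"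
    then obtain u v where uv: "u \<in> N" "a = i u" "v \<in> N" "b = i v" by blast
    have "u \<in> j ` carrier M" "v \<in> j ` carrier M"
      using subsetD[OF NM uv(1)] subsetD[OF NM uv(3)] by (simp_all only: copy_simps(1))
    then obtain p q where pq: "u = j p" "p \<in> carrier M" "v = j q" "q \<in> carrier M"
      by (elim imageE)
    have "j (p \<oplus>\<^bsub>M\<^esub> q) \<in> N"
      using N.m_closed[OF uv(1,3)] pq by (simp add: copy_simps(4))
    then have "i (j (p \<oplus>\<^bsub>M\<^esub> q)) \<in> i ` N" by (rule imageI)
    then show "a \<oplus>\<^bsub>M\<^esub> b \<in> i ` N" using uv pq by (simp add: copy_simps(3))
  next
    fix a b assume a: "a \<in> carrier R" and "b \<in> i ` N"
    then obtain u where u: "u \<in> N" "b = i u" by blast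
    have "u \<in> j ` carrier M"
      using subsetD[OF NM u(1)] by (simp only: copy_simps(1))
    then obtain p where p: "u = j p" "p \<in> carrier M" by (elim imageE)
    have "j (a \<odot>\<^bsub>M\<^esub> p) \<in> N"
      using N.smult_closed[OF a u(1)] p by (simp add: copy_simps(5))
    then have "i (j (a \<odot>\<^bsub>M\<^esub> p)) \<in> i ` N" by (rule imageI)
    then show "a \<odot>\<^bsub>M\<^esub> b \<in> i ` N" using a u p by (simp add: copy_simps(3))
  qed
qed

lemma finite_length_copy:
  assumes "finite_length R M"
  shows "finite_length R M'"
proof -
  obtain n F where F0: "F 0 = {\<zero>\<^bsub>M\<^esub>}" and Fn: "F n = carrier M"
    and sub: "\<And>i. i \<le> n \<Longrightarrow> submodule (F i) R M"
    and lt: "\<And>i. i < n \<Longrightarrow> F i \<subset> F (Suc i)"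
    and simple: "\<And>i N. \<lbrakk>i < n; submodule N R M; F i \<subseteq> N; N \<subseteq> F (Suc i)\<rbrakk> \<Longrightarrow> N = F i \<or> N = F (Suc i)"
    using assms unfolding finite_length_def by metis
  have FM: "F k \<subseteq> carrier M" if "k \<le> n" for k
    using subgroup.subset[OF submodule.axioms(1)[OF sub[OF that]]] by simp
  have ij: "i ` j ` A = A" if "A \<subseteq> carrier M" for A
    using that by (force simp: copy_simps image_image subset_iff)
  have 1: "j ` F k \<subset> j ` F (Suc k)" if "k < n" for k
    using lt[OF that] FM[of k] FM[of "Suc k"] that ij
    by (metis Suc_leI image_mono less_imp_le psubset_eq)
  have 2: "N = j ` F k \<or> N = j ` F (Suc k)"
    if k: "k < n" and N: "submodule N R M'" "j ` F k \<subseteq> N" "N \<subseteq> j ` F (Suc k)" for k N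
  proof -
    have "F k \<subseteq> i ` N" "i ` N \<subseteq> F (Suc k)"
      using image_mono[OF N(2), of i] image_mono[OF N(3), of i] ij FM[of k] FM[of "Suc k"] k
      by auto
    from simple[OF k submodule_copy'(1)[OF N(1)] this] show ?thesis
      using submodule_copy'(2)[OF N(1)] by metis
  qed
  show ?thesis
    unfolding finite_length_def
    by (rule exI[of _ n], rule exI[of _ "\<lambda>k. j ` F k"])
      (use F0 Fn sub submodule_copy 1 2 in \<open>auto simp: copy_simps\<close>)
qed

end

end

lemma degenerationI:
  fixes R :: "('a, 'r) ring_scheme" and U :: "('a, 'u, 'm) module_scheme"
  assumes X: "left_module R X" "finite_length R X" and Y: "left_module R Y" "finite_length R Y"
    and U: "left_module R U" "finite_length R U"
    and ex: "short_exact R U (direct_sum X U) Y f g"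
  shows "degeneration R X Y"
proof -
  interpret U: left_module R U by fact
  obtain j :: "'u \<Rightarrow> nat \<Rightarrow> 'a" where j: "inj_on j (carrier U)"
    using U.finite_length_embeds[OF U(2)] by blast
  define U' where "U' = copy_module j U"
  define i where "i = inv_into (carrier U) j"
  note s = U.copy_simps[OF j, folded U'_def i_def]
  define f' where "f' z = (let (x, u) = f (i z) in (x, j u))" for z
  define g' where "g' = (\<lambda>(x, z). g (x, i z))"
  have f: "f \<in> mod_hom R U (direct_sum X U)" "inj_on f (carrier U)"
    and g: "g \<in> mod_hom R (direct_sum X U) Y"
    and k: "f ` carrier U = a_kernel (direct_sum X U) Y g"
    and sg: "g ` carrier (direct_sum X U) = carrier Y"
    using ex by (auto simp: short_exact_def mod_mono_def)
  have fj: "f' (j u) = (fst (f u), j (snd (f u)))" if "u \<in> carrier U" for u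
    using that by (simp add: f'_def s split: prod.split)
  have gj: "g' (x, j u) = g (x, u)" if "u \<in> carrier U" for x u
    using that by (simp add: g'_def s)
  have fc: "fst (f u) \<in> carrier X" "snd (f u) \<in> carrier U" if "u \<in> carrier U" for u
    using f(1) that by (auto simp: mod_hom_def direct_sum_def Pi_iff mem_Times_iff)
  have fadd: "fst (f (u \<oplus>\<^bsub>U\<^esub> v)) = fst (f u) \<oplus>\<^bsub>X\<^esub> fst (f v)"
    "snd (f (u \<oplus>\<^bsub>U\<^esub> v)) = snd (f u) \<oplus>\<^bsub>U\<^esub> snd (f v)" if "u \<in> carrier U" "v \<in> carrier U" for u v
    using f(1) that by (auto simp: mod_hom_def direct_sum_def split: prod.splits)
  have fsm: "fst (f (a \<odot>\<^bsub>U\<^esub> u)) = a \<odot>\<^bsub>X\<^esub> fst (f u)"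
    "snd (f (a \<odot>\<^bsub>U\<^esub> u)) = a \<odot>\<^bsub>U\<^esub> snd (f u)" if "a \<in> carrier R" "u \<in> carrier U" for a u
    using f(1) that by (auto simp: mod_hom_def direct_sum_def split: prod.splits)
  have gc: "g (x, u) \<in> carrier Y" if "x \<in> carrier X" "u \<in> carrier U" for x u
    using g that by (auto simp: mod_hom_def direct_sum_def)
  have gadd: "g (x \<oplus>\<^bsub>X\<^esub> y, u \<oplus>\<^bsub>U\<^esub> v) = g (x, u) \<oplus>\<^bsub>Y\<^esub> g (y, v)"
    if "x \<in> carrier X" "y \<in> carrier X" "u \<in> carrier U" "v \<in> carrier U" for x y u v
    using g that by (force simp: mod_hom_def direct_sum_def)
  have gsm: "g (a \<odot>\<^bsub>X\<^esub> x, a \<odot>\<^bsub>U\<^esub> u) = a \<odot>\<^bsub>Y\<^esub> g (x, u)"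
    if "a \<in> carrier R" "x \<in> carrier X" "u \<in> carrier U" for a x u
    using g that by (force simp: mod_hom_def direct_sum_def)
  have 1: "f' \<in> mod_hom R U' (direct_sum X U')"
    by (auto simp: mod_hom_def direct_sum_def s fj fc fadd fsm)
  have 2: "inj_on f' (carrier U')"
  proof (rule inj_onI)
    fix a b assume "a \<in> carrier U'" "b \<in> carrier U'" "f' a = f' b"
    then obtain u v where uv: "u \<in> carrier U" "v \<in> carrier U" "a = j u" "b = j v" "f' a = f' b"
      by (auto simp: s)
    then have "fst (f u) = fst (f v)" "snd (f u) = snd (f v)"
      using fc by (auto simp: fj dest: inj_onD[OF j])
    then show "a = b" using uv inj_onD[OF f(2), of u v] by (simp add: prod_eq_iff)
  qed
  have 3: "g' \<in> mod_hom R (direct_sum X U') Y"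
    by (auto simp: mod_hom_def direct_sum_def s gj gc gadd gsm)
  have 4: "g' ` carrier (direct_sum X U') = carrier Y"
  proof -
    have "carrier (direct_sum X U') = (\<lambda>(x, u). (x, j u)) ` carrier (direct_sum X U)"
      by (auto simp: direct_sum_def s image_iff)
    moreover have "g' ` (\<lambda>(x, u). (x, j u)) ` carrier (direct_sum X U) = g ` carrier (direct_sum X U)"
      unfolding image_image by (rule image_cong) (auto simp: direct_sum_def gj)
    ultimately show ?thesis using sg by simp
  qed
  have 5: "f' ` carrier U' = a_kernel (direct_sum X U') Y g'"
  proof -
    have "f' ` carrier U' = (\<lambda>(x, u). (x, j u)) ` f ` carrier U"
      unfolding s image_image by (rule image_cong) (auto simp: fj split: prod.split)
    also have "\<dots> = a_kernel (direct_sum X U') Y g'"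
      unfolding k by (auto simp: a_kernel_def kernel_def direct_sum_def s gj image_iff)
    finally show ?thesis .
  qed
  show ?thesis
    unfolding degeneration_def short_exact_def mod_mono_def
    using X Y 1 2 3 4 5 U.left_module_copy[OF j] U.finite_length_copy[OF j U(2)]
    unfolding U'_def[symmetric] by blast
qed


section \<open>The quotient and \<open>Ext\<^sup>1\<close> are well defined\<close>

lemma (in left_module) left_module_quotient:
  assumes "submodule N R M"
  shows "left_module R (quotient_module M N)" "(\<lambda>x. N +>\<^bsub>M\<^esub> x) \<in> mod_hom R M (quotient_module M N)"
proof -
  interpret N: submodule N R M by fact
  interpret N: abelian_subgroup N M
    by (rule abelian_subgroupI2[OF M.a_comm_group N.subgroup_axioms])
  let ?Q = "quotient_module M N"
  have car: "carrier ?Q = (\<lambda>x. N +>\<^bsub>M\<^esub> x) ` carrier M" and zero: "\<zero>\<^bsub>?Q\<^esub> = N +>\<^bsub>M\<^esub> \<zero>\<^bsub>M\<^esub>"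
    using M.a_coset_add_zero[OF N.a_subset] by (auto simp: quotient_module_def A_RCOSETS_def')
  have add: "(N +>\<^bsub>M\<^esub> x) \<oplus>\<^bsub>?Q\<^esub> (N +>\<^bsub>M\<^esub> y) = N +>\<^bsub>M\<^esub> (x \<oplus>\<^bsub>M\<^esub> y)"
    if "x \<in> carrier M" "y \<in> carrier M" for x y
    using N.a_rcos_sum[OF that] by (simp add: quotient_module_def)
  have smult: "a \<odot>\<^bsub>?Q\<^esub> (N +>\<^bsub>M\<^esub> x) = N +>\<^bsub>M\<^esub> (a \<odot>\<^bsub>M\<^esub> x)"
    if a: "a \<in> carrier R" and x: "x \<in> carrier M" for a x
  proof -
    have "N +>\<^bsub>M\<^esub> (a \<odot>\<^bsub>M\<^esub> y) = N +>\<^bsub>M\<^esub> (a \<odot>\<^bsub>M\<^esub> x)" if "y \<in> N +>\<^bsub>M\<^esub> x" for y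
    proof -
      obtain n where n: "n \<in> N" "y = n \<oplus>\<^bsub>M\<^esub> x" using \<open>y \<in> N +>\<^bsub>M\<^esub> x\<close> by (auto simp: a_r_coset_def')
      have "a \<odot>\<^bsub>M\<^esub> y = a \<odot>\<^bsub>M\<^esub> n \<oplus>\<^bsub>M\<^esub> a \<odot>\<^bsub>M\<^esub> x"
        using n a x N.a_subset by (auto simp: smult_r_distr subset_iff)
      then have "a \<odot>\<^bsub>M\<^esub> y \<in> N +>\<^bsub>M\<^esub> (a \<odot>\<^bsub>M\<^esub> x)"
        using N.smult_closed[OF a n(1)] by (auto simp: a_r_coset_def')
      then show ?thesis
        using N.a_repr_independence'[of "a \<odot>\<^bsub>M\<^esub> y" "a \<odot>\<^bsub>M\<^esub> x"] a x by simp
    qed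
    then have "(\<Union>y\<in>N +>\<^bsub>M\<^esub> x. N +>\<^bsub>M\<^esub> (a \<odot>\<^bsub>M\<^esub> y)) = (\<Union>y\<in>N +>\<^bsub>M\<^esub> x. N +>\<^bsub>M\<^esub> (a \<odot>\<^bsub>M\<^esub> x))"
      by (rule SUP_cong[OF refl])
    also have "\<dots> = N +>\<^bsub>M\<^esub> (a \<odot>\<^bsub>M\<^esub> x)" using N.a_rcos_self[OF x] by blast
    finally show ?thesis by (simp add: quotient_module_def)
  qed
  have ab: "abelian_group ?Q"
  proof (rule abelian_groupI)
    fix C assume "C \<in> carrier ?Q"
    then obtain x where x: "x \<in> carrier M" "C = N +>\<^bsub>M\<^esub> x" by (auto simp: car)
    then have "(N +>\<^bsub>M\<^esub> (\<ominus>\<^bsub>M\<^esub> x)) \<oplus>\<^bsub>?Q\<^esub> C = \<zero>\<^bsub>?Q\<^esub>" by (simp add: add zero M.l_neg)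
    then show "\<exists>D\<in>carrier ?Q. D \<oplus>\<^bsub>?Q\<^esub> C = \<zero>\<^bsub>?Q\<^esub>" using x by (auto simp: car)
  qed (auto simp: car zero add M.a_ac)
  show "left_module R ?Q"
    by (intro left_module.intro left_module_axioms.intro ab R.ring_axioms)
      (auto simp: car add smult smult_l_distr smult_r_distr smult_assoc1)
  show "(\<lambda>x. N +>\<^bsub>M\<^esub> x) \<in> mod_hom R M ?Q"
    by (auto simp: mod_hom_def car add smult)
qed

lemma a_kernel_iff: "x \<in> a_kernel M N f \<longleftrightarrow> x \<in> carrier M \<and> f x = \<zero>\<^bsub>N\<^esub>"
  by (auto simp: a_kernel_def kernel_def)

lemma hom_group_comm_group:
  assumes M: "left_module R M" and N: "left_module R N"
  shows "comm_group (hom_group R M N)"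
proof -
  interpret M: left_module R M by fact
  interpret N: left_module R N by fact
  have sz: "a \<odot>\<^bsub>N\<^esub> \<zero>\<^bsub>N\<^esub> = \<zero>\<^bsub>N\<^esub>" if "a \<in> carrier R" for a
    using N.smult_r_distr[of a "\<zero>\<^bsub>N\<^esub>" "\<zero>\<^bsub>N\<^esub>"] that
    by (metis N.add.r_cancel_one' N.M.l_zero N.smult_closed N.M.zero_closed)
  have sm: "a \<odot>\<^bsub>N\<^esub> (\<ominus>\<^bsub>N\<^esub> y) = \<ominus>\<^bsub>N\<^esub> (a \<odot>\<^bsub>N\<^esub> y)" if "a \<in> carrier R" "y \<in> carrier N" for a y
    using N.smult_r_distr[of a "\<ominus>\<^bsub>N\<^esub> y" y] that sz
    by (metis N.M.a_inv_closed N.M.l_neg N.M.minus_equality N.smult_closed)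
  show ?thesis
  proof (rule comm_groupI)
    fix f assume f: "f \<in> carrier (hom_group R M N)"
    let ?g = "\<lambda>x\<in>carrier M. \<ominus>\<^bsub>N\<^esub> f x"
    have "?g \<in> carrier (hom_group R M N)"
      using f by (auto simp: hom_group_def mod_hom_def Pi_iff sm N.M.minus_add)
    moreover have "?g \<otimes>\<^bsub>hom_group R M N\<^esub> f = \<one>\<^bsub>hom_group R M N\<^esub>"
      using f by (auto simp: hom_group_def mod_hom_def Pi_iff N.M.l_neg)
    ultimately show "\<exists>g\<in>carrier (hom_group R M N). g \<otimes>\<^bsub>hom_group R M N\<^esub> f = \<one>\<^bsub>hom_group R M N\<^esub>"
      by blast
  qed (auto simp: hom_group_def mod_hom_def Pi_iff N.smult_r_distr sz N.M.a_ac
      intro!: extensionalityI[where A = "carrier M"])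
qed

lemma left_module_free_cover:
  assumes R: "ring R"
  shows "left_module R (free_cover R M)"
proof -
  interpret R: ring R by fact
  have fin: "finite {x. (if x \<in> carrier M then c x \<oplus>\<^bsub>R\<^esub> d x else \<zero>\<^bsub>R\<^esub>) \<noteq> \<zero>\<^bsub>R\<^esub>}"
    if "finite {x. c x \<noteq> \<zero>\<^bsub>R\<^esub>}" "finite {x. d x \<noteq> \<zero>\<^bsub>R\<^esub>}" for c d
    by (rule finite_subset[OF _ finite_UnI[OF that]]) auto
  have fin': "finite {x. (if x \<in> carrier M then a \<otimes>\<^bsub>R\<^esub> c x else \<zero>\<^bsub>R\<^esub>) \<noteq> \<zero>\<^bsub>R\<^esub>}"
    if "finite {x. c x \<noteq> \<zero>\<^bsub>R\<^esub>}" "a \<in> carrier R" for a c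
    by (rule finite_subset[OF _ that(1)]) (use that in auto)
  have ab: "abelian_group (free_cover R M)"
  proof (rule abelian_groupI)
    fix c assume c: "c \<in> carrier (free_cover R M)"
    let ?d = "\<lambda>x. if x \<in> carrier M then \<ominus>\<^bsub>R\<^esub> c x else \<zero>\<^bsub>R\<^esub>"
    have "finite {x. ?d x \<noteq> \<zero>\<^bsub>R\<^esub>}"
      by (rule finite_subset[of _ "{x. c x \<noteq> \<zero>\<^bsub>R\<^esub>}"]) (use c in \<open>auto simp: free_cover_def\<close>)
    then have "?d \<in> carrier (free_cover R M)"
      using c by (auto simp: free_cover_def)
    moreover have "?d \<oplus>\<^bsub>free_cover R M\<^esub> c = \<zero>\<^bsub>free_cover R M\<^esub>"
      using c by (auto simp: free_cover_def fun_eq_iff R.l_neg)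
    ultimately show "\<exists>d\<in>carrier (free_cover R M). d \<oplus>\<^bsub>free_cover R M\<^esub> c = \<zero>\<^bsub>free_cover R M\<^esub>"
      by blast
  qed (use fin in \<open>auto simp: free_cover_def fun_eq_iff R.a_ac\<close>)
  show ?thesis
    by (intro left_module.intro left_module_axioms.intro ab R)
      (use fin' in \<open>auto simp: free_cover_def fun_eq_iff R.l_distr R.r_distr R.m_assoc\<close>)
qed

lemma free_cover_map_hom:
  assumes M: "left_module R M"
  shows "free_cover_map R M \<in> mod_hom R (free_cover R M) M"
proof -
  interpret M: left_module R M by fact
  have zl: "\<zero>\<^bsub>R\<^esub> \<odot>\<^bsub>M\<^esub> x = \<zero>\<^bsub>M\<^esub>" if "x \<in> carrier M" for x
    using M.smult_l_distr[of "\<zero>\<^bsub>R\<^esub>" "\<zero>\<^bsub>R\<^esub>" x] that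
    by (metis M.add.r_cancel_one' M.R.l_zero M.smult_closed M.R.zero_closed)
  have zr: "a \<odot>\<^bsub>M\<^esub> \<zero>\<^bsub>M\<^esub> = \<zero>\<^bsub>M\<^esub>" if "a \<in> carrier R" for a
    using M.smult_r_distr[of a "\<zero>\<^bsub>M\<^esub>" "\<zero>\<^bsub>M\<^esub>"] that
    by (metis M.add.r_cancel_one' M.M.l_zero M.smult_closed M.M.zero_closed)
  have ext: "free_cover_map R M c = (\<Oplus>\<^bsub>M\<^esub>x\<in>A. c x \<odot>\<^bsub>M\<^esub> x)"
    if c: "c \<in> carrier (free_cover R M)" and A: "finite A" "{x. c x \<noteq> \<zero>\<^bsub>R\<^esub>} \<subseteq> A" "A \<subseteq> carrier M" for c A
    unfolding free_cover_map_def
    by (rule M.add.finprod_mono_neutral_cong_left)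
      (use c A zl in \<open>auto simp: free_cover_def\<close>)
  have smsum: "a \<odot>\<^bsub>M\<^esub> (\<Oplus>\<^bsub>M\<^esub>x\<in>A. f x) = (\<Oplus>\<^bsub>M\<^esub>x\<in>A. a \<odot>\<^bsub>M\<^esub> f x)"
    if "finite A" "f \<in> A \<rightarrow> carrier M" "a \<in> carrier R" for a A f
    using that
  proof (induction A rule: finite_induct)
    case empty
    then show ?case by (simp add: zr)
  next
    case (insert x A)
    then have "f \<in> A \<rightarrow> carrier M" "f x \<in> carrier M" by auto
    then show ?case using insert
      by (auto simp: M.smult_r_distr M.finsum_insert M.finsum_closed Pi_iff)
  qed
  have sub: "finite {x. c x \<noteq> \<zero>\<^bsub>R\<^esub>}" "{x. c x \<noteq> \<zero>\<^bsub>R\<^esub>} \<subseteq> carrier M"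
    if "c \<in> carrier (free_cover R M)" for c
    using that by (auto simp: free_cover_def)
  interpret F: left_module R "free_cover R M" by (rule left_module_free_cover) (rule M.R.ring_axioms)
  show ?thesis
    unfolding mod_hom_def
  proof (intro CollectI conjI ballI)
    show "free_cover_map R M \<in> carrier (free_cover R M) \<rightarrow> carrier M"
      by (auto simp: free_cover_map_def free_cover_def Pi_iff intro!: M.finsum_closed)
  next
    fix c d assume cd: "c \<in> carrier (free_cover R M)" "d \<in> carrier (free_cover R M)"
    define A where "A = {x. c x \<noteq> \<zero>\<^bsub>R\<^esub>} \<union> {x. d x \<noteq> \<zero>\<^bsub>R\<^esub>}"
    have A: "finite A" "A \<subseteq> carrier M" using sub[OF cd(1)] sub[OF cd(2)] by (auto simp: A_def)
    have s: "{x. (c \<oplus>\<^bsub>free_cover R M\<^esub> d) x \<noteq> \<zero>\<^bsub>R\<^esub>} \<subseteq> A"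
      by (auto simp: A_def free_cover_def)
    have c: "c x \<in> carrier R" "d x \<in> carrier R" if "x \<in> A" for x
      using cd A that by (auto simp: free_cover_def)
    have "free_cover_map R M (c \<oplus>\<^bsub>free_cover R M\<^esub> d) = (\<Oplus>\<^bsub>M\<^esub>x\<in>A. (c \<oplus>\<^bsub>free_cover R M\<^esub> d) x \<odot>\<^bsub>M\<^esub> x)"
      using ext[OF F.a_closed[OF cd] A(1) s A(2)] .
    also have "\<dots> = (\<Oplus>\<^bsub>M\<^esub>x\<in>A. c x \<odot>\<^bsub>M\<^esub> x \<oplus>\<^bsub>M\<^esub> d x \<odot>\<^bsub>M\<^esub> x)"
      by (rule M.add.finprod_cong') (use A c in \<open>auto simp: free_cover_def M.smult_l_distr subset_iff\<close>)
    also have "\<dots> = (\<Oplus>\<^bsub>M\<^esub>x\<in>A. c x \<odot>\<^bsub>M\<^esub> x) \<oplus>\<^bsub>M\<^esub> (\<Oplus>\<^bsub>M\<^esub>x\<in>A. d x \<odot>\<^bsub>M\<^esub> x)"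
      by (rule M.finsum_addf) (use A c in auto)
    also have "\<dots> = free_cover_map R M c \<oplus>\<^bsub>M\<^esub> free_cover_map R M d"
      using ext[OF cd(1) A(1) _ A(2)] ext[OF cd(2) A(1) _ A(2)] by (simp add: A_def)
    finally show "free_cover_map R M (c \<oplus>\<^bsub>free_cover R M\<^esub> d)
        = free_cover_map R M c \<oplus>\<^bsub>M\<^esub> free_cover_map R M d" .
  next
    fix a c assume a: "a \<in> carrier R" and c: "c \<in> carrier (free_cover R M)"
    let ?A = "{x. c x \<noteq> \<zero>\<^bsub>R\<^esub>}"
    note A = sub[OF c]
    have s: "{x. (a \<odot>\<^bsub>free_cover R M\<^esub> c) x \<noteq> \<zero>\<^bsub>R\<^esub>} \<subseteq> ?A"
      using a by (auto simp: free_cover_def)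
    have cR: "c x \<in> carrier R" if "x \<in> ?A" for x
      using c A that by (auto simp: free_cover_def)
    have "free_cover_map R M (a \<odot>\<^bsub>free_cover R M\<^esub> c) = (\<Oplus>\<^bsub>M\<^esub>x\<in>?A. (a \<odot>\<^bsub>free_cover R M\<^esub> c) x \<odot>\<^bsub>M\<^esub> x)"
      using ext[OF F.smult_closed[OF a c] A(1) s A(2)] .
    also have "\<dots> = (\<Oplus>\<^bsub>M\<^esub>x\<in>?A. a \<odot>\<^bsub>M\<^esub> (c x \<odot>\<^bsub>M\<^esub> x))"
      by (rule M.add.finprod_cong') (use A cR a in \<open>auto simp: free_cover_def M.smult_assoc1 subset_iff\<close>)
    also have "\<dots> = a \<odot>\<^bsub>M\<^esub> free_cover_map R M c"
      unfolding free_cover_map_def using A cR a by (subst smsum) (auto simp: subset_iff)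
    finally show "free_cover_map R M (a \<odot>\<^bsub>free_cover R M\<^esub> c) = a \<odot>\<^bsub>M\<^esub> free_cover_map R M c" .
  qed
qed

lemma left_module_syzygy:
  assumes M: "left_module R M"
  shows "left_module R (syzygy R M)" "carrier (syzygy R M) \<subseteq> carrier (free_cover R M)"
proof -
  interpret M: left_module R M by fact
  interpret F: left_module R "free_cover R M" by (rule left_module_free_cover) (rule M.R.ring_axioms)
  have h: "\<And>c d. \<lbrakk>c \<in> carrier (free_cover R M); d \<in> carrier (free_cover R M)\<rbrakk> \<Longrightarrow>
      free_cover_map R M (c \<oplus>\<^bsub>free_cover R M\<^esub> d) = free_cover_map R M c \<oplus>\<^bsub>M\<^esub> free_cover_map R M d"
    "\<And>a c. \<lbrakk>a \<in> carrier R; c \<in> carrier (free_cover R M)\<rbrakk> \<Longrightarrow>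
      free_cover_map R M (a \<odot>\<^bsub>free_cover R M\<^esub> c) = a \<odot>\<^bsub>M\<^esub> free_cover_map R M c"
    using free_cover_map_hom[OF M] by (auto simp: mod_hom_def)
  have zr: "a \<odot>\<^bsub>M\<^esub> \<zero>\<^bsub>M\<^esub> = \<zero>\<^bsub>M\<^esub>" if "a \<in> carrier R" for a
    using M.smult_r_distr[of a "\<zero>\<^bsub>M\<^esub>" "\<zero>\<^bsub>M\<^esub>"] that
    by (metis M.add.r_cancel_one' M.M.l_zero M.smult_closed M.M.zero_closed)
  let ?K = "a_kernel (free_cover R M) M (free_cover_map R M)"
  have 0: "free_cover_map R M \<zero>\<^bsub>free_cover R M\<^esub> = \<zero>\<^bsub>M\<^esub>"
    by (simp add: free_cover_map_def free_cover_def)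
  have "submodule ?K R (free_cover R M)"
    by (rule F.module_submoduleI) (auto simp: a_kernel_iff h 0 zr)
  then interpret K: submodule ?K R "free_cover R M" .
  show sub: "carrier (syzygy R M) \<subseteq> carrier (free_cover R M)"
    by (auto simp: syzygy_def a_kernel_iff)
  have "comm_group (add_monoid (syzygy R M))"
    using group.subgroup_imp_group[OF F.a_group K.subgroup_axioms] F.a_comm
    by (intro group.group_comm_groupI) (auto simp: syzygy_def a_kernel_iff)
  then have "abelian_group (syzygy R M)"
    by (intro abelian_group.intro abelian_monoid.intro abelian_group_axioms.intro comm_group.axioms(1))
  then show "left_module R (syzygy R M)"
    by (intro left_module.intro left_module_axioms.intro M.R.ring_axioms)
      (use K.smult_closed in \<open>auto simp: syzygy_def a_kernel_iff F.smult_l_distr F.smult_r_distr F.smult_assoc1\<close>)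
qed

lemma Ext1_comm_group:
  assumes M: "left_module R M" and N: "left_module R N"
  shows "comm_group (Ext1 R M N)"
proof -
  interpret M: left_module R M by fact
  interpret N: left_module R N by fact
  note F = left_module_free_cover[OF M.R.ring_axioms, of M]
  note K = left_module_syzygy[OF M]
  interpret GF: comm_group "hom_group R (free_cover R M) N" by (rule hom_group_comm_group[OF F N])
  interpret GK: comm_group "hom_group R (syzygy R M) N" by (rule hom_group_comm_group[OF K(1) N])
  let ?r = "\<lambda>f. restrict f (carrier (syzygy R M))"
  have "?r \<in> hom (hom_group R (free_cover R M) N) (hom_group R (syzygy R M) N)"
  proof (rule homI)
    fix f assume f: "f \<in> carrier (hom_group R (free_cover R M) N)"
    interpret K: left_module R "syzygy R M" by (rule K)
    have ops: "x \<oplus>\<^bsub>syzygy R M\<^esub> y = x \<oplus>\<^bsub>free_cover R M\<^esub> y" "a \<odot>\<^bsub>syzygy R M\<^esub> x = a \<odot>\<^bsub>free_cover R M\<^esub> x" for a x y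
      by (simp_all add: syzygy_def)
    show "?r f \<in> carrier (hom_group R (syzygy R M) N)"
      using f K(2) K.a_closed K.smult_closed
      by (auto simp: hom_group_def mod_hom_def Pi_iff subset_iff ops)
  next
    fix f g
    show "?r (f \<otimes>\<^bsub>hom_group R (free_cover R M) N\<^esub> g) = ?r f \<otimes>\<^bsub>hom_group R (syzygy R M) N\<^esub> ?r g"
      using K(2) by (auto simp: hom_group_def fun_eq_iff)
  qed
  then interpret r: group_hom "hom_group R (free_cover R M) N" "hom_group R (syzygy R M) N" ?r
    by unfold_locales
  show ?thesis
    unfolding Ext1_def by (rule GK.abelian_FactGroup) (rule r.img_is_subgroup)
qed

end

theory Submission
  imports Defs "HOL-Algebra.RingHom"
begin

text \<open>The proof runs through Ringel's ladder construction. Write \<open>f, h : U \<rightarrow> V\<close> for the two monomorphisms, \<open>W\<close> being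
the cokernel of \<open>f\<close>. Iterated pushouts of \<open>f\<close> along \<open>h\<close> give modules \<open>U\<^sub>0 = U\<close>, \<open>U\<^sub>1 = V\<close>, \<open>U\<^sub>2\<close>, ... with
two monomorphisms \<open>U\<^sub>n \<rightarrow> U\<^sub>n\<^sub>+\<^sub>1\<close>: an inclusion, with cokernel \<open>W\<close>, and a shift, with cokernel \<open>V / h(U)\<close>.
If for a single \<open>n\<close> the inclusion splits, then \<open>U\<^sub>n\<^sub>+\<^sub>1\<close> is \<open>W \<oplus> U\<^sub>n\<close>, and the shift turns into an exact
sequence \<open>0 \<rightarrow> U\<^sub>n \<rightarrow> W \<oplus> U\<^sub>n \<rightarrow> V / h(U) \<rightarrow> 0\<close>, which is the degeneration sought
(\<open>degeneration_cokernel\<close>).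

Why some inclusion splits (\<open>split_rung\<close>): all quotients \<open>U\<^sub>i\<^sub>+\<^sub>1 / U\<^sub>i\<close> are isomorphic to \<open>W\<close>, so
\<open>Ext\<^sup>1(W, W) = 0\<close> gives \<open>Ext\<^sup>1(W, U\<^sub>n / U\<^sub>0) = 0\<close>, and the map \<open>Ext\<^sup>1(W, U\<^sub>0) \<rightarrow> Ext\<^sup>1(W, U\<^sub>n)\<close> is
surjective for every \<open>n\<close> (\<open>push_down\<close>). Its kernels form an ascending chain of \<open>k\<close>-submodules of
\<open>Ext\<^sup>1(W, U\<^sub>0)\<close>. Once the chain is stationary, \<open>Ext\<^sup>1(W, U\<^sub>n) \<rightarrow> Ext\<^sup>1(W, U\<^sub>n\<^sub>+\<^sub>1)\<close> is injective. This map
always kills the class of \<open>0 \<rightarrow> U\<^sub>n \<rightarrow> U\<^sub>n\<^sub>+\<^sub>1 \<rightarrow> W \<rightarrow> 0\<close>, so that class is zero.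

In the formal argument a class in \<open>Ext\<^sup>1(W, U\<^sub>0)\<close> that dies in \<open>U\<^sub>n\<close> is
represented by a homomorphism \<open>\<Phi>\<close> from the free cover of \<open>W\<close> to \<open>U\<^sub>n\<close> that maps the syzygy into \<open>U\<^sub>0\<close>.

The ascending chain condition is the place where the artin algebra enters. Let \<open>P\<close> be a free module of
finite rank mapping onto \<open>W\<close>, with kernel \<open>K\<close>. Being finitely generated over the artinian ring \<open>k\<close>, \<open>P\<close>
satisfies the descending chain condition on \<open>k\<close>-submodules; a module of finite length satisfies both
chain conditions on \<open>k\<close>-submodules (\<open>finite_length_chain_cond\<close>). From these two facts alone, a
homomorphism from \<open>K\<close> to \<open>U\<^sub>0\<close> is determined by its values on a finite set \<open>C\<close>
(\<open>finite_determining_set\<close>), so the chain may be observed inside a finite power of \<open>U\<^sub>0\<close>.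

All modules \<open>U\<^sub>n\<close> are realised inside one module, the quotient of the countable direct sum of
copies of \<open>V\<close> by the relations that identify \<open>h(u)\<close> in copy \<open>i\<close> with \<open>f(u)\<close> in copy \<open>i + 1\<close>.\<close>

section \<open>Chain conditions for families of sets\<close>

text \<open>The flag selects the direction, so that noetherian and artinian statements share one proof: \<open>True\<close>
stands for ascending chains, \<open>False\<close> for descending ones.\<close>
definition beyond :: "bool \<Rightarrow> 'b set \<Rightarrow> 'b set \<Rightarrow> bool" where
  "beyond up A B \<longleftrightarrow> (if up then A \<subseteq> B else B \<subseteq> A)"

text \<open>The chain condition in its extremal form. It is stated for an arbitrary family of sets so that it
applies equally to submodules for two different rings of scalars, to ideals, and to finite families.\<close>
definition chain_cond :: "bool \<Rightarrow> 'b set set \<Rightarrow> bool" where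
  "chain_cond up L \<longleftrightarrow>
     (\<forall>F. F \<subseteq> L \<and> F \<noteq> {} \<longrightarrow> (\<exists>N\<in>F. \<forall>N'\<in>F. beyond up N N' \<longrightarrow> N' = N))"

lemma chain_cond_extremal:
  assumes "chain_cond up L" "F \<subseteq> L" "F \<noteq> {}"
  shows "\<exists>N\<in>F. \<forall>N'\<in>F. beyond up N N' \<longrightarrow> N' = N"
  using assms unfolding chain_cond_def by meson

lemma chain_cond_subset: "chain_cond up L \<Longrightarrow> L' \<subseteq> L \<Longrightarrow> chain_cond up L'"
  unfolding chain_cond_def by (meson subset_trans)

lemma chain_cond_finite:
  assumes "finite L"
  shows "chain_cond up L"
  unfolding chain_cond_def
proof (intro allI impI)
  fix F assume F: "F \<subseteq> L \<and> F \<noteq> {}"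
  then have fin: "finite F" using assms finite_subset by blast
  show "\<exists>N\<in>F. \<forall>N'\<in>F. beyond up N N' \<longrightarrow> N' = N"
  proof (cases up)
    case True
    obtain N where "N \<in> F" "\<forall>N'\<in>F. N \<subseteq> N' \<longrightarrow> N = N'" using finite_has_maximal[OF fin] F by blast
    with True show ?thesis by (auto simp: beyond_def)
  next
    case False
    obtain N where "N \<in> F" "\<forall>N'\<in>F. N' \<subseteq> N \<longrightarrow> N = N'" using finite_has_minimal[OF fin] F by blast
    with False show ?thesis by (auto simp: beyond_def)
  qed
qed

text \<open>The order-theoretic core of every extension argument: to bound chains of submodules of an extension it
is enough to watch a trace in the submodule and a trace in the quotient, provided that these two traces
together detect strict inclusions. Choose \<open>N\<close> extremal for \<open>G1\<close> first, and among those for \<open>G2\<close>.\<close>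
lemma chain_cond_lex:
  assumes L1: "chain_cond up L1" and L2: "chain_cond up L2"
    and G1: "\<And>N. N \<in> L \<Longrightarrow> G1 N \<in> L1" and G2: "\<And>N. N \<in> L \<Longrightarrow> G2 N \<in> L2"
    and m1: "\<And>N N'. \<lbrakk>N \<in> L; N' \<in> L; N \<subseteq> N'\<rbrakk> \<Longrightarrow> G1 N \<subseteq> G1 N'"
    and m2: "\<And>N N'. \<lbrakk>N \<in> L; N' \<in> L; N \<subseteq> N'\<rbrakk> \<Longrightarrow> G2 N \<subseteq> G2 N'"
    and strict: "\<And>N N'. \<lbrakk>N \<in> L; N' \<in> L; N \<subseteq> N'; G1 N = G1 N'; G2 N = G2 N'\<rbrakk> \<Longrightarrow> N' \<subseteq> N"
  shows "chain_cond up L"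
  unfolding chain_cond_def
proof (intro allI impI)
  fix F assume F: "F \<subseteq> L \<and> F \<noteq> {}"
  have mono: "beyond up (G1 N) (G1 N')" "beyond up (G2 N) (G2 N')"
    if "N \<in> F" "N' \<in> F" "beyond up N N'" for N N'
    using that m1[of N N'] m1[of N' N] m2[of N N'] m2[of N' N] F unfolding beyond_def
    by (simp_all split: if_splits) (simp_all add: subset_eq)
  have strict': "N' = N" if "N \<in> F" "N' \<in> F" "beyond up N N'" "G1 N' = G1 N" "G2 N' = G2 N" for N N'
  proof -
    have "N \<in> L" "N' \<in> L" using that F by auto
    then show ?thesis using that strict[of N N'] strict[of N' N] unfolding beyond_def
      by (metis subset_antisym)
  qed
  obtain N0 where N0: "N0 \<in> F" "\<And>N'. N' \<in> F \<Longrightarrow> beyond up (G1 N0) (G1 N') \<Longrightarrow> G1 N' = G1 N0"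
  proof -
    have "G1 ` F \<subseteq> L1" "G1 ` F \<noteq> {}" using G1 F by auto
    from chain_cond_extremal[OF L1 this] obtain B
      where "B \<in> G1 ` F" "\<forall>N'\<in>G1 ` F. beyond up B N' \<longrightarrow> N' = B" ..
    then show ?thesis using that by (metis imageE imageI)
  qed
  define F' where "F' = {N \<in> F. G1 N = G1 N0}"
  have F': "G2 ` F' \<subseteq> L2" "G2 ` F' \<noteq> {}" using N0(1) F G2 unfolding F'_def by auto
  obtain N1 where N1: "N1 \<in> F'" "\<And>N'. N' \<in> F' \<Longrightarrow> beyond up (G2 N1) (G2 N') \<Longrightarrow> G2 N' = G2 N1"
  proof -
    from chain_cond_extremal[OF L2 F'] obtain B
      where "B \<in> G2 ` F'" "\<forall>N'\<in>G2 ` F'. beyond up B N' \<longrightarrow> N' = B" ..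
    then show ?thesis using that by (metis imageE imageI)
  qed
  show "\<exists>N\<in>F. \<forall>N'\<in>F. beyond up N N' \<longrightarrow> N' = N"
  proof (intro bexI ballI impI)
    show N1F: "N1 \<in> F" using N1(1) by (simp add: F'_def)
    fix N' assume N': "N' \<in> F" "beyond up N1 N'"
    have "G1 N' = G1 N0" using N0(2)[OF N'(1)] mono(1)[OF N1F N'] N1(1) by (simp add: F'_def)
    then have "N' \<in> F'" "G1 N' = G1 N1" using N'(1) N1(1) by (auto simp: F'_def)
    then show "N' = N1" using N1(2)[OF _ mono(2)[OF N1F N']] strict'[OF N1F N'] by blast
  qed
qed

lemma chain_cond_inj:
  assumes "chain_cond up L'" "\<And>N. N \<in> L \<Longrightarrow> G N \<in> L'"
    and "\<And>N N'. \<lbrakk>N \<in> L; N' \<in> L; N \<subseteq> N'\<rbrakk> \<Longrightarrow> G N \<subseteq> G N'"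
    and "\<And>N N'. \<lbrakk>N \<in> L; N' \<in> L; N \<subseteq> N'; G N = G N'\<rbrakk> \<Longrightarrow> N' \<subseteq> N"
  shows "chain_cond up L"
  by (rule chain_cond_lex[where ?G1.0 = G and ?G2.0 = G, OF assms(1,1)]) (fact assms | rule assms(4); assumption)+

lemma chain_cond_stationary:
  assumes "chain_cond True L" "\<And>n. B n \<in> L" "\<And>n. B n \<subseteq> B (Suc n)"
  shows "\<exists>n. B (Suc n) = B n"
proof -
  have "range B \<subseteq> L" "range B \<noteq> {}" using assms(2) by auto
  from chain_cond_extremal[OF assms(1) this] obtain N
    where N: "N \<in> range B" "\<forall>N'\<in>range B. beyond True N N' \<longrightarrow> N' = N" ..
  from N(1) obtain n where n: "N = B n" ..
  have "B (Suc n) = B n"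
    using N(2)[THEN bspec, of "B (Suc n)"] assms(3)[of n] n by (simp add: beyond_def)
  then show ?thesis ..
qed

section \<open>Modules\<close>

context abelian_group
begin

lemma neg_zero [simp]: "\<ominus> \<zero> = \<zero>"
  by (rule minus_equality) simp_all

lemma diff_zero [simp]: "x \<in> carrier G \<Longrightarrow> x \<ominus> \<zero> = x"
  by (simp add: a_minus_def)

lemma diff_add_cancel [simp]: "x \<in> carrier G \<Longrightarrow> y \<in> carrier G \<Longrightarrow> (x \<ominus> y) \<oplus> y = x"
  by (simp add: a_minus_def a_assoc l_neg)

lemma diff_self [simp]: "x \<in> carrier G \<Longrightarrow> x \<ominus> x = \<zero>"
  by (simp add: a_minus_def r_neg)

lemma diff_eq_zero_iff: "x \<in> carrier G \<Longrightarrow> y \<in> carrier G \<Longrightarrow> x \<ominus> y = \<zero> \<longleftrightarrow> x = y"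
  using diff_add_cancel[of x y] l_zero[of y] by (metis diff_self)

lemma add_diff_cancel [simp]: "x \<in> carrier G \<Longrightarrow> y \<in> carrier G \<Longrightarrow> (x \<oplus> y) \<ominus> y = x"
  by (simp add: a_minus_def a_assoc r_neg)

end

text \<open>With \<open>D\<close> the whole ring these are the submodules contained in \<open>A\<close>; with \<open>D\<close> the image of the ground ring
\<open>k\<close> they are the \<open>k\<close>-submodules. Varying \<open>D\<close> avoids passing to a module with restricted scalars.\<close>
definition scalar_subspaces :: "'a set \<Rightarrow> ('a, 'b, 'm) module_scheme \<Rightarrow> 'b set \<Rightarrow> 'b set set" where
  "scalar_subspaces D M A = {N. N \<subseteq> A \<and> \<zero>\<^bsub>M\<^esub> \<in> N \<and> (\<forall>x\<in>N. \<forall>y\<in>N. x \<oplus>\<^bsub>M\<^esub> y \<in> N) \<and>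
     (\<forall>x\<in>N. \<ominus>\<^bsub>M\<^esub> x \<in> N) \<and> (\<forall>d\<in>D. \<forall>x\<in>N. d \<odot>\<^bsub>M\<^esub> x \<in> N)}"

lemma scalar_subspacesI:
  assumes "N \<subseteq> A" "\<zero>\<^bsub>M\<^esub> \<in> N" "\<And>x y. x \<in> N \<Longrightarrow> y \<in> N \<Longrightarrow> x \<oplus>\<^bsub>M\<^esub> y \<in> N"
    "\<And>x. x \<in> N \<Longrightarrow> \<ominus>\<^bsub>M\<^esub> x \<in> N" "\<And>d x. d \<in> D \<Longrightarrow> x \<in> N \<Longrightarrow> d \<odot>\<^bsub>M\<^esub> x \<in> N"
  shows "N \<in> scalar_subspaces D M A"
  using assms by (auto simp: scalar_subspaces_def)

lemma scalar_subspacesD: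
  assumes "N \<in> scalar_subspaces D M A"
  shows "N \<subseteq> A" "\<zero>\<^bsub>M\<^esub> \<in> N" "\<And>x y. x \<in> N \<Longrightarrow> y \<in> N \<Longrightarrow> x \<oplus>\<^bsub>M\<^esub> y \<in> N"
    "\<And>x. x \<in> N \<Longrightarrow> \<ominus>\<^bsub>M\<^esub> x \<in> N" "\<And>d x. d \<in> D \<Longrightarrow> x \<in> N \<Longrightarrow> d \<odot>\<^bsub>M\<^esub> x \<in> N"
    "\<And>x y. x \<in> N \<Longrightarrow> y \<in> N \<Longrightarrow> x \<ominus>\<^bsub>M\<^esub> y \<in> N"
  using assms by (auto simp: scalar_subspaces_def a_minus_def)

lemma scalar_subspaces_mono:
  "D' \<subseteq> D \<Longrightarrow> A \<subseteq> A' \<Longrightarrow> scalar_subspaces D M A \<subseteq> scalar_subspaces D' M A'"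
  unfolding scalar_subspaces_def by blast

lemma scalar_subspaces_self: "A \<in> scalar_subspaces D M C \<Longrightarrow> A \<in> scalar_subspaces D M A"
  unfolding scalar_subspaces_def by blast

lemma scalar_subspaces_superset:
  "N \<in> scalar_subspaces D M A \<Longrightarrow> D' \<subseteq> D \<Longrightarrow> A \<subseteq> A' \<Longrightarrow> N \<in> scalar_subspaces D' M A'"
  unfolding scalar_subspaces_def by blast

lemma scalar_subspaces_Int:
  "N \<in> scalar_subspaces D M A \<Longrightarrow> N' \<in> scalar_subspaces D M A' \<Longrightarrow> N \<inter> N' \<in> scalar_subspaces D M (A \<inter> A')"
  unfolding scalar_subspaces_def by blast

context left_module
begin

lemma smult_l_null: "x \<in> carrier M \<Longrightarrow> \<zero> \<odot>\<^bsub>M\<^esub> x = \<zero>\<^bsub>M\<^esub>"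
  using smult_l_distr[of \<zero> \<zero> x] by (metis M.add.r_cancel_one' R.l_zero smult_closed R.zero_closed)

lemma smult_r_null: "a \<in> carrier R \<Longrightarrow> a \<odot>\<^bsub>M\<^esub> \<zero>\<^bsub>M\<^esub> = \<zero>\<^bsub>M\<^esub>"
  using smult_r_distr[of a "\<zero>\<^bsub>M\<^esub>" "\<zero>\<^bsub>M\<^esub>"] by (metis M.add.r_cancel_one' M.l_zero smult_closed M.zero_closed)

lemma smult_r_minus: "a \<in> carrier R \<Longrightarrow> x \<in> carrier M \<Longrightarrow> a \<odot>\<^bsub>M\<^esub> (\<ominus>\<^bsub>M\<^esub> x) = \<ominus>\<^bsub>M\<^esub> (a \<odot>\<^bsub>M\<^esub> x)"
  using smult_r_distr[of a "\<ominus>\<^bsub>M\<^esub> x" x]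
  by (metis M.a_inv_closed M.l_neg M.minus_equality smult_closed smult_r_null)

lemma smult_l_minus: "a \<in> carrier R \<Longrightarrow> x \<in> carrier M \<Longrightarrow> (\<ominus> a) \<odot>\<^bsub>M\<^esub> x = \<ominus>\<^bsub>M\<^esub> (a \<odot>\<^bsub>M\<^esub> x)"
  using smult_l_distr[of "\<ominus> a" a x]
  by (metis R.a_inv_closed R.l_neg M.minus_equality smult_closed smult_l_null)

lemma smult_r_diff: "a \<in> carrier R \<Longrightarrow> x \<in> carrier M \<Longrightarrow> y \<in> carrier M \<Longrightarrow>
   a \<odot>\<^bsub>M\<^esub> (x \<ominus>\<^bsub>M\<^esub> y) = a \<odot>\<^bsub>M\<^esub> x \<ominus>\<^bsub>M\<^esub> a \<odot>\<^bsub>M\<^esub> y"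
  by (simp add: a_minus_def smult_r_distr smult_r_minus)

lemma submodule_iff: "submodule N R M \<longleftrightarrow> N \<in> scalar_subspaces (carrier R) M (carrier M)"
proof
  assume "submodule N R M"
  then interpret N: submodule N R M .
  show "N \<in> scalar_subspaces (carrier R) M (carrier M)"
    using N.subset N.one_closed N.m_closed N.m_inv_closed N.smult_closed
    by (auto simp: scalar_subspaces_def a_inv_def)
qed (rule module_submoduleI, auto simp: scalar_subspaces_def)

lemma left_module_sub:
  assumes A: "A \<in> scalar_subspaces (carrier R) M (carrier M)"
  shows "left_module R (M\<lparr>carrier := A\<rparr>)"
proof -
  note A' = scalar_subspacesD[OF A]
  have c: "\<And>x. x \<in> A \<Longrightarrow> x \<in> carrier M" using A'(1) by auto
  have ab: "abelian_group (M\<lparr>carrier := A\<rparr>)"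
  proof (rule abelian_groupI)
    fix x assume "x \<in> carrier (M\<lparr>carrier := A\<rparr>)"
    then show "\<exists>y\<in>carrier (M\<lparr>carrier := A\<rparr>). y \<oplus>\<^bsub>M\<lparr>carrier := A\<rparr>\<^esub> x = \<zero>\<^bsub>M\<lparr>carrier := A\<rparr>\<^esub>"
      using A'(4)[of x] c by (auto intro!: bexI[of _ "\<ominus>\<^bsub>M\<^esub> x"] simp: M.l_neg)
  qed (use A' c in \<open>auto simp: M.a_ac\<close>)
  show ?thesis
    by (intro left_module.intro left_module_axioms.intro ab R.ring_axioms)
      (use A' c in \<open>auto simp: smult_l_distr smult_r_distr smult_assoc1\<close>)
qed

lemma minus_sub:
  assumes A: "A \<in> scalar_subspaces (carrier R) M (carrier M)" and x: "x \<in> A"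
  shows "\<ominus>\<^bsub>M\<lparr>carrier := A\<rparr>\<^esub> x = \<ominus>\<^bsub>M\<^esub> x"
proof -
  interpret S: left_module R "M\<lparr>carrier := A\<rparr>" by (rule left_module_sub[OF A])
  have "\<ominus>\<^bsub>M\<^esub> x \<oplus>\<^bsub>M\<^esub> x = \<zero>\<^bsub>M\<^esub>" using x scalar_subspacesD(1)[OF A] by (auto simp: M.l_neg)
  then show ?thesis using S.M.minus_equality[of "\<ominus>\<^bsub>M\<^esub> x" x] x scalar_subspacesD(4)[OF A x] by simp
qed

lemma submodule_sub_iff:
  assumes A: "A \<in> scalar_subspaces (carrier R) M (carrier M)"
  shows "submodule N R (M\<lparr>carrier := A\<rparr>) \<longleftrightarrow> N \<in> scalar_subspaces (carrier R) M A"
  unfolding left_module.submodule_iff[OF left_module_sub[OF A]]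
  using minus_sub[OF A] by (auto simp: scalar_subspaces_def subset_iff)

lemma carrier_scalar_subspace: "D \<subseteq> carrier R \<Longrightarrow> carrier M \<in> scalar_subspaces D M (carrier M)"
  by (auto simp: scalar_subspaces_def)

lemma zero_scalar_subspace: "D \<subseteq> carrier R \<Longrightarrow> {\<zero>\<^bsub>M\<^esub>} \<in> scalar_subspaces D M (carrier M)"
  by (auto simp: scalar_subspaces_def smult_r_null subset_iff)

end

lemma mod_homD:
  assumes "f \<in> mod_hom R M N" 
  shows "\<And>x. x \<in> carrier M \<Longrightarrow> f x \<in> carrier N"
    "\<And>x y. x \<in> carrier M \<Longrightarrow> y \<in> carrier M \<Longrightarrow> f (x \<oplus>\<^bsub>M\<^esub> y) = f x \<oplus>\<^bsub>N\<^esub> f y"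
    "\<And>a x. a \<in> carrier R \<Longrightarrow> x \<in> carrier M \<Longrightarrow> f (a \<odot>\<^bsub>M\<^esub> x) = a \<odot>\<^bsub>N\<^esub> f x"
  using assms by (auto simp: mod_hom_def)

lemma mod_hom_minus:
  assumes "f \<in> mod_hom R M N" "left_module R M" "left_module R N"
  shows "f \<zero>\<^bsub>M\<^esub> = \<zero>\<^bsub>N\<^esub>"
    "\<And>x. x \<in> carrier M \<Longrightarrow> f (\<ominus>\<^bsub>M\<^esub> x) = \<ominus>\<^bsub>N\<^esub> f x"
    "\<And>x y. x \<in> carrier M \<Longrightarrow> y \<in> carrier M \<Longrightarrow> f (x \<ominus>\<^bsub>M\<^esub> y) = f x \<ominus>\<^bsub>N\<^esub> f y"
proof -
  interpret M: left_module R M by fact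
  interpret N: left_module R N by fact
  note f = mod_homD[OF assms(1)]
  show z: "f \<zero>\<^bsub>M\<^esub> = \<zero>\<^bsub>N\<^esub>"
    using f(2)[of "\<zero>\<^bsub>M\<^esub>" "\<zero>\<^bsub>M\<^esub>"] f(1)[of "\<zero>\<^bsub>M\<^esub>"] by (metis M.M.l_zero M.M.zero_closed N.add.r_cancel_one')
  show m: "f (\<ominus>\<^bsub>M\<^esub> x) = \<ominus>\<^bsub>N\<^esub> f x" if "x \<in> carrier M" for x
    using f(2)[of "\<ominus>\<^bsub>M\<^esub> x" x] that f(1) z by (metis M.M.a_inv_closed M.M.l_neg N.M.minus_equality)
  show "f (x \<ominus>\<^bsub>M\<^esub> y) = f x \<ominus>\<^bsub>N\<^esub> f y" if "x \<in> carrier M" "y \<in> carrier M" for x y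
    using that f(2)[of x "\<ominus>\<^bsub>M\<^esub> y"] m by (simp add: a_minus_def)
qed

lemma scalar_subspaces_image:
  assumes f: "f \<in> mod_hom R M N" and M: "left_module R M" and N: "left_module R N" and D: "D \<subseteq> carrier R"
    and S: "S \<in> scalar_subspaces D M (carrier M)"
  shows "f ` S \<in> scalar_subspaces D N (carrier N)"
proof -
  note S' = scalar_subspacesD[OF S]
  have c: "\<And>x. x \<in> S \<Longrightarrow> x \<in> carrier M" using S'(1) by auto
  note h = mod_homD[OF f] mod_hom_minus[OF f M N]
  show ?thesis
  proof (rule scalar_subspacesI)
    show "\<zero>\<^bsub>N\<^esub> \<in> f ` S" unfolding h(4)[symmetric] by (rule imageI) (rule S')
    show "x \<oplus>\<^bsub>N\<^esub> y \<in> f ` S" if "x \<in> f ` S" "y \<in> f ` S" for x y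
      using that S'(3) by (auto simp: h(2)[symmetric] c)
    show "\<ominus>\<^bsub>N\<^esub> x \<in> f ` S" if "x \<in> f ` S" for x
      using that S'(4) by (auto simp: h(5)[symmetric] c)
    show "d \<odot>\<^bsub>N\<^esub> x \<in> f ` S" if "d \<in> D" "x \<in> f ` S" for d x
      using that S'(5) by (auto simp: h(3)[symmetric] c subsetD[OF D])
  qed (use c h in auto)
qed

lemma scalar_subspaces_vimage:
  assumes f: "f \<in> mod_hom R M N" and M: "left_module R M" and N: "left_module R N" and D: "D \<subseteq> carrier R"
    and S: "S \<in> scalar_subspaces D N B" and T: "T \<in> scalar_subspaces D M (carrier M)"
  shows "{x \<in> T. f x \<in> S} \<in> scalar_subspaces D M T"
proof -
  interpret M: left_module R M by fact
  note S' = scalar_subspacesD[OF S] and T' = scalar_subspacesD[OF T]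
  have c: "\<And>x. x \<in> T \<Longrightarrow> x \<in> carrier M" using T'(1) by auto
  note h = mod_homD[OF f] mod_hom_minus[OF f M N]
  show ?thesis
    by (rule scalar_subspacesI) (use h S' T' c D in \<open>auto simp: subset_iff\<close>)
qed

context left_module
begin

lemma add_scalar_subspace:
  assumes A: "A \<in> scalar_subspaces D M (carrier M)" and B: "B \<in> scalar_subspaces D M (carrier M)"
    and D: "D \<subseteq> carrier R"
  shows "A <+>\<^bsub>M\<^esub> B \<in> scalar_subspaces D M (carrier M)"
proof -
  note A' = scalar_subspacesD[OF A] and B' = scalar_subspacesD[OF B]
  have c: "\<And>x. x \<in> A \<Longrightarrow> x \<in> carrier M" "\<And>x. x \<in> B \<Longrightarrow> x \<in> carrier M" using A'(1) B'(1) by auto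
  have eq: "A <+>\<^bsub>M\<^esub> B = {a \<oplus>\<^bsub>M\<^esub> b | a b. a \<in> A \<and> b \<in> B}" by (auto simp: set_add_def set_mult_def)
  show ?thesis
    unfolding eq
  proof (rule scalar_subspacesI)
    show "\<zero>\<^bsub>M\<^esub> \<in> {a \<oplus>\<^bsub>M\<^esub> b | a b. a \<in> A \<and> b \<in> B}"
      using A'(2) B'(2) by force
    show "x \<oplus>\<^bsub>M\<^esub> y \<in> {a \<oplus>\<^bsub>M\<^esub> b | a b. a \<in> A \<and> b \<in> B}"
      if xy: "x \<in> {a \<oplus>\<^bsub>M\<^esub> b | a b. a \<in> A \<and> b \<in> B}" "y \<in> {a \<oplus>\<^bsub>M\<^esub> b | a b. a \<in> A \<and> b \<in> B}" for x y
    proof -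
      obtain a b a' b' where "a \<in> A" "b \<in> B" "a' \<in> A" "b' \<in> B" "x = a \<oplus>\<^bsub>M\<^esub> b" "y = a' \<oplus>\<^bsub>M\<^esub> b'"
        using xy by blast
      moreover from this have "x \<oplus>\<^bsub>M\<^esub> y = (a \<oplus>\<^bsub>M\<^esub> a') \<oplus>\<^bsub>M\<^esub> (b \<oplus>\<^bsub>M\<^esub> b')" using c by (simp add: M.a_ac)
      ultimately show ?thesis using A'(3) B'(3) by blast
    qed
    show "\<ominus>\<^bsub>M\<^esub> x \<in> {a \<oplus>\<^bsub>M\<^esub> b | a b. a \<in> A \<and> b \<in> B}"
      if x: "x \<in> {a \<oplus>\<^bsub>M\<^esub> b | a b. a \<in> A \<and> b \<in> B}" for x
    proof -
      obtain a b where "a \<in> A" "b \<in> B" "x = a \<oplus>\<^bsub>M\<^esub> b" using x by blast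
      moreover from this have "\<ominus>\<^bsub>M\<^esub> x = \<ominus>\<^bsub>M\<^esub> a \<oplus>\<^bsub>M\<^esub> \<ominus>\<^bsub>M\<^esub> b" using c by (simp add: M.minus_add)
      ultimately show ?thesis using A'(4) B'(4) by blast
    qed
    show "d \<odot>\<^bsub>M\<^esub> x \<in> {a \<oplus>\<^bsub>M\<^esub> b | a b. a \<in> A \<and> b \<in> B}"
      if d: "d \<in> D" and x: "x \<in> {a \<oplus>\<^bsub>M\<^esub> b | a b. a \<in> A \<and> b \<in> B}" for d x
    proof -
      obtain a b where "a \<in> A" "b \<in> B" "x = a \<oplus>\<^bsub>M\<^esub> b" using x by blast
      moreover from this have "d \<odot>\<^bsub>M\<^esub> x = d \<odot>\<^bsub>M\<^esub> a \<oplus>\<^bsub>M\<^esub> d \<odot>\<^bsub>M\<^esub> b" using c d D by (auto simp: smult_r_distr)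
      ultimately show ?thesis using A'(5) B'(5) d by blast
    qed
  qed (use c in auto)
qed

lemma mem_set_add: "x \<in> A <+>\<^bsub>M\<^esub> B \<longleftrightarrow> (\<exists>a\<in>A. \<exists>b\<in>B. x = a \<oplus>\<^bsub>M\<^esub> b)"
  by (auto simp: set_add_def set_mult_def)

lemma subset_set_add:
  assumes "A \<in> scalar_subspaces D M (carrier M)" and "B \<in> scalar_subspaces D M (carrier M)"
  shows "A \<subseteq> A <+>\<^bsub>M\<^esub> B" "B \<subseteq> A <+>\<^bsub>M\<^esub> B"
proof -
  note A' = scalar_subspacesD[OF assms(1)] and B' = scalar_subspacesD[OF assms(2)]
  have c: "\<And>x. x \<in> A \<Longrightarrow> x \<in> carrier M" "\<And>x. x \<in> B \<Longrightarrow> x \<in> carrier M" using A'(1) B'(1) by auto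
  show "A \<subseteq> A <+>\<^bsub>M\<^esub> B"
  proof
    fix x assume "x \<in> A"
    moreover have "x = x \<oplus>\<^bsub>M\<^esub> \<zero>\<^bsub>M\<^esub>" using \<open>x \<in> A\<close> c by simp
    ultimately show "x \<in> A <+>\<^bsub>M\<^esub> B" using B'(2) unfolding mem_set_add by blast
  qed
  show "B \<subseteq> A <+>\<^bsub>M\<^esub> B"
  proof
    fix x assume "x \<in> B"
    moreover have "x = \<zero>\<^bsub>M\<^esub> \<oplus>\<^bsub>M\<^esub> x" using \<open>x \<in> B\<close> c by simp
    ultimately show "x \<in> A <+>\<^bsub>M\<^esub> B" using A'(2) unfolding mem_set_add by blast
  qed
qed

text \<open>The traces of \<open>N\<close> are its intersection with \<open>A\<close> and its image modulo \<open>A\<close>, the latter recorded by the indices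
\<open>i\<close> with \<open>e i \<in> N + A\<close>. The family \<open>L\<close> of possible index sets is left open: it will be the ideals of a
ring, the submodules of another module, or just a pair of sets.\<close>
lemma chain_cond_set_add:
  assumes A: "A \<in> scalar_subspaces D M (carrier M)" and e: "e ` I \<subseteq> carrier M"
    and ccA: "chain_cond up (scalar_subspaces D M A)" and ccL: "chain_cond up L"
    and L: "\<And>N. N \<in> scalar_subspaces D M (A <+>\<^bsub>M\<^esub> e ` I) \<Longrightarrow> {i \<in> I. e i \<in> N <+>\<^bsub>M\<^esub> A} \<in> L"
  shows "chain_cond up (scalar_subspaces D M (A <+>\<^bsub>M\<^esub> e ` I))"
proof (rule chain_cond_lex[OF ccA ccL])
  note A' = scalar_subspacesD[OF A]
  have Ac: "\<And>a. a \<in> A \<Longrightarrow> a \<in> carrier M" using A'(1) by auto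
  have ec: "\<And>i. i \<in> I \<Longrightarrow> e i \<in> carrier M" using e by auto
  have sub: "A <+>\<^bsub>M\<^esub> e ` I \<subseteq> carrier M" using Ac ec by (auto simp: mem_set_add)
  fix N assume N: "N \<in> scalar_subspaces D M (A <+>\<^bsub>M\<^esub> e ` I)"
  note N1 = scalar_subspacesD[OF N]
  show "N \<inter> A \<in> scalar_subspaces D M A"
    by (rule scalar_subspaces_superset[OF scalar_subspaces_Int[OF N scalar_subspaces_self[OF A]]]) auto
  show "{i \<in> I. e i \<in> N <+>\<^bsub>M\<^esub> A} \<in> L" by (rule L[OF N])
  fix N' assume N': "N' \<in> scalar_subspaces D M (A <+>\<^bsub>M\<^esub> e ` I)" and le: "N \<subseteq> N'"
  note N2 = scalar_subspacesD[OF N']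
  have Nc: "\<And>x. x \<in> N' \<Longrightarrow> x \<in> carrier M" using N2(1) sub by blast
  show "N \<inter> A \<subseteq> N' \<inter> A" using le by blast
  show "{i \<in> I. e i \<in> N <+>\<^bsub>M\<^esub> A} \<subseteq> {i \<in> I. e i \<in> N' <+>\<^bsub>M\<^esub> A}"
    using le by (auto simp: mem_set_add)
  assume eq: "N \<inter> A = N' \<inter> A" "{i \<in> I. e i \<in> N <+>\<^bsub>M\<^esub> A} = {i \<in> I. e i \<in> N' <+>\<^bsub>M\<^esub> A}"
  show "N' \<subseteq> N"
  proof
    fix x assume x: "x \<in> N'"
    then obtain a i where a: "a \<in> A" and i: "i \<in> I" and xa: "x = a \<oplus>\<^bsub>M\<^esub> e i"
      using subsetD[OF N2(1) x] by (auto simp: mem_set_add)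
    have "e i = x \<oplus>\<^bsub>M\<^esub> \<ominus>\<^bsub>M\<^esub> a"
      unfolding xa using Ac[OF a] ec[OF i] M.a_comm M.r_neg1 by simp
    then have "i \<in> {i \<in> I. e i \<in> N' <+>\<^bsub>M\<^esub> A}"
      using x i A'(4)[OF a] by (auto simp: mem_set_add)
    then obtain n b where n: "n \<in> N" and b: "b \<in> A" and en: "e i = n \<oplus>\<^bsub>M\<^esub> b"
      unfolding eq(2)[symmetric] by (auto simp: mem_set_add)
    have nc: "n \<in> carrier M" using n le Nc by blast
    have ab: "a \<oplus>\<^bsub>M\<^esub> b \<in> A" by (rule A'(3)[OF a b])
    have x2: "x = n \<oplus>\<^bsub>M\<^esub> (a \<oplus>\<^bsub>M\<^esub> b)" unfolding xa en using nc Ac[OF a] Ac[OF b] by (simp add: M.a_ac)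
    have "a \<oplus>\<^bsub>M\<^esub> b = x \<ominus>\<^bsub>M\<^esub> n"
      unfolding x2 using nc Ac[OF ab] by (simp add: M.a_comm[of n])
    also have "\<dots> \<in> N'" using N2(6)[OF x] n le by blast
    finally have "a \<oplus>\<^bsub>M\<^esub> b \<in> N" using eq(1) ab by blast
    then show "x \<in> N" unfolding x2 by (rule N1(3)[OF n])
  qed
qed

end

lemma set_add_least:
  assumes "B \<in> scalar_subspaces D M C" "A \<subseteq> B" "A' \<subseteq> B"
  shows "A <+>\<^bsub>M\<^esub> A' \<subseteq> B"
  using scalar_subspacesD(3)[OF assms(1)] assms(2,3) by (auto simp: set_add_def set_mult_def)

lemma mod_hom_zero_map:
  assumes "left_module R N"
  shows "(\<lambda>_. \<zero>\<^bsub>N\<^esub>) \<in> mod_hom R M N"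
proof -
  interpret N: left_module R N by fact
  show ?thesis by (auto simp: mod_hom_def N.smult_r_null)
qed

lemma mod_hom_add_map:
  assumes N: "left_module R N" and f: "f \<in> mod_hom R M N" and g: "g \<in> mod_hom R M N"
  shows "(\<lambda>x. f x \<oplus>\<^bsub>N\<^esub> g x) \<in> mod_hom R M N"
proof -
  interpret N: left_module R N by fact
  show ?thesis
    using mod_homD[OF f] mod_homD[OF g] by (auto simp: mod_hom_def N.smult_r_distr N.M.a_ac)
qed

lemma mod_hom_diff_map:
  assumes N: "left_module R N" and f: "f \<in> mod_hom R M N" and g: "g \<in> mod_hom R M N"
  shows "(\<lambda>x. f x \<ominus>\<^bsub>N\<^esub> g x) \<in> mod_hom R M N"
proof -
  interpret N: left_module R N by fact
  show ?thesis
    using mod_homD[OF f] mod_homD[OF g]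
    by (auto simp: mod_hom_def a_minus_def N.smult_r_distr N.smult_r_minus N.M.minus_add N.M.a_ac)
qed

lemma mod_hom_sub:
  assumes "A \<subseteq> carrier N"
  shows "f \<in> mod_hom R M (N\<lparr>carrier := A\<rparr>) \<longleftrightarrow> f \<in> mod_hom R M N \<and> f ` carrier M \<subseteq> A"
  using assms by (auto simp: mod_hom_def Pi_iff)

lemma mod_hom_comp:
  "f \<in> mod_hom R M N \<Longrightarrow> g \<in> mod_hom R N P \<Longrightarrow> (\<lambda>x. g (f x)) \<in> mod_hom R M P"
  by (auto simp: mod_hom_def Pi_iff)

section \<open>Chain conditions over an artin algebra\<close>

lemma (in abelian_group) finsum_in_subset:
  assumes "finite S" "A \<subseteq> carrier G" "\<zero> \<in> A" "\<And>x y. x \<in> A \<Longrightarrow> y \<in> A \<Longrightarrow> x \<oplus> y \<in> A"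
    "\<And>s. s \<in> S \<Longrightarrow> f s \<in> A"
  shows "finsum G f S \<in> A"
  using assms(1,5)
proof (induction S rule: finite_induct)
  case empty
  then show ?case using assms(3) by simp
next
  case (insert s S)
  then have "f \<in> S \<rightarrow> carrier G" "f s \<in> carrier G" using assms(2) by auto
  then show ?case using insert assms(4) by simp
qed

lemma chain_cond_ideals:
  assumes k: "artinian_cring k"
  shows "chain_cond False {I. ideal I k}"
  unfolding chain_cond_def
proof (intro allI impI, rule ccontr)
  fix F assume F: "F \<subseteq> {I. ideal I k} \<and> F \<noteq> {}" and "\<not> (\<exists>N\<in>F. \<forall>N'\<in>F. beyond False N N' \<longrightarrow> N' = N)"
  then have next_ideal: "\<exists>N'. N' \<in> F \<and> N' \<subset> N" if "N \<in> F" for N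
    using that unfolding beyond_def by auto
  have "\<exists>I. \<forall>n. I n \<in> F \<and> I (Suc n) \<subset> I n"
    by (rule dependent_nat_choice) (use F next_ideal in auto)
  then obtain I :: "nat \<Rightarrow> 'a set" where I: "\<And>n. I n \<in> F" "\<And>n. I (Suc n) \<subset> I n" by blast
  then have "\<forall>n. ideal (I n) k \<and> I (Suc n) \<subseteq> I n" using F by blast
  then have "\<exists>N. \<forall>n\<ge>N. I n = I N"
    using k[unfolded artinian_cring_def, THEN conjunct2, THEN spec, of I] by (rule rev_mp)
  then obtain N where N: "\<forall>n\<ge>N. I n = I N" ..
  have "I (Suc N) = I N" using N[THEN spec, of "Suc N"] by (rule mp) simp
  then show False using I(2)[of N] by simp
qed

text \<open>The descending chain of the principal ideals of \<open>r\<^sup>n\<close> becomes stationary.\<close>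
lemma artinian_power_eq:
  assumes k: "artinian_cring k" and r: "r \<in> carrier k"
  obtains n c where "c \<in> carrier k" "r [^]\<^bsub>k\<^esub> (n::nat) = r [^]\<^bsub>k\<^esub> n \<otimes>\<^bsub>k\<^esub> (c \<otimes>\<^bsub>k\<^esub> r)"
proof -
  interpret k: cring k using k by (simp add: artinian_cring_def)
  let ?I = "\<lambda>n::nat. PIdl\<^bsub>k\<^esub> (r [^]\<^bsub>k\<^esub> n)"
  have "?I (Suc n) \<subseteq> ?I n" for n
  proof
    fix x assume "x \<in> ?I (Suc n)"
    then obtain a where "a \<in> carrier k" "x = a \<otimes>\<^bsub>k\<^esub> (r [^]\<^bsub>k\<^esub> Suc n)" by (auto simp: cgenideal_def)
    then have "a \<otimes>\<^bsub>k\<^esub> r \<in> carrier k" "x = (a \<otimes>\<^bsub>k\<^esub> r) \<otimes>\<^bsub>k\<^esub> r [^]\<^bsub>k\<^esub> n" using r by (auto simp: k.m_ac)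
    then show "x \<in> ?I n" unfolding cgenideal_def by blast
  qed
  then have "\<forall>n. ideal (?I n) k \<and> ?I (Suc n) \<subseteq> ?I n" using r by (auto intro: k.cgenideal_ideal)
  then have "\<exists>N. \<forall>n\<ge>N. ?I n = ?I N"
    using k[unfolded artinian_cring_def, THEN conjunct2, THEN spec, of ?I] by (rule rev_mp)
  then obtain n where n: "\<forall>m\<ge>n. ?I m = ?I n" ..
  have "?I (Suc n) = ?I n" using n[THEN spec, of "Suc n"] by (rule mp) simp
  then have "r [^]\<^bsub>k\<^esub> n \<in> ?I (Suc n)" using k.cgenideal_self[of "r [^]\<^bsub>k\<^esub> n"] r by simp
  then obtain c where "c \<in> carrier k" "r [^]\<^bsub>k\<^esub> n = c \<otimes>\<^bsub>k\<^esub> r [^]\<^bsub>k\<^esub> Suc n" by (auto simp: cgenideal_def)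
  then have "r [^]\<^bsub>k\<^esub> n = r [^]\<^bsub>k\<^esub> n \<otimes>\<^bsub>k\<^esub> (c \<otimes>\<^bsub>k\<^esub> r)" using r by (simp add: k.m_ac)
  then show ?thesis using that \<open>c \<in> carrier k\<close> by blast
qed

locale artin_alg =
  fixes k :: "('k, 'r) ring_scheme" and \<phi> :: "'k \<Rightarrow> 'a" and \<Lambda> :: "('a, 's) ring_scheme"
  assumes artin: "artin_algebra k \<phi> \<Lambda>"
begin

abbreviation scal :: "'a set" where "scal \<equiv> \<phi> ` carrier k"

lemma artinian_k: "artinian_cring k" and ring_\<Lambda>: "ring \<Lambda>" and \<phi>_hom: "\<phi> \<in> ring_hom k \<Lambda>"
  and central: "\<And>c x. c \<in> carrier k \<Longrightarrow> x \<in> carrier \<Lambda> \<Longrightarrow> \<phi> c \<otimes>\<^bsub>\<Lambda>\<^esub> x = x \<otimes>\<^bsub>\<Lambda>\<^esub> \<phi> c"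
  using artin by (auto simp: artin_algebra_def)

sublocale k: cring k using artinian_k by (simp add: artinian_cring_def)
sublocale L: ring \<Lambda> by (rule ring_\<Lambda>)
sublocale str: ring_hom_ring k \<Lambda> \<phi>
  by (rule ring_hom_ringI2[OF k.ring_axioms ring_\<Lambda> \<phi>_hom])

lemma scal: "scal \<subseteq> carrier \<Lambda>" by auto

definition line :: "('a, 'b, 'm) module_scheme \<Rightarrow> 'b \<Rightarrow> 'b set" where
  "line M y = (\<lambda>r. \<phi> r \<odot>\<^bsub>M\<^esub> y) ` carrier k"

definition coeffs :: "('a, 'b, 'm) module_scheme \<Rightarrow> 'b set \<Rightarrow> 'b \<Rightarrow> 'k set" where
  "coeffs M N y = {r \<in> carrier k. \<phi> r \<odot>\<^bsub>M\<^esub> y \<in> N}"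

context
  fixes M :: "('a, 'b, 'm) module_scheme"
  assumes M: "left_module \<Lambda> M"
begin

interpretation M: left_module \<Lambda> M by (rule M)

lemma line_subspace:
  assumes y: "y \<in> carrier M"
  shows "line M y \<in> scalar_subspaces scal M (carrier M)"
proof (rule scalar_subspacesI)
  show "line M y \<subseteq> carrier M" using y by (auto simp: line_def)
  show "\<zero>\<^bsub>M\<^esub> \<in> line M y"
    using y by (auto simp: line_def M.smult_l_null intro!: image_eqI[of _ _ "\<zero>\<^bsub>k\<^esub>"])
  show "u \<oplus>\<^bsub>M\<^esub> v \<in> line M y" if uv: "u \<in> line M y" "v \<in> line M y" for u v
  proof -
    obtain r s where "r \<in> carrier k" "s \<in> carrier k" "u = \<phi> r \<odot>\<^bsub>M\<^esub> y" "v = \<phi> s \<odot>\<^bsub>M\<^esub> y"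
      using uv by (auto simp: line_def)
    then have "u \<oplus>\<^bsub>M\<^esub> v = \<phi> (r \<oplus>\<^bsub>k\<^esub> s) \<odot>\<^bsub>M\<^esub> y" "r \<oplus>\<^bsub>k\<^esub> s \<in> carrier k"
      using y by (auto simp: M.smult_l_distr)
    then show ?thesis unfolding line_def by blast
  qed
  show "\<ominus>\<^bsub>M\<^esub> u \<in> line M y" if u: "u \<in> line M y" for u
  proof -
    obtain r where "r \<in> carrier k" "u = \<phi> r \<odot>\<^bsub>M\<^esub> y" using u by (auto simp: line_def)
    then have "\<ominus>\<^bsub>M\<^esub> u = \<phi> (\<ominus>\<^bsub>k\<^esub> r) \<odot>\<^bsub>M\<^esub> y" "\<ominus>\<^bsub>k\<^esub> r \<in> carrier k"
      using y by (auto simp: M.smult_l_minus)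
    then show ?thesis unfolding line_def by blast
  qed
  show "d \<odot>\<^bsub>M\<^esub> u \<in> line M y" if d: "d \<in> scal" and u: "u \<in> line M y" for d u
  proof -
    obtain r s where "r \<in> carrier k" "s \<in> carrier k" "u = \<phi> r \<odot>\<^bsub>M\<^esub> y" "d = \<phi> s"
      using u d by (auto simp: line_def)
    then have "d \<odot>\<^bsub>M\<^esub> u = \<phi> (s \<otimes>\<^bsub>k\<^esub> r) \<odot>\<^bsub>M\<^esub> y" "s \<otimes>\<^bsub>k\<^esub> r \<in> carrier k"
      using y by (auto simp: M.smult_assoc1)
    then show ?thesis unfolding line_def by blast
  qed
qed

lemma coeffs_ideal:
  assumes N: "N \<in> scalar_subspaces scal M (carrier M)" and y: "y \<in> carrier M"
  shows "ideal (coeffs M N y) k"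
proof -
  note N' = scalar_subspacesD[OF N]
  have mult: "s \<otimes>\<^bsub>k\<^esub> r \<in> coeffs M N y" if "r \<in> coeffs M N y" "s \<in> carrier k" for r s
    using that N'(5)[of "\<phi> s" "\<phi> r \<odot>\<^bsub>M\<^esub> y"] y by (simp add: coeffs_def M.smult_assoc1)
  show ?thesis
  proof (rule idealI[OF k.ring_axioms])
    show "subgroup (coeffs M N y) (add_monoid k)"
    proof (rule k.add.subgroupI)
      have "\<zero>\<^bsub>k\<^esub> \<in> coeffs M N y" using y N'(2) by (simp add: coeffs_def M.smult_l_null)
      then show "coeffs M N y \<noteq> {}" by blast
    qed (use y N' in \<open>auto simp: coeffs_def M.smult_l_distr M.smult_l_minus simp flip: a_inv_def\<close>)
    show "s \<otimes>\<^bsub>k\<^esub> r \<in> coeffs M N y" "r \<otimes>\<^bsub>k\<^esub> s \<in> coeffs M N y"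
      if "r \<in> coeffs M N y" "s \<in> carrier k" for r s
      using mult[OF that] that k.m_comm[of r s] by (auto simp: coeffs_def)
  qed
qed

lemma chain_cond_adjoin_line:
  assumes A: "A \<in> scalar_subspaces scal M (carrier M)" and y: "y \<in> carrier M"
    and ccA: "chain_cond up (scalar_subspaces scal M A)" and ccL: "chain_cond up L"
    and L: "\<And>N. N \<in> scalar_subspaces scal M (A <+>\<^bsub>M\<^esub> line M y) \<Longrightarrow> coeffs M (N <+>\<^bsub>M\<^esub> A) y \<in> L"
  shows "chain_cond up (scalar_subspaces scal M (A <+>\<^bsub>M\<^esub> line M y))"
  unfolding line_def
  by (rule M.chain_cond_set_add[OF A _ ccA ccL]) (use y L in \<open>auto simp: line_def coeffs_def\<close>)

text \<open>Since \<open>\<Lambda>\<close> is generated over \<open>k\<close> by a finite set, adjoining \<open>\<Lambda> x\<close> means adjoining finitely many \<open>k\<close>-lines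
\<open>k s x\<close> one after the other. At each step the chain condition for the coefficient ideals that can occur
is what has to be supplied.\<close>
lemma chain_cond_adjoin_cyclic:
  assumes A: "A \<in> scalar_subspaces scal M (carrier M)" and x: "x \<in> carrier M"
    and ccA: "chain_cond up (scalar_subspaces scal M A)"
    and B: "B \<in> scalar_subspaces scal M (carrier M)" "A \<subseteq> B" "\<And>a. a \<in> carrier \<Lambda> \<Longrightarrow> a \<odot>\<^bsub>M\<^esub> x \<in> B"
      "B \<subseteq> A <+>\<^bsub>M\<^esub> (\<lambda>a. a \<odot>\<^bsub>M\<^esub> x) ` carrier \<Lambda>"
    and coeffs: "\<And>A' y. A' \<in> scalar_subspaces scal M (carrier M) \<Longrightarrow> A \<subseteq> A' \<Longrightarrow> A' \<subseteq> B \<Longrightarrow> y \<in> B \<Longrightarrow>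
      \<exists>L. chain_cond up L \<and> (\<forall>N \<in> scalar_subspaces scal M B. coeffs M (N <+>\<^bsub>M\<^esub> A') y \<in> L)"
  shows "chain_cond up (scalar_subspaces scal M B)"
proof -
  have Bc: "\<And>b. b \<in> B \<Longrightarrow> b \<in> carrier M" using scalar_subspacesD(1)[OF B(1)] by blast
  obtain S where S: "finite S" "S \<subseteq> carrier \<Lambda>"
    and gen: "\<And>a. a \<in> carrier \<Lambda> \<Longrightarrow> \<exists>c\<in>S \<rightarrow> carrier k. a = (\<Oplus>\<^bsub>\<Lambda>\<^esub>s\<in>S. \<phi> (c s) \<otimes>\<^bsub>\<Lambda>\<^esub> s)"
    using artin unfolding artin_algebra_def by metis
  have "\<exists>A'. A' \<in> scalar_subspaces scal M (carrier M) \<and> A \<subseteq> A' \<and> A' \<subseteq> B \<and> (\<forall>s\<in>T. s \<odot>\<^bsub>M\<^esub> x \<in> A') \<and>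
    chain_cond up (scalar_subspaces scal M A')" if "finite T" "T \<subseteq> carrier \<Lambda>" for T
    using that
  proof (induction T rule: finite_induct)
    case empty
    then show ?case using A B(2) ccA by blast
  next
    case (insert t T)
    then obtain A' where A': "A' \<in> scalar_subspaces scal M (carrier M)" "A \<subseteq> A'" "A' \<subseteq> B"
      "\<And>s. s \<in> T \<Longrightarrow> s \<odot>\<^bsub>M\<^esub> x \<in> A'" "chain_cond up (scalar_subspaces scal M A')" by auto
    let ?y = "t \<odot>\<^bsub>M\<^esub> x" and ?A = "A' <+>\<^bsub>M\<^esub> line M (t \<odot>\<^bsub>M\<^esub> x)"
    have t: "t \<in> carrier \<Lambda>" using insert.prems by simp
    have yB: "?y \<in> B" by (rule B(3)[OF t])
    have y: "?y \<in> carrier M" by (rule Bc[OF yB])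
    have lineB: "line M ?y \<subseteq> B" using scalar_subspacesD(5)[OF B(1)] yB by (auto simp: line_def)
    have AB: "?A \<subseteq> B" by (rule set_add_least[OF B(1) A'(3) lineB])
    obtain L where L: "chain_cond up L" "\<forall>N \<in> scalar_subspaces scal M B. coeffs M (N <+>\<^bsub>M\<^esub> A') ?y \<in> L"
      using coeffs[OF A'(1-3) yB] by blast
    have cc: "chain_cond up (scalar_subspaces scal M ?A)"
      by (rule chain_cond_adjoin_line[OF A'(1) y A'(5) L(1)])
        (use L(2) scalar_subspaces_superset[OF _ subset_refl AB] in blast)
    have sub: "A' \<subseteq> ?A" "line M ?y \<subseteq> ?A" using M.subset_set_add[OF A'(1) line_subspace[OF y]] .
    have "?y = \<phi> \<one>\<^bsub>k\<^esub> \<odot>\<^bsub>M\<^esub> ?y" using y by simp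
    then have "?y \<in> line M ?y" unfolding line_def by (rule image_eqI) simp
    then have "\<forall>s\<in>insert t T. s \<odot>\<^bsub>M\<^esub> x \<in> ?A" using sub A'(4) by blast
    then show ?case using M.add_scalar_subspace[OF A'(1) line_subspace[OF y] scal] A'(2) sub AB cc by blast
  qed
  from this[OF S] obtain A' where A': "A' \<in> scalar_subspaces scal M (carrier M)" "A \<subseteq> A'" "A' \<subseteq> B"
    "\<And>s. s \<in> S \<Longrightarrow> s \<odot>\<^bsub>M\<^esub> x \<in> A'" "chain_cond up (scalar_subspaces scal M A')" by blast
  note A1 = scalar_subspacesD[OF A'(1)]
  have mult: "a \<odot>\<^bsub>M\<^esub> x \<in> A'" if a: "a \<in> carrier \<Lambda>" for a
  proof -
    obtain c where c: "c \<in> S \<rightarrow> carrier k" "a = (\<Oplus>\<^bsub>\<Lambda>\<^esub>s\<in>S. \<phi> (c s) \<otimes>\<^bsub>\<Lambda>\<^esub> s)" using gen[OF a] by blast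
    have "a \<in> {a \<in> carrier \<Lambda>. a \<odot>\<^bsub>M\<^esub> x \<in> A'}"
      unfolding c(2)
    proof (rule L.finsum_in_subset[OF S(1)])
      fix s assume s: "s \<in> S"
      then have cs: "c s \<in> carrier k" "s \<in> carrier \<Lambda>" using c(1) S(2) by auto
      then show "\<phi> (c s) \<otimes>\<^bsub>\<Lambda>\<^esub> s \<in> {a \<in> carrier \<Lambda>. a \<odot>\<^bsub>M\<^esub> x \<in> A'}"
        using x A1(5)[of "\<phi> (c s)", OF _ A'(4)[OF s]] by (simp add: M.smult_assoc1)
    qed (use x A1 in \<open>auto simp: M.smult_l_null M.smult_l_distr\<close>)
    then show ?thesis by simp
  qed
  have "A <+>\<^bsub>M\<^esub> (\<lambda>a. a \<odot>\<^bsub>M\<^esub> x) ` carrier \<Lambda> \<subseteq> A'"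
    by (rule set_add_least[OF A'(1,2)]) (use mult in blast)
  then have "B \<subseteq> A'" using B(4) by (rule order_trans[rotated])
  then have "A' = B" using A'(3) by blast
  then show ?thesis using A'(5) by simp
qed

text \<open>An element \<open>r\<close> of \<open>k\<close> acts on the simple module \<open>B / A\<close> either as zero or injectively, because its
kernel is a submodule. In the second case \<open>r\<^sup>n = r\<^sup>n c r\<close> makes \<open>c r\<close> act as the identity. So \<open>k\<close> acts
through a field, a \<open>k\<close>-line contributes at most one step, and only two coefficient ideals can
occur. As a finite family satisfies both chain conditions, the argument works in both directions.\<close>
lemma chain_cond_composition_step:
  assumes A: "A \<in> scalar_subspaces (carrier \<Lambda>) M (carrier M)" and B: "B \<in> scalar_subspaces (carrier \<Lambda>) M (carrier M)"
    and AB: "A \<subset> B"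
    and simple: "\<And>N. N \<in> scalar_subspaces (carrier \<Lambda>) M (carrier M) \<Longrightarrow> A \<subseteq> N \<Longrightarrow> N \<subseteq> B \<Longrightarrow> N = A \<or> N = B"
    and ccA: "chain_cond up (scalar_subspaces scal M A)"
  shows "chain_cond up (scalar_subspaces scal M B)"
proof -
  note A' = scalar_subspacesD[OF A] and B' = scalar_subspacesD[OF B]
  have Bc: "\<And>b. b \<in> B \<Longrightarrow> b \<in> carrier M" using B'(1) by blast
  have As: "A \<in> scalar_subspaces scal M (carrier M)" and Bs: "B \<in> scalar_subspaces scal M (carrier M)"
    using A B scalar_subspaces_superset[OF _ scal subset_refl] by blast+
  obtain x where x: "x \<in> B" "x \<notin> A" using AB by blast
  let ?X = "(\<lambda>a. a \<odot>\<^bsub>M\<^esub> x) ` carrier \<Lambda>"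
  have xc: "x \<in> carrier M" using Bc x by blast
  have X: "?X \<in> scalar_subspaces (carrier \<Lambda>) M (carrier M)"
  proof (rule scalar_subspacesI)
    show "?X \<subseteq> carrier M" using xc by auto
    show "\<zero>\<^bsub>M\<^esub> \<in> ?X" using xc by (auto simp: M.smult_l_null intro!: image_eqI[of _ _ "\<zero>\<^bsub>\<Lambda>\<^esub>"])
    show "u \<oplus>\<^bsub>M\<^esub> v \<in> ?X" if "u \<in> ?X" "v \<in> ?X" for u v
      using that xc by (auto simp: M.smult_l_distr[symmetric])
    show "\<ominus>\<^bsub>M\<^esub> u \<in> ?X" if "u \<in> ?X" for u
      using that xc by (auto simp: M.smult_l_minus[symmetric])
    show "d \<odot>\<^bsub>M\<^esub> u \<in> ?X" if "d \<in> carrier \<Lambda>" "u \<in> ?X" for d u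
      using that xc by (auto simp: M.smult_assoc1[symmetric])
  qed
  have XB: "a \<odot>\<^bsub>M\<^esub> x \<in> B" if "a \<in> carrier \<Lambda>" for a using that B'(5) x by blast
  have sum: "A <+>\<^bsub>M\<^esub> ?X = A \<or> A <+>\<^bsub>M\<^esub> ?X = B"
  proof (rule simple)
    show "A <+>\<^bsub>M\<^esub> ?X \<in> scalar_subspaces (carrier \<Lambda>) M (carrier M)"
      by (rule M.add_scalar_subspace[OF A X subset_refl])
    show "A <+>\<^bsub>M\<^esub> ?X \<subseteq> B" by (rule set_add_least[OF B]) (use AB XB in auto)
  qed (rule M.subset_set_add[OF A X])
  have "x = \<one>\<^bsub>\<Lambda>\<^esub> \<odot>\<^bsub>M\<^esub> x" using xc by simp
  then have "x \<in> ?X" by (rule image_eqI) simp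
  then have "x \<in> A <+>\<^bsub>M\<^esub> ?X" using M.subset_set_add(2)[OF A X] by blast
  then have BX: "B = A <+>\<^bsub>M\<^esub> ?X" using sum x(2) by auto
  show ?thesis
  proof (rule chain_cond_adjoin_cyclic[OF As xc ccA Bs])
    show "A \<subseteq> B" using AB by blast
    show "B \<subseteq> A <+>\<^bsub>M\<^esub> ?X" using BX by simp
    show "a \<odot>\<^bsub>M\<^esub> x \<in> B" if "a \<in> carrier \<Lambda>" for a by (rule XB[OF that])
    fix C y assume C: "C \<in> scalar_subspaces scal M (carrier M)" "A \<subseteq> C" "C \<subseteq> B" and yB: "y \<in> B"
    have y: "y \<in> carrier M" using Bc yB by blast
    have "coeffs M (N <+>\<^bsub>M\<^esub> C) y \<in> {coeffs M C y, carrier k}" if N: "N \<in> scalar_subspaces scal M B" for N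
    proof (cases "coeffs M (N <+>\<^bsub>M\<^esub> C) y \<subseteq> coeffs M C y")
      case True
      have Nc: "N \<in> scalar_subspaces scal M (carrier M)"
        by (rule scalar_subspaces_superset[OF N subset_refl B'(1)])
      have "coeffs M C y \<subseteq> coeffs M (N <+>\<^bsub>M\<^esub> C) y"
        using M.subset_set_add(2)[OF Nc C(1)] by (auto simp: coeffs_def)
      with True show ?thesis by blast
    next
      case False
      have Nc: "N \<in> scalar_subspaces scal M (carrier M)"
        by (rule scalar_subspaces_superset[OF N subset_refl B'(1)])
      have NC: "N <+>\<^bsub>M\<^esub> C \<in> scalar_subspaces scal M (carrier M)"
        by (rule M.add_scalar_subspace[OF Nc C(1) scal])
      obtain r where r: "r \<in> carrier k" "\<phi> r \<odot>\<^bsub>M\<^esub> y \<in> N <+>\<^bsub>M\<^esub> C" "\<phi> r \<odot>\<^bsub>M\<^esub> y \<notin> C"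
        using False by (auto simp: coeffs_def)
      \<comment> \<open>The preimage in \<open>B\<close> of the kernel of \<open>r\<close> on \<open>B / A\<close>; it is a submodule because \<open>\<phi> r\<close> is central.\<close>
      define K where "K = {z \<in> B. \<phi> r \<odot>\<^bsub>M\<^esub> z \<in> A}"
      have "K \<in> scalar_subspaces (carrier \<Lambda>) M (carrier M)"
      proof (rule scalar_subspacesI)
        fix d z assume d: "d \<in> carrier \<Lambda>" and z: "z \<in> K"
        have "\<phi> r \<odot>\<^bsub>M\<^esub> (d \<odot>\<^bsub>M\<^esub> z) = d \<odot>\<^bsub>M\<^esub> (\<phi> r \<odot>\<^bsub>M\<^esub> z)"
          using central[OF r(1) d] z d r(1) Bc by (simp add: K_def M.smult_assoc1[symmetric])
        then show "d \<odot>\<^bsub>M\<^esub> z \<in> K" using z d A'(5) B'(5) by (simp add: K_def)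
      qed (use r(1) Bc A' B' in \<open>auto simp: K_def M.smult_r_distr M.smult_r_null M.smult_r_minus\<close>)
      then have "K = A \<or> K = B"
        by (rule simple) (use AB A'(5) r(1) in \<open>auto simp: K_def\<close>)
      then have KA: "K = A" using yB r(3) C(2) by (auto simp: K_def)
      have pow: "z \<in> A" if "z \<in> B" "\<phi> (r [^]\<^bsub>k\<^esub> (n::nat)) \<odot>\<^bsub>M\<^esub> z \<in> A" for z n
        using that
      proof (induction n arbitrary: z)
        case 0
        then show ?case using Bc by simp
      next
        case (Suc n)
        then have "\<phi> (r [^]\<^bsub>k\<^esub> n) \<odot>\<^bsub>M\<^esub> (\<phi> r \<odot>\<^bsub>M\<^esub> z) \<in> A"
          using Bc r(1) by (simp add: M.smult_assoc1)
        then have "\<phi> r \<odot>\<^bsub>M\<^esub> z \<in> A" using Suc.IH[of "\<phi> r \<odot>\<^bsub>M\<^esub> z"] Suc.prems B'(5) r(1) by simp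
        then show ?case using KA Suc.prems(1) by (auto simp: K_def)
      qed
      obtain n c where c: "c \<in> carrier k" "r [^]\<^bsub>k\<^esub> (n::nat) = r [^]\<^bsub>k\<^esub> n \<otimes>\<^bsub>k\<^esub> (c \<otimes>\<^bsub>k\<^esub> r)"
        using artinian_power_eq[OF artinian_k r(1)] by blast
      let ?w = "\<phi> (c \<otimes>\<^bsub>k\<^esub> r) \<odot>\<^bsub>M\<^esub> y"
      have w: "?w \<in> B" using B'(5) yB c(1) r(1) by simp
      have rn: "\<phi> (r [^]\<^bsub>k\<^esub> n) \<in> carrier \<Lambda>" using r(1) by simp
      have "\<phi> (r [^]\<^bsub>k\<^esub> n) \<odot>\<^bsub>M\<^esub> ?w = \<phi> (r [^]\<^bsub>k\<^esub> n \<otimes>\<^bsub>k\<^esub> (c \<otimes>\<^bsub>k\<^esub> r)) \<odot>\<^bsub>M\<^esub> y"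
        using c(1) r(1) y rn M.smult_assoc1[OF rn, of "\<phi> (c \<otimes>\<^bsub>k\<^esub> r)" y]
          str.hom_mult[of "r [^]\<^bsub>k\<^esub> n" "c \<otimes>\<^bsub>k\<^esub> r"] by (simp only: k.m_closed str.hom_closed k.nat_pow_closed)
      also have "\<dots> = \<phi> (r [^]\<^bsub>k\<^esub> n) \<odot>\<^bsub>M\<^esub> y" using c(2) by simp
      finally have "\<phi> (r [^]\<^bsub>k\<^esub> n) \<odot>\<^bsub>M\<^esub> (y \<ominus>\<^bsub>M\<^esub> ?w) = \<zero>\<^bsub>M\<^esub>"
        using M.smult_r_diff[OF rn y Bc[OF w]] rn y by (simp add: a_minus_def M.M.r_neg)
      then have "y \<ominus>\<^bsub>M\<^esub> ?w \<in> A" using pow[of "y \<ominus>\<^bsub>M\<^esub> ?w" n] B'(6)[OF yB w] A'(2) by simp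
      then have 1: "y \<ominus>\<^bsub>M\<^esub> ?w \<in> N <+>\<^bsub>M\<^esub> C" using C(2) M.subset_set_add(2)[OF Nc C(1)] by blast
      have "?w = \<phi> c \<odot>\<^bsub>M\<^esub> (\<phi> r \<odot>\<^bsub>M\<^esub> y)" using c(1) r(1) y by (simp add: M.smult_assoc1)
      then have 2: "?w \<in> N <+>\<^bsub>M\<^esub> C" using scalar_subspacesD(5)[OF NC _ r(2), of "\<phi> c"] c(1) by simp
      have "(y \<ominus>\<^bsub>M\<^esub> ?w) \<oplus>\<^bsub>M\<^esub> ?w = y" using y Bc[OF w] by (simp add: a_minus_def M.M.a_assoc M.M.l_neg)
      then have "y \<in> N <+>\<^bsub>M\<^esub> C" using scalar_subspacesD(3)[OF NC 1 2] by simp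
      then have "coeffs M (N <+>\<^bsub>M\<^esub> C) y = carrier k"
        using scalar_subspacesD(5)[OF NC] by (auto simp: coeffs_def)
      then show ?thesis by blast
    qed
    then show "\<exists>L. chain_cond up L \<and> (\<forall>N \<in> scalar_subspaces scal M B. coeffs M (N <+>\<^bsub>M\<^esub> C) y \<in> L)"
      by (intro exI[of _ "{coeffs M C y, carrier k}"]) (simp add: chain_cond_finite)
  qed
qed

lemma finite_length_chain_cond:
  assumes fl: "finite_length \<Lambda> M"
  shows "chain_cond up (scalar_subspaces scal M (carrier M))"
proof -
  obtain n F where F0: "F 0 = {\<zero>\<^bsub>M\<^esub>}" and Fn: "F n = carrier M"
    and sub: "\<And>i. i \<le> n \<Longrightarrow> submodule (F i) \<Lambda> M"
    and lt: "\<And>i. i < n \<Longrightarrow> F i \<subset> F (Suc i)"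
    and simple: "\<And>i N. \<lbrakk>i < n; submodule N \<Lambda> M; F i \<subseteq> N; N \<subseteq> F (Suc i)\<rbrakk> \<Longrightarrow> N = F i \<or> N = F (Suc i)"
    using fl unfolding finite_length_def by metis
  have "chain_cond up (scalar_subspaces scal M (F i))" if "i \<le> n" for i
    using that
  proof (induction i)
    case 0
    have "scalar_subspaces scal M (F 0) \<subseteq> {{\<zero>\<^bsub>M\<^esub>}}" by (auto simp: F0 scalar_subspaces_def)
    then show ?case using chain_cond_finite chain_cond_subset by blast
  next
    case (Suc i)
    then have i: "i < n" and le: "i \<le> n" by auto
    show ?case
      using chain_cond_composition_step[of "F i" "F (Suc i)" up] sub[OF le] sub[OF Suc.prems] lt[OF i] simple[OF i]
        Suc.IH[OF le] unfolding M.submodule_iff by blast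
  qed
  from this[of n] show ?thesis using Fn by simp
qed

end

end

text \<open>Among the submodules that are reached by a composition series choose a maximal one; if it were not \<open>B\<close>,
a minimal submodule strictly above it would prolong the series.\<close>
lemma (in left_module) finite_lengthI:
  assumes B: "B \<in> scalar_subspaces (carrier R) M (carrier M)"
    and up: "chain_cond True (scalar_subspaces (carrier R) M B)"
    and down: "chain_cond False (scalar_subspaces (carrier R) M B)"
  shows "finite_length R (M\<lparr>carrier := B\<rparr>)"
proof -
  let ?S = "scalar_subspaces (carrier R) M B"
  define series where "series X n F \<longleftrightarrow> F 0 = {\<zero>\<^bsub>M\<^esub>} \<and> F n = X \<and> (\<forall>i\<le>n. F i \<in> ?S) \<and>
      (\<forall>i<n. F i \<subset> F (Suc i) \<and> (\<forall>N. N \<in> ?S \<and> F i \<subseteq> N \<and> N \<subseteq> F (Suc i) \<longrightarrow> N = F i \<or> N = F (Suc i)))"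
    for X and n :: nat and F
  define G where "G = {X. \<exists>n F. series X n F}"
  have "series {\<zero>\<^bsub>M\<^esub>} 0 (\<lambda>_. {\<zero>\<^bsub>M\<^esub>})"
    using zero_scalar_subspace[OF subset_refl] scalar_subspacesD(2)[OF B]
    by (auto simp: series_def scalar_subspaces_def)
  then have ne: "G \<noteq> {}" by (auto simp: G_def)
  have "G \<subseteq> ?S" by (auto simp: G_def series_def)
  from chain_cond_extremal[OF up this ne] obtain X
    where X: "X \<in> G" and max0: "\<forall>N\<in>G. beyond True X N \<longrightarrow> N = X" ..
  have max: "N = X" if "N \<in> G" "X \<subseteq> N" for N
    using max0[THEN bspec, of N] that by (simp add: beyond_def)
  obtain n F where s: "series X n F" using X by (auto simp: G_def)
  have XS: "X \<in> ?S" using s by (auto simp: series_def)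
  have BS: "B \<in> ?S" using B by (auto simp: scalar_subspaces_def)
  have "X = B"
  proof (rule ccontr)
    assume "X \<noteq> B"
    then have XB: "X \<subset> B" using scalar_subspacesD(1)[OF XS] by blast
    let ?H = "{N \<in> ?S. X \<subset> N}"
    have ne: "?H \<noteq> {}" using XB BS by blast
    have sub: "?H \<subseteq> ?S" by blast
    have "\<exists>Y\<in>?H. \<forall>N\<in>?H. beyond False Y N \<longrightarrow> N = Y"
      by (rule chain_cond_extremal[OF down sub ne])
    then obtain Y where Y0: "Y \<in> ?H" and min0: "\<forall>N\<in>?H. beyond False Y N \<longrightarrow> N = Y" ..
    have Y: "Y \<in> ?S" "X \<subset> Y" using Y0 by auto
    have min: "N = Y" if "N \<in> ?S" "X \<subset> N" "N \<subseteq> Y" for N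
      using min0[THEN bspec, of N] that by (simp add: beyond_def)
    have "series Y (Suc n) (F(Suc n := Y))"
      unfolding series_def
    proof (intro conjI allI impI)
      fix i assume i: "i < Suc n"
      show "(F(Suc n := Y)) i \<subset> (F(Suc n := Y)) (Suc i)" using s Y(2) i by (auto simp: series_def less_Suc_eq)
      fix N assume "N \<in> ?S \<and> (F(Suc n := Y)) i \<subseteq> N \<and> N \<subseteq> (F(Suc n := Y)) (Suc i)"
      then show "N = (F(Suc n := Y)) i \<or> N = (F(Suc n := Y)) (Suc i)"
        using s min[of N] i by (cases "i = n") (auto simp: series_def)
    qed (use s Y(1) in \<open>auto simp: series_def le_Suc_eq\<close>)
    then have "Y \<in> G" by (auto simp: G_def)
    then show False using max[of Y] Y(2) by blast
  qed
  then show ?thesis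
    using s unfolding series_def finite_length_def submodule_sub_iff[OF B] by auto
qed

section \<open>Finitely supported families\<close>

definition regular_module :: "('a, 'r) ring_scheme \<Rightarrow> ('a, 'a) module" where
  "regular_module R = \<lparr>carrier = carrier R, mult = undefined, one = undefined,
     zero = \<zero>\<^bsub>R\<^esub>, add = add R, smult = mult R\<rparr>"

text \<open>This one construction serves as the direct sum in which the ladder is built, as the finite
powers in the finiteness arguments, and (over the regular module) as the free cover.\<close>
definition finsupp :: "'i set \<Rightarrow> ('a, 'b, 'm) module_scheme \<Rightarrow> ('a, 'i \<Rightarrow> 'b) module" where
  "finsupp I M = \<lparr>carrier = {c. (\<forall>i\<in>I. c i \<in> carrier M) \<and> (\<forall>i. i \<notin> I \<longrightarrow> c i = \<zero>\<^bsub>M\<^esub>) \<and>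
       finite {i. c i \<noteq> \<zero>\<^bsub>M\<^esub>}},
     mult = undefined, one = undefined, zero = (\<lambda>i. \<zero>\<^bsub>M\<^esub>),
     add = (\<lambda>c d i. if i \<in> I then c i \<oplus>\<^bsub>M\<^esub> d i else \<zero>\<^bsub>M\<^esub>),
     smult = (\<lambda>a c i. if i \<in> I then a \<odot>\<^bsub>M\<^esub> c i else \<zero>\<^bsub>M\<^esub>)\<rparr>"

lemma free_cover_eq: "free_cover R X = finsupp (carrier X) (regular_module R)"
  by (simp add: free_cover_def finsupp_def regular_module_def cong: if_cong)

lemma left_module_regular:
  assumes R: "ring R"
  shows "left_module R (regular_module R)"
proof -
  interpret R: ring R by fact
  have ab: "abelian_group (regular_module R)"
    by (rule abelian_groupI) (auto simp: regular_module_def R.a_ac intro: R.l_neg)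
  show ?thesis
    by (intro left_module.intro left_module_axioms.intro ab R)
      (auto simp: regular_module_def R.l_distr R.r_distr R.m_assoc)
qed

lemma left_module_finsupp:
  assumes M: "left_module R M"
  shows "left_module R (finsupp I M)"
proof -
  interpret M: left_module R M by fact
  have fin: "finite {i. (if i \<in> I then c i \<oplus>\<^bsub>M\<^esub> d i else \<zero>\<^bsub>M\<^esub>) \<noteq> \<zero>\<^bsub>M\<^esub>}"
    if "finite {i. c i \<noteq> \<zero>\<^bsub>M\<^esub>}" "finite {i. d i \<noteq> \<zero>\<^bsub>M\<^esub>}" for c d
    by (rule finite_subset[OF _ finite_UnI[OF that]]) auto
  have fin': "finite {i. (if i \<in> I then a \<odot>\<^bsub>M\<^esub> c i else \<zero>\<^bsub>M\<^esub>) \<noteq> \<zero>\<^bsub>M\<^esub>}"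
    if "finite {i. c i \<noteq> \<zero>\<^bsub>M\<^esub>}" "a \<in> carrier R" for a c
    by (rule finite_subset[OF _ that(1)]) (use that in \<open>auto simp: M.smult_r_null\<close>)
  have ab: "abelian_group (finsupp I M)"
  proof (rule abelian_groupI)
    fix c assume c: "c \<in> carrier (finsupp I M)"
    let ?d = "\<lambda>i. if i \<in> I then \<ominus>\<^bsub>M\<^esub> c i else \<zero>\<^bsub>M\<^esub>"
    have "finite {i. ?d i \<noteq> \<zero>\<^bsub>M\<^esub>}"
      by (rule finite_subset[of _ "{i. c i \<noteq> \<zero>\<^bsub>M\<^esub>}"]) (use c in \<open>auto simp: finsupp_def\<close>)
    then have "?d \<in> carrier (finsupp I M)" using c by (auto simp: finsupp_def)
    moreover have "?d \<oplus>\<^bsub>finsupp I M\<^esub> c = \<zero>\<^bsub>finsupp I M\<^esub>"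
      using c by (auto simp: finsupp_def fun_eq_iff M.M.l_neg)
    ultimately show "\<exists>d\<in>carrier (finsupp I M). d \<oplus>\<^bsub>finsupp I M\<^esub> c = \<zero>\<^bsub>finsupp I M\<^esub>" by blast
  qed (use fin in \<open>auto simp: finsupp_def fun_eq_iff M.M.a_ac\<close>)
  show ?thesis
    by (intro left_module.intro left_module_axioms.intro ab M.R.ring_axioms)
      (use fin' in \<open>auto simp: finsupp_def fun_eq_iff M.smult_l_distr M.smult_r_distr M.smult_assoc1\<close>)
qed

lemma finsupp_eval_hom:
  assumes M: "left_module R M"
  shows "(\<lambda>c. c i) \<in> mod_hom R (finsupp I M) M"
proof -
  interpret M: left_module R M by fact
  show ?thesis
    by (cases "i \<in> I") (auto simp: mod_hom_def finsupp_def M.smult_r_null)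
qed

definition supported :: "'i set \<Rightarrow> ('a, 'b, 'm) module_scheme \<Rightarrow> 'i set \<Rightarrow> 'b set \<Rightarrow> ('i \<Rightarrow> 'b) set" where
  "supported I M J A = {c \<in> carrier (finsupp I M). (\<forall>i\<in>J. c i \<in> A) \<and> (\<forall>i. i \<notin> J \<longrightarrow> c i = \<zero>\<^bsub>M\<^esub>)}"

lemma supported_subspace:
  assumes M: "left_module R M" and A: "A \<in> scalar_subspaces D M (carrier M)" and D: "D \<subseteq> carrier R"
  shows "supported I M J A \<in> scalar_subspaces D (finsupp I M) (carrier (finsupp I M))"
proof -
  interpret M: left_module R M by fact
  interpret P: left_module R "finsupp I M" by (rule left_module_finsupp[OF M])
  note h = mod_homD[OF finsupp_eval_hom[OF M, of _ I]] mod_hom_minus[OF finsupp_eval_hom[OF M, of _ I] P.left_module_axioms M]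
  note A' = scalar_subspacesD[OF A]
  show ?thesis
    by (rule scalar_subspacesI) (use h A' D in \<open>auto simp: supported_def subset_iff M.smult_r_null\<close>)
qed

text \<open>A finite power inherits the chain condition by adding one coordinate at a time.\<close>
lemma chain_cond_supported:
  assumes M: "left_module R M" and A: "A \<in> scalar_subspaces D M (carrier M)" and D: "D \<subseteq> carrier R"
    and cc: "chain_cond up (scalar_subspaces D M A)" and J: "finite J"
  shows "chain_cond up (scalar_subspaces D (finsupp I M) (supported I M J A))"
  using J
proof (induction J rule: finite_induct)
  case empty
  have "scalar_subspaces D (finsupp I M) (supported I M {} A) \<subseteq> {{\<lambda>i. \<zero>\<^bsub>M\<^esub>}}"
    by (auto simp: scalar_subspaces_def supported_def finsupp_def)
  then show ?case using chain_cond_finite chain_cond_subset by blast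
next
  case (insert j J)
  interpret M: left_module R M by fact
  interpret P: left_module R "finsupp I M" by (rule left_module_finsupp[OF M])
  note hom = finsupp_eval_hom[OF M, of _ I]
  note h = mod_homD[OF hom] mod_hom_minus[OF hom P.left_module_axioms M]
  let ?B = "supported I M (insert j J) A" and ?C = "supported I M J A"
  have B: "?B \<in> scalar_subspaces D (finsupp I M) (carrier (finsupp I M))"
    and C: "?C \<in> scalar_subspaces D (finsupp I M) (carrier (finsupp I M))"
    by (rule supported_subspace[OF M A D])+
  show ?case
  proof (rule chain_cond_lex[OF insert.IH cc])
    fix N assume N: "N \<in> scalar_subspaces D (finsupp I M) ?B"
    note N1 = scalar_subspacesD[OF N]
    have Nc: "N \<in> scalar_subspaces D (finsupp I M) (carrier (finsupp I M))"
      by (rule scalar_subspaces_superset[OF N subset_refl scalar_subspacesD(1)[OF B]])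
    show "N \<inter> ?C \<in> scalar_subspaces D (finsupp I M) ?C"
      by (rule scalar_subspaces_superset[OF scalar_subspaces_Int[OF N scalar_subspaces_self[OF C]]]) auto
    have "(\<lambda>c. c j) ` N \<in> scalar_subspaces D M (carrier M)"
      by (rule scalar_subspaces_image[OF hom P.left_module_axioms M D Nc])
    moreover have "(\<lambda>c. c j) ` N \<subseteq> A" using N1(1) by (auto simp: supported_def)
    ultimately show "(\<lambda>c. c j) ` N \<in> scalar_subspaces D M A"
      unfolding scalar_subspaces_def by blast
    fix N' assume N': "N' \<in> scalar_subspaces D (finsupp I M) ?B" and le: "N \<subseteq> N'"
    note N2 = scalar_subspacesD[OF N']
    show "N \<inter> ?C \<subseteq> N' \<inter> ?C" using le by blast
    show "(\<lambda>c. c j) ` N \<subseteq> (\<lambda>c. c j) ` N'" using le by blast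
    assume eq: "N \<inter> ?C = N' \<inter> ?C" "(\<lambda>c. c j) ` N = (\<lambda>c. c j) ` N'"
    show "N' \<subseteq> N"
    proof
      fix x assume x: "x \<in> N'"
      then have "x j \<in> (\<lambda>c. c j) ` N" unfolding eq(2) by (rule imageI)
      then obtain n where n: "n \<in> N" "x j = n j" by blast
      have nN': "n \<in> N'" using le n(1) by blast
      have xc: "x \<in> carrier (finsupp I M)" and nc: "n \<in> carrier (finsupp I M)"
        using subsetD[OF N2(1)] x nN' by (auto simp: supported_def)
      let ?z = "x \<ominus>\<^bsub>finsupp I M\<^esub> n"
      have z: "?z \<in> N'" by (rule N2(6)[OF x nN'])
      have zB: "?z \<in> ?B" using subsetD[OF N2(1) z] .
      have "?z j = x j \<ominus>\<^bsub>M\<^esub> n j" by (rule h(6)[OF xc nc])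
      also have "\<dots> = \<zero>\<^bsub>M\<^esub>" using n(2) h(1)[OF nc, of j] by (simp add: a_minus_def M.M.r_neg)
      finally have zj: "?z j = \<zero>\<^bsub>M\<^esub>" .
      have "?z \<in> ?C" using zB zj by (auto simp: supported_def)
      then have "?z \<in> N" using eq(1) z by blast
      then have "?z \<oplus>\<^bsub>finsupp I M\<^esub> n \<in> N" using N1(3) n(1) by blast
      moreover have "?z \<oplus>\<^bsub>finsupp I M\<^esub> n = x"
        using xc nc by (simp add: a_minus_def P.M.a_assoc P.M.l_neg)
      ultimately show "x \<in> N" by simp
    qed
  qed
qed

text \<open>\<open>\<Lambda>\<close> is finitely generated over the artinian ring \<open>k\<close>. Only the descending condition is claimed, since
the coefficient ideals here are arbitrary ideals of \<open>k\<close>.\<close>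
lemma (in artin_alg) chain_cond_regular:
  "chain_cond False (scalar_subspaces scal (regular_module \<Lambda>) (carrier \<Lambda>))"
proof -
  have M: "left_module \<Lambda> (regular_module \<Lambda>)" by (rule left_module_regular[OF ring_\<Lambda>])
  interpret M: left_module \<Lambda> "regular_module \<Lambda>" by (rule M)
  have s [simp]: "carrier (regular_module \<Lambda>) = carrier \<Lambda>" "\<zero>\<^bsub>regular_module \<Lambda>\<^esub> = \<zero>\<^bsub>\<Lambda>\<^esub>"
    "a \<odot>\<^bsub>regular_module \<Lambda>\<^esub> x = a \<otimes>\<^bsub>\<Lambda>\<^esub> x" for a x
    by (simp_all add: regular_module_def)
  have z: "{\<zero>\<^bsub>\<Lambda>\<^esub>} \<in> scalar_subspaces scal (regular_module \<Lambda>) (carrier \<Lambda>)"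
    using M.zero_scalar_subspace[OF scal] by simp
  have B: "carrier \<Lambda> \<in> scalar_subspaces scal (regular_module \<Lambda>) (carrier \<Lambda>)"
    using M.carrier_scalar_subspace[OF scal] by simp
  show ?thesis
  proof (rule chain_cond_adjoin_cyclic[OF M, unfolded s, OF z])
    have "scalar_subspaces scal (regular_module \<Lambda>) {\<zero>\<^bsub>\<Lambda>\<^esub>} \<subseteq> {{\<zero>\<^bsub>\<Lambda>\<^esub>}}"
      by (auto simp: scalar_subspaces_def)
    then show "chain_cond False (scalar_subspaces scal (regular_module \<Lambda>) {\<zero>\<^bsub>\<Lambda>\<^esub>})"
      using chain_cond_finite chain_cond_subset by blast
    show "carrier \<Lambda> \<subseteq> {\<zero>\<^bsub>\<Lambda>\<^esub>} <+>\<^bsub>regular_module \<Lambda>\<^esub> (\<lambda>a. a \<otimes>\<^bsub>\<Lambda>\<^esub> \<one>\<^bsub>\<Lambda>\<^esub>) ` carrier \<Lambda>"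
    proof
      fix x assume x: "x \<in> carrier \<Lambda>"
      then have "x = \<zero>\<^bsub>\<Lambda>\<^esub> \<oplus>\<^bsub>regular_module \<Lambda>\<^esub> x \<otimes>\<^bsub>\<Lambda>\<^esub> \<one>\<^bsub>\<Lambda>\<^esub>" by (simp add: regular_module_def)
      then show "x \<in> {\<zero>\<^bsub>\<Lambda>\<^esub>} <+>\<^bsub>regular_module \<Lambda>\<^esub> (\<lambda>a. a \<otimes>\<^bsub>\<Lambda>\<^esub> \<one>\<^bsub>\<Lambda>\<^esub>) ` carrier \<Lambda>"
        using x unfolding M.mem_set_add by blast
    qed
    fix C y assume C: "C \<in> scalar_subspaces scal (regular_module \<Lambda>) (carrier \<Lambda>)" and y: "y \<in> carrier \<Lambda>"
    have "ideal (coeffs (regular_module \<Lambda>) (N <+>\<^bsub>regular_module \<Lambda>\<^esub> C) y) k"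
      if "N \<in> scalar_subspaces scal (regular_module \<Lambda>) (carrier \<Lambda>)" for N
      using coeffs_ideal[OF M M.add_scalar_subspace[OF _ _ scal], unfolded s, OF that C y] .
    then show "\<exists>L. chain_cond False L \<and> (\<forall>N\<in>scalar_subspaces scal (regular_module \<Lambda>) (carrier \<Lambda>).
        coeffs (regular_module \<Lambda>) (N <+>\<^bsub>regular_module \<Lambda>\<^esub> C) y \<in> L)"
      using chain_cond_ideals[OF artinian_k] by (intro exI[of _ "{I. ideal I k}"]) simp
  qed (use B in auto)
qed

section \<open>Homomorphisms determined by finitely many values\<close>

text \<open>By the descending chain condition on \<open>K\<close> there is a finite \<open>T \<subseteq> H\<close> whose common kernel is the common kernel
of all of \<open>H\<close>; evaluation at \<open>T\<close> then embeds \<open>K\<close> modulo that kernel into the power \<open>A\<^sup>T\<close>. By the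
ascending chain condition in that power, there is a finite \<open>C\<close> such that the set of points where everything
vanishing on \<open>C\<close> has to vanish cannot be enlarged; this set is all of \<open>K\<close>.\<close>
lemma finite_determining_set:
  assumes F: "left_module R F" and M: "left_module R M" and D: "D \<subseteq> carrier R"
    and K: "K \<in> scalar_subspaces D F (carrier F)" and A: "A \<in> scalar_subspaces D M (carrier M)"
    and dcc: "chain_cond False (scalar_subspaces D F K)" and acc: "chain_cond True (scalar_subspaces D M A)"
    and H: "H \<subseteq> mod_hom R F M" and HA: "\<And>f x. f \<in> H \<Longrightarrow> x \<in> K \<Longrightarrow> f x \<in> A"
  shows "\<exists>C. finite C \<and> C \<subseteq> K \<and> (\<forall>f\<in>H. (\<forall>c\<in>C. f c = \<zero>\<^bsub>M\<^esub>) \<longrightarrow> (\<forall>x\<in>K. f x = \<zero>\<^bsub>M\<^esub>))"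
proof -
  interpret M: left_module R M by fact
  note K' = scalar_subspacesD[OF K]
  have Kc: "\<And>x. x \<in> K \<Longrightarrow> x \<in> carrier F" using K'(1) by blast
  have h: "f (x \<oplus>\<^bsub>F\<^esub> y) = f x \<oplus>\<^bsub>M\<^esub> f y" "f (\<ominus>\<^bsub>F\<^esub> x) = \<ominus>\<^bsub>M\<^esub> f x" "f (x \<ominus>\<^bsub>F\<^esub> y) = f x \<ominus>\<^bsub>M\<^esub> f y"
    "f \<zero>\<^bsub>F\<^esub> = \<zero>\<^bsub>M\<^esub>" "f x \<in> carrier M"
    if "f \<in> H" "x \<in> K" "y \<in> K" for f x y
  proof -
    have f: "f \<in> mod_hom R F M" using H that(1) by blast
    show "f (x \<oplus>\<^bsub>F\<^esub> y) = f x \<oplus>\<^bsub>M\<^esub> f y" "f (\<ominus>\<^bsub>F\<^esub> x) = \<ominus>\<^bsub>M\<^esub> f x" "f (x \<ominus>\<^bsub>F\<^esub> y) = f x \<ominus>\<^bsub>M\<^esub> f y"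
      "f \<zero>\<^bsub>F\<^esub> = \<zero>\<^bsub>M\<^esub>" "f x \<in> carrier M"
      using mod_homD[OF f] mod_hom_minus[OF f F M] Kc that(2,3) by simp_all
  qed
  have hs: "f (d \<odot>\<^bsub>F\<^esub> x) = d \<odot>\<^bsub>M\<^esub> f x" if "f \<in> H" "d \<in> D" "x \<in> K" for f d x
  proof -
    have f: "f \<in> mod_hom R F M" using H that(1) by blast
    show ?thesis using mod_homD(3)[OF f] D that(2) Kc[OF that(3)] by auto
  qed
  define L where "L T = {x \<in> K. \<forall>f\<in>T. f x = \<zero>\<^bsub>M\<^esub>}" for T
  have LS: "L T \<in> scalar_subspaces D F K" if T: "T \<subseteq> H" for T
  proof (rule scalar_subspacesI)
    show "\<zero>\<^bsub>F\<^esub> \<in> L T" using K'(2) h(4)[OF _ K'(2) K'(2)] T by (auto simp: L_def)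
    show "x \<oplus>\<^bsub>F\<^esub> y \<in> L T" if "x \<in> L T" "y \<in> L T" for x y
    proof -
      have "f (x \<oplus>\<^bsub>F\<^esub> y) = \<zero>\<^bsub>M\<^esub>" if f: "f \<in> T" for f
      proof -
        have "f \<in> H" "x \<in> K" "y \<in> K" "f x = \<zero>\<^bsub>M\<^esub>" "f y = \<zero>\<^bsub>M\<^esub>"
          using f T \<open>x \<in> L T\<close> \<open>y \<in> L T\<close> by (auto simp only: L_def)
        then show ?thesis using h(1)[of f x y] by simp
      qed
      then show ?thesis using that K'(3) by (simp add: L_def)
    qed
    show "\<ominus>\<^bsub>F\<^esub> x \<in> L T" if "x \<in> L T" for x
    proof -
      have "f (\<ominus>\<^bsub>F\<^esub> x) = \<zero>\<^bsub>M\<^esub>" if f: "f \<in> T" for f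
      proof -
        have "f \<in> H" "x \<in> K" "f x = \<zero>\<^bsub>M\<^esub>" using f T \<open>x \<in> L T\<close> by (auto simp only: L_def)
        then show ?thesis using h(2)[of f x x] by simp
      qed
      then show ?thesis using that K'(4) by (simp add: L_def)
    qed
    show "d \<odot>\<^bsub>F\<^esub> x \<in> L T" if "d \<in> D" "x \<in> L T" for d x
    proof -
      have "f (d \<odot>\<^bsub>F\<^esub> x) = \<zero>\<^bsub>M\<^esub>" if f: "f \<in> T" for f
      proof -
        have "f \<in> H" "x \<in> K" "f x = \<zero>\<^bsub>M\<^esub>" using f T \<open>x \<in> L T\<close> by (auto simp only: L_def)
        then show ?thesis using hs[of f d x] \<open>d \<in> D\<close> D by (auto simp: M.smult_r_null)
      qed
      then show ?thesis using that K'(5) by (simp add: L_def)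
    qed
  qed (auto simp: L_def)
  have "\<exists>Y\<in>L ` {T. finite T \<and> T \<subseteq> H}. \<forall>N\<in>L ` {T. finite T \<and> T \<subseteq> H}. beyond False Y N \<longrightarrow> N = Y"
    by (rule chain_cond_extremal[OF dcc]) (use LS in auto)
  then obtain Y where Y: "Y \<in> L ` {T. finite T \<and> T \<subseteq> H}"
    and minY: "\<forall>N\<in>L ` {T. finite T \<and> T \<subseteq> H}. beyond False Y N \<longrightarrow> N = Y" ..
  obtain T where T: "finite T" "T \<subseteq> H" "Y = L T" using Y by blast
  have minT: "L T' = L T" if "finite T'" "T' \<subseteq> H" "L T' \<subseteq> L T" for T'
    using minY[THEN bspec, of "L T'"] that T(3) by (simp add: beyond_def)
  have LT: "f x = \<zero>\<^bsub>M\<^esub>" if f: "f \<in> H" and x: "x \<in> L T" for f x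
  proof -
    have "L (insert f T) = L T" by (rule minT) (use T f in \<open>auto simp: L_def\<close>)
    then have "x \<in> L (insert f T)" using x by simp
    then show ?thesis by (simp add: L_def)
  qed
  define ev where "ev x = (\<lambda>f. if f \<in> T then f x else \<zero>\<^bsub>M\<^esub>)" for x
  interpret P: left_module R "finsupp T M" by (rule left_module_finsupp[OF M])
  have ev: "ev \<in> mod_hom R F (finsupp T M)"
  proof -
    have TH: "f \<in> mod_hom R F M" if "f \<in> T" for f using that T H by blast
    have "finite {f. (if f \<in> T then f x else \<zero>\<^bsub>M\<^esub>) \<noteq> \<zero>\<^bsub>M\<^esub>}" for x
      by (rule finite_subset[OF _ T(1)]) auto
    then show ?thesis
      using mod_homD[OF TH] by (auto simp: mod_hom_def ev_def finsupp_def fun_eq_iff)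
  qed
  \<comment> \<open>The points at which every member of \<open>H\<close> vanishing on \<open>C\<close> vanishes: a double annihilator, hence a subspace, which takes the place of the span of \<open>C\<close>.\<close>
  define dbl where "dbl C = {x \<in> K. \<forall>f\<in>H. (\<forall>c\<in>C. f c = \<zero>\<^bsub>M\<^esub>) \<longrightarrow> f x = \<zero>\<^bsub>M\<^esub>}" for C
  have "dbl C = L {f \<in> H. \<forall>c\<in>C. f c = \<zero>\<^bsub>M\<^esub>}" for C by (auto simp: dbl_def L_def)
  then have dS: "dbl C \<in> scalar_subspaces D F (carrier F)" for C
    using scalar_subspaces_superset[OF LS subset_refl K'(1)] by simp
  let ?G = "(\<lambda>C. ev ` dbl C) ` {C. finite C \<and> C \<subseteq> K}"
  have "?G \<subseteq> scalar_subspaces D (finsupp T M) (supported T M T A)"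
  proof (rule image_subsetI)
    fix C
    have 1: "ev ` dbl C \<in> scalar_subspaces D (finsupp T M) (carrier (finsupp T M))"
      by (rule scalar_subspaces_image[OF ev F P.left_module_axioms D dS])
    have "ev ` dbl C \<subseteq> supported T M T A"
      using scalar_subspacesD(1)[OF 1] HA T(2) by (auto simp: supported_def ev_def dbl_def)
    with 1 show "ev ` dbl C \<in> scalar_subspaces D (finsupp T M) (supported T M T A)"
      unfolding scalar_subspaces_def by blast
  qed
  then have "\<exists>Y\<in>?G. \<forall>N\<in>?G. beyond True Y N \<longrightarrow> N = Y"
    by (rule chain_cond_extremal[OF chain_cond_supported[OF M A D acc T(1)]]) blast
  then obtain Y where Y: "Y \<in> ?G" and maxY: "\<forall>N\<in>?G. beyond True Y N \<longrightarrow> N = Y" ..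
  obtain C where C: "finite C" "C \<subseteq> K" "Y = ev ` dbl C" using Y by blast
  have max: "ev ` dbl C' = ev ` dbl C" if "finite C'" "C' \<subseteq> K" "ev ` dbl C \<subseteq> ev ` dbl C'" for C'
    using maxY[THEN bspec, of "ev ` dbl C'"] that C(3) by (simp add: beyond_def)
  have "f x = \<zero>\<^bsub>M\<^esub>" if f: "f \<in> H" "\<And>c. c \<in> C \<Longrightarrow> f c = \<zero>\<^bsub>M\<^esub>" and x: "x \<in> K" for f x
  proof -
    have "ev ` dbl (insert x C) = ev ` dbl C" by (rule max) (use C x in \<open>auto simp: dbl_def\<close>)
    moreover have "x \<in> dbl (insert x C)" using x by (simp add: dbl_def)
    ultimately have "ev x \<in> ev ` dbl C" by blast
    then obtain d where d: "d \<in> dbl C" "ev x = ev d" by blast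
    have dK: "d \<in> K" using d(1) by (simp add: dbl_def)
    have "g (x \<ominus>\<^bsub>F\<^esub> d) = \<zero>\<^bsub>M\<^esub>" if g: "g \<in> T" for g
    proof -
      have gH: "g \<in> H" using g T by blast
      have "g x = g d" using fun_cong[OF d(2), of g] g by (simp add: ev_def)
      then show ?thesis using h(3)[OF gH x dK] h(5)[OF gH dK dK] by (simp add: a_minus_def M.M.r_neg)
    qed
    then have "x \<ominus>\<^bsub>F\<^esub> d \<in> L T" using K'(6)[OF x dK] by (simp add: L_def)
    then have "f x \<ominus>\<^bsub>M\<^esub> f d = \<zero>\<^bsub>M\<^esub>" using LT[OF f(1)] h(3)[OF f(1) x dK] by simp
    moreover have "f d = \<zero>\<^bsub>M\<^esub>" using d(1) f by (simp add: dbl_def)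
    ultimately show ?thesis using M.M.diff_eq_zero_iff[OF h(5)[OF f(1) x x] h(5)[OF f(1) dK dK]] by simp
  qed
  then have "\<forall>f\<in>H. (\<forall>c\<in>C. f c = \<zero>\<^bsub>M\<^esub>) \<longrightarrow> (\<forall>x\<in>K. f x = \<zero>\<^bsub>M\<^esub>)" by simp
  with C(1,2) show ?thesis by (intro exI[of _ C] conjI)
qed

section \<open>Lifting from the free cover\<close>

definition basis_elt :: "('a, 'r) ring_scheme \<Rightarrow> 'b \<Rightarrow> 'b \<Rightarrow> 'a" where
  "basis_elt R x = (\<lambda>w. if w = x then \<one>\<^bsub>R\<^esub> else \<zero>\<^bsub>R\<^esub>)"

definition lin_ext :: "('a, 'r) ring_scheme \<Rightarrow> ('a, 'c, 'm) module_scheme \<Rightarrow> ('b \<Rightarrow> 'c) \<Rightarrow> ('b \<Rightarrow> 'a) \<Rightarrow> 'c" where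
  "lin_ext R M y c = (\<Oplus>\<^bsub>M\<^esub>x\<in>{x. c x \<noteq> \<zero>\<^bsub>R\<^esub>}. c x \<odot>\<^bsub>M\<^esub> y x)"

lemma lin_ext_hom:
  assumes M: "left_module R M" and y: "y \<in> carrier X \<rightarrow> carrier M"
  shows "lin_ext R M y \<in> mod_hom R (free_cover R X) M"
proof -
  interpret M: left_module R M by fact
  interpret F: left_module R "free_cover R X" by (rule left_module_free_cover) (rule M.R.ring_axioms)
  have yc: "\<And>x. x \<in> carrier X \<Longrightarrow> y x \<in> carrier M" using y by auto
  have ext: "lin_ext R M y c = (\<Oplus>\<^bsub>M\<^esub>x\<in>A. c x \<odot>\<^bsub>M\<^esub> y x)"
    if c: "c \<in> carrier (free_cover R X)" and A: "finite A" "{x. c x \<noteq> \<zero>\<^bsub>R\<^esub>} \<subseteq> A" "A \<subseteq> carrier X" for c A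
    unfolding lin_ext_def
    by (rule M.add.finprod_mono_neutral_cong_left)
      (use c A yc in \<open>auto simp: free_cover_def M.smult_l_null\<close>)
  have smsum: "a \<odot>\<^bsub>M\<^esub> (\<Oplus>\<^bsub>M\<^esub>x\<in>A. f x) = (\<Oplus>\<^bsub>M\<^esub>x\<in>A. a \<odot>\<^bsub>M\<^esub> f x)"
    if "finite A" "f \<in> A \<rightarrow> carrier M" "a \<in> carrier R" for a A f
    using that
  proof (induction A rule: finite_induct)
    case empty
    then show ?case by (simp add: M.smult_r_null)
  next
    case (insert x A)
    then have "f \<in> A \<rightarrow> carrier M" "f x \<in> carrier M" by auto
    then show ?case using insert
      by (auto simp: M.smult_r_distr M.finsum_insert M.finsum_closed Pi_iff)
  qed
  have sub: "finite {x. c x \<noteq> \<zero>\<^bsub>R\<^esub>}" "{x. c x \<noteq> \<zero>\<^bsub>R\<^esub>} \<subseteq> carrier X" "\<And>x. c x \<in> carrier R"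
    if "c \<in> carrier (free_cover R X)" for c
  proof -
    show "c x \<in> carrier R" for x using that by (cases "x \<in> carrier X") (auto simp: free_cover_def)
  qed (use that in \<open>auto simp: free_cover_def\<close>)
  show ?thesis
    unfolding mod_hom_def
  proof (intro CollectI conjI ballI)
    show "lin_ext R M y \<in> carrier (free_cover R X) \<rightarrow> carrier M"
      using yc by (auto simp: lin_ext_def free_cover_def Pi_iff intro!: M.finsum_closed)
  next
    fix c d assume cd: "c \<in> carrier (free_cover R X)" "d \<in> carrier (free_cover R X)"
    define A where "A = {x. c x \<noteq> \<zero>\<^bsub>R\<^esub>} \<union> {x. d x \<noteq> \<zero>\<^bsub>R\<^esub>}"
    have A: "finite A" "A \<subseteq> carrier X" using sub[OF cd(1)] sub[OF cd(2)] by (auto simp: A_def)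
    have s: "{x. (c \<oplus>\<^bsub>free_cover R X\<^esub> d) x \<noteq> \<zero>\<^bsub>R\<^esub>} \<subseteq> A" by (auto simp: A_def free_cover_def)
    note cR = sub(3)[OF cd(1)] sub(3)[OF cd(2)]
    have "lin_ext R M y (c \<oplus>\<^bsub>free_cover R X\<^esub> d) = (\<Oplus>\<^bsub>M\<^esub>x\<in>A. (c \<oplus>\<^bsub>free_cover R X\<^esub> d) x \<odot>\<^bsub>M\<^esub> y x)"
      using ext[OF F.a_closed[OF cd] A(1) s A(2)] .
    also have "\<dots> = (\<Oplus>\<^bsub>M\<^esub>x\<in>A. c x \<odot>\<^bsub>M\<^esub> y x \<oplus>\<^bsub>M\<^esub> d x \<odot>\<^bsub>M\<^esub> y x)"
      by (rule M.add.finprod_cong') (use A cR yc in \<open>auto simp: free_cover_def M.smult_l_distr subset_iff\<close>)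
    also have "\<dots> = (\<Oplus>\<^bsub>M\<^esub>x\<in>A. c x \<odot>\<^bsub>M\<^esub> y x) \<oplus>\<^bsub>M\<^esub> (\<Oplus>\<^bsub>M\<^esub>x\<in>A. d x \<odot>\<^bsub>M\<^esub> y x)"
      by (rule M.finsum_addf) (use A cR yc in auto)
    also have "\<dots> = lin_ext R M y c \<oplus>\<^bsub>M\<^esub> lin_ext R M y d"
      using ext[OF cd(1) A(1) _ A(2)] ext[OF cd(2) A(1) _ A(2)] by (simp add: A_def)
    finally show "lin_ext R M y (c \<oplus>\<^bsub>free_cover R X\<^esub> d) = lin_ext R M y c \<oplus>\<^bsub>M\<^esub> lin_ext R M y d" .
  next
    fix a c assume a: "a \<in> carrier R" and c: "c \<in> carrier (free_cover R X)"
    let ?A = "{x. c x \<noteq> \<zero>\<^bsub>R\<^esub>}"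
    note A = sub[OF c]
    have s: "{x. (a \<odot>\<^bsub>free_cover R X\<^esub> c) x \<noteq> \<zero>\<^bsub>R\<^esub>} \<subseteq> ?A"
      using a by (auto simp: free_cover_def)
    have "lin_ext R M y (a \<odot>\<^bsub>free_cover R X\<^esub> c) = (\<Oplus>\<^bsub>M\<^esub>x\<in>?A. (a \<odot>\<^bsub>free_cover R X\<^esub> c) x \<odot>\<^bsub>M\<^esub> y x)"
      using ext[OF F.smult_closed[OF a c] A(1) s A(2)] .
    also have "\<dots> = (\<Oplus>\<^bsub>M\<^esub>x\<in>?A. a \<odot>\<^bsub>M\<^esub> (c x \<odot>\<^bsub>M\<^esub> y x))"
      by (rule M.add.finprod_cong') (use A yc a in \<open>auto simp: free_cover_def M.smult_assoc1 subset_iff\<close>)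
    also have "\<dots> = a \<odot>\<^bsub>M\<^esub> lin_ext R M y c"
      unfolding lin_ext_def using A yc a by (subst smsum) (auto simp: subset_iff)
    finally show "lin_ext R M y (a \<odot>\<^bsub>free_cover R X\<^esub> c) = a \<odot>\<^bsub>M\<^esub> lin_ext R M y c" .
  qed
qed

lemma basis_elt_closed:
  assumes "ring R" "x \<in> carrier X"
  shows "basis_elt R x \<in> carrier (free_cover R X)"
proof -
  interpret R: ring R by fact
  have "finite {w. (if w = x then \<one>\<^bsub>R\<^esub> else \<zero>\<^bsub>R\<^esub>) \<noteq> \<zero>\<^bsub>R\<^esub>}" by (rule finite_subset[of _ "{x}"]) auto
  then show ?thesis using assms(2) by (auto simp: basis_elt_def free_cover_def)
qed

text \<open>The zero ring needs a separate look, because there the basis element has empty support.\<close>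
lemma lin_ext_basis:
  assumes M: "left_module R M" and x: "y x \<in> carrier M"
  shows "lin_ext R M y (basis_elt R x) = y x"
proof -
  interpret M: left_module R M by fact
  show ?thesis
  proof (cases "\<one>\<^bsub>R\<^esub> = \<zero>\<^bsub>R\<^esub>")
    case True
    then have "y x = \<zero>\<^bsub>M\<^esub>" using M.smult_one[OF x] M.smult_l_null[OF x] by simp
    then show ?thesis using True by (simp add: lin_ext_def basis_elt_def)
  next
    case False
    then have "{w. basis_elt R x w \<noteq> \<zero>\<^bsub>R\<^esub>} = {x}" by (auto simp: basis_elt_def)
    then show ?thesis using x by (simp add: lin_ext_def basis_elt_def)
  qed
qed

lemma free_cover_map_basis:
  assumes "left_module R X" "x \<in> carrier X"
  shows "free_cover_map R X (basis_elt R x) = x"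
  using lin_ext_basis[OF assms(1), of "\<lambda>x. x" x] assms(2) by (simp add: lin_ext_def free_cover_map_def)

text \<open>Induction on a finite set containing the support, splitting off one coordinate.\<close>
lemma hom_eq_on_basis:
  assumes M: "left_module R M" and f: "f \<in> mod_hom R (free_cover R X) M" and g: "g \<in> mod_hom R (free_cover R X) M"
    and eq: "\<And>x. x \<in> carrier X \<Longrightarrow> f (basis_elt R x) = g (basis_elt R x)"
    and c: "c \<in> carrier (free_cover R X)"
  shows "f c = g c"
proof -
  interpret M: left_module R M by fact
  interpret F: left_module R "free_cover R X" by (rule left_module_free_cover) (rule M.R.ring_axioms)
  note f' = mod_homD[OF f] and g' = mod_homD[OF g]
  have "f c = g c" if "c \<in> carrier (free_cover R X)" "{x. c x \<noteq> \<zero>\<^bsub>R\<^esub>} \<subseteq> A" "finite A" for A c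
    using that(3,1,2)
  proof (induction A arbitrary: c rule: finite_induct)
    case empty
    then have "c = \<zero>\<^bsub>free_cover R X\<^esub>" by (auto simp: free_cover_def)
    then show ?case
      using mod_hom_minus(1)[OF f F.left_module_axioms M] mod_hom_minus(1)[OF g F.left_module_axioms M] by simp
  next
    case (insert x A)
    show ?case
    proof (cases "x \<in> carrier X")
      case False
      then have "c x = \<zero>\<^bsub>R\<^esub>" using insert.prems(1) by (simp add: free_cover_def)
      then show ?thesis using insert.IH[of c] insert.prems by auto
    next
      case True
      let ?d = "c(x := \<zero>\<^bsub>R\<^esub>)" and ?b = "basis_elt R x"
      have cx: "c x \<in> carrier R" using insert.prems(1) True by (simp add: free_cover_def)
      have "finite {w. (c(x := \<zero>\<^bsub>R\<^esub>)) w \<noteq> \<zero>\<^bsub>R\<^esub>}"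
        by (rule finite_subset[of _ "{w. c w \<noteq> \<zero>\<^bsub>R\<^esub>}"]) (use insert.prems(1) in \<open>auto simp: free_cover_def\<close>)
      then have d: "?d \<in> carrier (free_cover R X)"
        using insert.prems(1) by (auto simp: free_cover_def)
      have b: "?b \<in> carrier (free_cover R X)" by (rule basis_elt_closed[OF M.R.ring_axioms True])
      have cb: "c x \<odot>\<^bsub>free_cover R X\<^esub> ?b \<in> carrier (free_cover R X)" using cx b by simp
      have split: "c = ?d \<oplus>\<^bsub>free_cover R X\<^esub> (c x \<odot>\<^bsub>free_cover R X\<^esub> ?b)"
        using insert.prems(1) cx by (auto simp: free_cover_def basis_elt_def fun_eq_iff)
      have fgd: "f ?d = g ?d" by (rule insert.IH[OF d]) (use insert.prems(2) in auto)
      have "f (?d \<oplus>\<^bsub>free_cover R X\<^esub> (c x \<odot>\<^bsub>free_cover R X\<^esub> ?b)) = g (?d \<oplus>\<^bsub>free_cover R X\<^esub> (c x \<odot>\<^bsub>free_cover R X\<^esub> ?b))"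
        using f'(2)[OF d cb] g'(2)[OF d cb] f'(3)[OF cx b] g'(3)[OF cx b] fgd eq[OF True] by simp
      then show ?thesis using split by simp
    qed
  qed
  from this[OF c subset_refl] c show ?thesis by (simp add: free_cover_def)
qed

lemma free_cover_projective:
  assumes N: "left_module R N" and W: "left_module R W"
    and q: "q \<in> mod_hom R N W" "q ` carrier N = carrier W" and f: "f \<in> mod_hom R (free_cover R X) W"
  obtains z where "z \<in> mod_hom R (free_cover R X) N" "\<And>c. c \<in> carrier (free_cover R X) \<Longrightarrow> q (z c) = f c"
proof -
  interpret N: left_module R N by fact
  define y where "y x = (SOME n. n \<in> carrier N \<and> q n = f (basis_elt R x))" for x
  have y: "y x \<in> carrier N \<and> q (y x) = f (basis_elt R x)" if x: "x \<in> carrier X" for x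
  proof -
    have "f (basis_elt R x) \<in> q ` carrier N"
      unfolding q(2) by (rule mod_homD(1)[OF f basis_elt_closed[OF N.R.ring_axioms x]])
    then have "\<exists>n. n \<in> carrier N \<and> q n = f (basis_elt R x)" by (auto simp: image_iff)
    from someI_ex[OF this] show ?thesis by (simp add: y_def)
  qed
  have z: "lin_ext R N y \<in> mod_hom R (free_cover R X) N"
    by (rule lin_ext_hom[OF N]) (use y in auto)
  have "q (lin_ext R N y c) = f c" if c: "c \<in> carrier (free_cover R X)" for c
  proof (rule hom_eq_on_basis[OF W mod_hom_comp[OF z q(1)] f _ c])
    fix x assume "x \<in> carrier X"
    then show "q (lin_ext R N y (basis_elt R x)) = f (basis_elt R x)"
      using y[of x] lin_ext_basis[OF N, of y x] by simp
  qed
  with z show ?thesis using that by blast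
qed

lemma syzygy_simps:
  "c \<in> carrier (syzygy R X) \<longleftrightarrow> c \<in> carrier (free_cover R X) \<and> free_cover_map R X c = \<zero>\<^bsub>X\<^esub>"
  "add (syzygy R X) = add (free_cover R X)" "smult (syzygy R X) = smult (free_cover R X)"
  by (auto simp: syzygy_def a_kernel_iff)

text \<open>\<open>Ext\<^sup>1\<close> is a quotient by the homomorphisms that extend to the free cover, so if it is trivial the coset
of \<open>f\<close> is the coset of zero.\<close>
lemma Ext1_trivial_extend:
  assumes X: "left_module R X" and Y: "left_module R Y" and triv: "trivial_group (Ext1 R X Y)"
    and f: "f \<in> mod_hom R (syzygy R X) Y"
  obtains g where "g \<in> mod_hom R (free_cover R X) Y" "\<And>c. c \<in> carrier (syzygy R X) \<Longrightarrow> g c = f c"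
proof -
  interpret Y: left_module R Y by fact
  note F = left_module_free_cover[OF Y.R.ring_axioms, of X]
  note K = left_module_syzygy[OF X]
  interpret G: comm_group "hom_group R (syzygy R X) Y" by (rule hom_group_comm_group[OF K(1) Y])
  interpret GF: comm_group "hom_group R (free_cover R X) Y" by (rule hom_group_comm_group[OF F Y])
  let ?H = "(\<lambda>f. restrict f (carrier (syzygy R X))) ` carrier (hom_group R (free_cover R X) Y)"
  let ?f = "restrict f (carrier (syzygy R X))"
  interpret K: left_module R "syzygy R X" by (rule K)
  have fc: "?f \<in> carrier (hom_group R (syzygy R X) Y)"
    using f by (auto simp: hom_group_def mod_hom_def)
  have "?H #>\<^bsub>hom_group R (syzygy R X) Y\<^esub> ?f \<in> carrier (Ext1 R X Y)"
    using fc unfolding Ext1_def FactGroup_def RCOSETS_def by auto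
  moreover have "carrier (Ext1 R X Y) = {?H}"
    using triv unfolding trivial_group_def Ext1_def FactGroup_def by simp
  ultimately have coset: "?H #>\<^bsub>hom_group R (syzygy R X) Y\<^esub> ?f = ?H" by blast
  have "restrict \<one>\<^bsub>hom_group R (free_cover R X) Y\<^esub> (carrier (syzygy R X)) = \<one>\<^bsub>hom_group R (syzygy R X) Y\<^esub>"
    using K(2) by (auto simp: hom_group_def fun_eq_iff)
  then have "\<one>\<^bsub>hom_group R (syzygy R X) Y\<^esub> \<in> ?H" using GF.one_closed by (metis imageI)
  then have "\<one>\<^bsub>hom_group R (syzygy R X) Y\<^esub> \<otimes>\<^bsub>hom_group R (syzygy R X) Y\<^esub> ?f \<in> ?H #>\<^bsub>hom_group R (syzygy R X) Y\<^esub> ?f"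
    unfolding r_coset_def by blast
  then have "?f \<in> ?H" unfolding coset using fc by simp
  then obtain g where g: "g \<in> carrier (hom_group R (free_cover R X) Y)" "?f = restrict g (carrier (syzygy R X))"
    by blast
  have "g c = f c" if "c \<in> carrier (syzygy R X)" for c
    using fun_cong[OF g(2), of c] that by simp
  moreover have "g \<in> mod_hom R (free_cover R X) Y" using g(1) by (simp add: hom_group_def)
  ultimately show ?thesis using that by blast
qed

section \<open>The ladder of pushouts\<close>

lemma (in left_module) quotient_facts:
  assumes N: "submodule N R M"
  shows "carrier (quotient_module M N) = (\<lambda>x. N +>\<^bsub>M\<^esub> x) ` carrier M"
    and "\<And>x y. x \<in> carrier M \<Longrightarrow> y \<in> carrier M \<Longrightarrow> N +>\<^bsub>M\<^esub> x = N +>\<^bsub>M\<^esub> y \<longleftrightarrow> x \<ominus>\<^bsub>M\<^esub> y \<in> N"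
    and "\<And>x. x \<in> carrier M \<Longrightarrow> N +>\<^bsub>M\<^esub> x = \<zero>\<^bsub>quotient_module M N\<^esub> \<longleftrightarrow> x \<in> N"
proof -
  interpret N: submodule N R M by fact
  interpret N: abelian_subgroup N M
    by (rule abelian_subgroupI2[OF M.a_comm_group N.subgroup_axioms])
  show "carrier (quotient_module M N) = (\<lambda>x. N +>\<^bsub>M\<^esub> x) ` carrier M"
    by (auto simp: quotient_module_def A_RCOSETS_def')
  show eq: "N +>\<^bsub>M\<^esub> x = N +>\<^bsub>M\<^esub> y \<longleftrightarrow> x \<ominus>\<^bsub>M\<^esub> y \<in> N" if x: "x \<in> carrier M" and y: "y \<in> carrier M" for x y
  proof
    assume "N +>\<^bsub>M\<^esub> x = N +>\<^bsub>M\<^esub> y"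
    then have "x \<in> N +>\<^bsub>M\<^esub> y" using N.a_rcos_self[OF x] by simp
    then obtain n where "n \<in> N" "x = n \<oplus>\<^bsub>M\<^esub> y" by (auto simp: a_r_coset_def')
    moreover have "n \<in> carrier M" using \<open>n \<in> N\<close> N.a_subset by blast
    ultimately show "x \<ominus>\<^bsub>M\<^esub> y \<in> N" using y by (simp add: a_minus_def M.a_assoc M.r_neg)
  next
    assume n: "x \<ominus>\<^bsub>M\<^esub> y \<in> N"
    have "x = (x \<ominus>\<^bsub>M\<^esub> y) \<oplus>\<^bsub>M\<^esub> y" using x y by (simp add: a_minus_def M.a_assoc M.l_neg)
    then have "x \<in> N +>\<^bsub>M\<^esub> y" using n by (auto simp: a_r_coset_def')
    then show "N +>\<^bsub>M\<^esub> x = N +>\<^bsub>M\<^esub> y" using N.a_repr_independence'[of x y] y by simp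
  qed
  have zero: "\<zero>\<^bsub>quotient_module M N\<^esub> = N +>\<^bsub>M\<^esub> \<zero>\<^bsub>M\<^esub>"
    using M.a_coset_add_zero[OF N.a_subset] by (simp add: quotient_module_def)
  show "N +>\<^bsub>M\<^esub> x = \<zero>\<^bsub>quotient_module M N\<^esub> \<longleftrightarrow> x \<in> N" if x: "x \<in> carrier M" for x
    unfolding zero using eq[OF x M.zero_closed] x by (simp add: a_minus_def)
qed

lemma (in left_module) quotient_lift:
  assumes N: "submodule N R M" and Z: "left_module R Z" and f: "f \<in> mod_hom R M Z"
    and zero: "\<And>x. x \<in> N \<Longrightarrow> f x = \<zero>\<^bsub>Z\<^esub>"
  shows "\<exists>f' \<in> mod_hom R (quotient_module M N) Z. \<forall>x\<in>carrier M. f' (N +>\<^bsub>M\<^esub> x) = f x"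
proof -
  interpret Z: left_module R Z by fact
  note Q = left_module_quotient[OF N] and q = quotient_facts[OF N]
  note pr = mod_homD[OF Q(2)] and f1 = mod_homD[OF f]
  define f' where "f' C = f (SOME x. x \<in> carrier M \<and> N +>\<^bsub>M\<^esub> x = C)" for C
  have val: "f' (N +>\<^bsub>M\<^esub> x) = f x" if x: "x \<in> carrier M" for x
  proof -
    let ?y = "SOME y. y \<in> carrier M \<and> N +>\<^bsub>M\<^esub> y = N +>\<^bsub>M\<^esub> x"
    have y: "?y \<in> carrier M \<and> N +>\<^bsub>M\<^esub> ?y = N +>\<^bsub>M\<^esub> x"
      by (rule someI_ex) (use x in blast)
    then have "?y \<ominus>\<^bsub>M\<^esub> x \<in> N" using q(2) x by blast
    then have "f (?y \<ominus>\<^bsub>M\<^esub> x) = \<zero>\<^bsub>Z\<^esub>" by (rule zero)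
    then have "f ?y \<ominus>\<^bsub>Z\<^esub> f x = \<zero>\<^bsub>Z\<^esub>"
      using mod_hom_minus(3)[OF f left_module_axioms Z] y x by simp
    then have "f ?y = f x" using f1(1) x y by (simp add: Z.M.diff_eq_zero_iff)
    then show ?thesis by (simp add: f'_def)
  qed
  have "f' \<in> mod_hom R (quotient_module M N) Z"
    using f1 by (auto simp: mod_hom_def q(1) val pr(2,3)[symmetric])
  with val show ?thesis by blast
qed

locale ladder =
  fixes R :: "('a, 'r) ring_scheme" and U :: "('a, 'u, 'm1) module_scheme" and V :: "('a, 'v, 'm2) module_scheme"
    and W :: "('a, 'w, 'm3) module_scheme" and f h :: "'u \<Rightarrow> 'v" and g :: "'v \<Rightarrow> 'w"
  assumes U: "left_module R U" and V: "left_module R V" and W: "left_module R W"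
    and ex: "short_exact R U V W f g" and h: "h \<in> mod_mono R U V"
begin

sublocale U: left_module R U by (rule U)
sublocale V: left_module R V by (rule V)
sublocale W: left_module R W by (rule W)

lemma f_hom: "f \<in> mod_hom R U V" and f_inj: "inj_on f (carrier U)" and g_hom: "g \<in> mod_hom R V W"
  and g_surj: "g ` carrier V = carrier W"
  and g_zero_iff: "\<And>x. x \<in> carrier V \<Longrightarrow> g x = \<zero>\<^bsub>W\<^esub> \<longleftrightarrow> x \<in> f ` carrier U"
  and h_hom: "h \<in> mod_hom R U V" and h_inj: "inj_on h (carrier U)"
  using ex h by (auto simp: short_exact_def mod_mono_def a_kernel_iff)

lemmas fD = mod_homD[OF f_hom] mod_hom_minus[OF f_hom U V]
lemmas gD = mod_homD[OF g_hom] mod_hom_minus[OF g_hom V W]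
lemmas hD = mod_homD[OF h_hom] mod_hom_minus[OF h_hom U V]

lemma f_zero: "u \<in> carrier U \<Longrightarrow> f u = \<zero>\<^bsub>V\<^esub> \<Longrightarrow> u = \<zero>\<^bsub>U\<^esub>"
  using inj_onD[OF f_inj, of u "\<zero>\<^bsub>U\<^esub>"] fD(4) by simp

lemma h_zero: "u \<in> carrier U \<Longrightarrow> h u = \<zero>\<^bsub>V\<^esub> \<Longrightarrow> u = \<zero>\<^bsub>U\<^esub>"
  using inj_onD[OF h_inj, of u "\<zero>\<^bsub>U\<^esub>"] hD(4) by simp

abbreviation Vs :: "('a, nat \<Rightarrow> 'v) module" where "Vs \<equiv> finsupp UNIV V"
abbreviation Us :: "('a, nat \<Rightarrow> 'u) module" where "Us \<equiv> finsupp UNIV U"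

sublocale Vs: left_module R Vs by (rule left_module_finsupp[OF V])
sublocale Us: left_module R Us by (rule left_module_finsupp[OF U])

text \<open>Viewing
families as polynomials with shift variable \<open>s\<close>, the ladder is the cokernel of \<open>h - s f\<close> from
\<open>U[s]\<close> to \<open>V[s]\<close>.\<close>
definition relator :: "(nat \<Rightarrow> 'u) \<Rightarrow> nat \<Rightarrow> 'v" where
  "relator u i = h (u i) \<ominus>\<^bsub>V\<^esub> (case i of 0 \<Rightarrow> \<zero>\<^bsub>V\<^esub> | Suc j \<Rightarrow> f (u j))"

lemma Vs_simps:
  "x \<in> carrier Vs \<longleftrightarrow> (\<forall>i. x i \<in> carrier V) \<and> finite {i. x i \<noteq> \<zero>\<^bsub>V\<^esub>}"
  "\<zero>\<^bsub>Vs\<^esub> = (\<lambda>i. \<zero>\<^bsub>V\<^esub>)" "x \<oplus>\<^bsub>Vs\<^esub> y = (\<lambda>i. x i \<oplus>\<^bsub>V\<^esub> y i)" "a \<odot>\<^bsub>Vs\<^esub> x = (\<lambda>i. a \<odot>\<^bsub>V\<^esub> x i)"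
  by (auto simp: finsupp_def)

lemma Us_simps:
  "u \<in> carrier Us \<longleftrightarrow> (\<forall>i. u i \<in> carrier U) \<and> finite {i. u i \<noteq> \<zero>\<^bsub>U\<^esub>}"
  "\<zero>\<^bsub>Us\<^esub> = (\<lambda>i. \<zero>\<^bsub>U\<^esub>)" "u \<oplus>\<^bsub>Us\<^esub> v = (\<lambda>i. u i \<oplus>\<^bsub>U\<^esub> v i)" "a \<odot>\<^bsub>Us\<^esub> u = (\<lambda>i. a \<odot>\<^bsub>U\<^esub> u i)"
  by (auto simp: finsupp_def)

lemma relator_hom: "relator \<in> mod_hom R Us Vs"
proof -
  have closed: "relator u \<in> carrier Vs" if u: "u \<in> carrier Us" for u
  proof -
    have fin: "finite {i. u i \<noteq> \<zero>\<^bsub>U\<^esub>}" and c: "\<And>i. u i \<in> carrier U" using u by (auto simp: Us_simps)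
    have "finite {i. relator u i \<noteq> \<zero>\<^bsub>V\<^esub>}"
    proof (rule finite_subset)
      show "finite ({i. u i \<noteq> \<zero>\<^bsub>U\<^esub>} \<union> Suc ` {i. u i \<noteq> \<zero>\<^bsub>U\<^esub>})" using fin by simp
      show "{i. relator u i \<noteq> \<zero>\<^bsub>V\<^esub>} \<subseteq> {i. u i \<noteq> \<zero>\<^bsub>U\<^esub>} \<union> Suc ` {i. u i \<noteq> \<zero>\<^bsub>U\<^esub>}"
      proof
        fix i assume "i \<in> {i. relator u i \<noteq> \<zero>\<^bsub>V\<^esub>}"
        then show "i \<in> {i. u i \<noteq> \<zero>\<^bsub>U\<^esub>} \<union> Suc ` {i. u i \<noteq> \<zero>\<^bsub>U\<^esub>}"
          by (cases i) (auto simp: relator_def fD hD)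
      qed
    qed
    then show ?thesis using c by (auto simp: Vs_simps relator_def hD fD split: nat.splits)
  qed
  show ?thesis
    using closed
    by (auto simp: mod_hom_def Vs_simps(3,4) Us_simps fun_eq_iff relator_def fD hD a_minus_def V.M.minus_add
        V.M.a_ac V.smult_r_distr V.smult_r_minus V.smult_r_null split: nat.splits)
qed

definition Rel :: "(nat \<Rightarrow> 'v) set" where "Rel = relator ` carrier Us"

lemma Rel: "submodule Rel R Vs"
  unfolding Vs.submodule_iff Rel_def
  by (rule scalar_subspaces_image[OF relator_hom Us.left_module_axioms Vs.left_module_axioms subset_refl
      Us.carrier_scalar_subspace[OF subset_refl]])

definition single :: "nat \<Rightarrow> 'v \<Rightarrow> nat \<Rightarrow> 'v" where
  "single n x = (\<lambda>i. if i = n then x else \<zero>\<^bsub>V\<^esub>)"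

lemma single_hom: "single n \<in> mod_hom R V Vs"
proof -
  have "finite {i. single n x i \<noteq> \<zero>\<^bsub>V\<^esub>}" for x
    by (rule finite_subset[of _ "{n}"]) (auto simp: single_def)
  then show ?thesis
    by (auto simp: mod_hom_def Vs_simps single_def fun_eq_iff V.smult_r_null)
qed

definition shift :: "(nat \<Rightarrow> 'v) \<Rightarrow> nat \<Rightarrow> 'v" where
  "shift x i = (case i of 0 \<Rightarrow> \<zero>\<^bsub>V\<^esub> | Suc j \<Rightarrow> x j)"

lemma shift_hom: "shift \<in> mod_hom R Vs Vs"
proof -
  have "finite {i. shift x i \<noteq> \<zero>\<^bsub>V\<^esub>}" if x: "finite {i. x i \<noteq> \<zero>\<^bsub>V\<^esub>}" for x
  proof (rule finite_subset)
    show "finite (Suc ` {i. x i \<noteq> \<zero>\<^bsub>V\<^esub>})" using x by simp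
    show "{i. shift x i \<noteq> \<zero>\<^bsub>V\<^esub>} \<subseteq> Suc ` {i. x i \<noteq> \<zero>\<^bsub>V\<^esub>}"
    proof
      fix i assume "i \<in> {i. shift x i \<noteq> \<zero>\<^bsub>V\<^esub>}"
      then show "i \<in> Suc ` {i. x i \<noteq> \<zero>\<^bsub>V\<^esub>}" by (cases i) (auto simp: shift_def)
    qed
  qed
  then show ?thesis
    by (auto simp: mod_hom_def Vs_simps shift_def fun_eq_iff V.smult_r_null split: nat.splits)
qed

text \<open>In a relation with vanishing coordinate \<open>0\<close> the first term satisfies \<open>h (u 0) = 0\<close>; as \<open>h\<close> is injective the
relation is itself a shift. This is what makes the shift injective on the quotient.\<close>
lemma shift_in_Rel_iff:
  assumes x: "x \<in> carrier Vs"
  shows "shift x \<in> Rel \<longleftrightarrow> x \<in> Rel"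
proof
  assume "shift x \<in> Rel"
  then obtain u where u: "u \<in> carrier Us" "shift x = relator u" by (auto simp: Rel_def)
  have c: "\<And>i. u i \<in> carrier U" and fin: "finite {i. u i \<noteq> \<zero>\<^bsub>U\<^esub>}" using u(1) by (auto simp: Us_simps)
  have "h (u 0) = \<zero>\<^bsub>V\<^esub>"
    using fun_cong[OF u(2), of 0] hD(1)[OF c] by (simp add: shift_def relator_def a_minus_def)
  then have u0: "u 0 = \<zero>\<^bsub>U\<^esub>" using h_zero c by blast
  let ?u = "\<lambda>i. u (Suc i)"
  have "finite {i. ?u i \<noteq> \<zero>\<^bsub>U\<^esub>}"
    using finite_vimageI[OF fin, of Suc] by (simp add: vimage_def)
  then have u': "?u \<in> carrier Us" using c by (simp add: Us_simps)
  have "x i = relator ?u i" for i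
    using fun_cong[OF u(2), of "Suc i"] u0
    by (cases i) (simp_all add: shift_def relator_def fD)
  then have "x = relator ?u" by auto
  then show "x \<in> Rel" using u' by (auto simp: Rel_def)
next
  assume "x \<in> Rel"
  then obtain u where u: "u \<in> carrier Us" "x = relator u" by (auto simp: Rel_def)
  have c: "\<And>i. u i \<in> carrier U" and fin: "finite {i. u i \<noteq> \<zero>\<^bsub>U\<^esub>}" using u(1) by (auto simp: Us_simps)
  let ?u = "\<lambda>i. case i of 0 \<Rightarrow> \<zero>\<^bsub>U\<^esub> | Suc j \<Rightarrow> u j"
  have "finite {i. ?u i \<noteq> \<zero>\<^bsub>U\<^esub>}"
  proof (rule finite_subset)
    show "finite (Suc ` {i. u i \<noteq> \<zero>\<^bsub>U\<^esub>})" using fin by simp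
    show "{i. ?u i \<noteq> \<zero>\<^bsub>U\<^esub>} \<subseteq> Suc ` {i. u i \<noteq> \<zero>\<^bsub>U\<^esub>}"
    proof
      fix i assume "i \<in> {i. ?u i \<noteq> \<zero>\<^bsub>U\<^esub>}"
      then show "i \<in> Suc ` {i. u i \<noteq> \<zero>\<^bsub>U\<^esub>}" by (cases i) auto
    qed
  qed
  then have u': "?u \<in> carrier Us" using c by (auto simp: Us_simps split: nat.splits)
  have "shift x i = relator ?u i" for i
    using u(2) by (auto simp: shift_def relator_def fD hD a_minus_def split: nat.splits)
  then have "shift x = relator ?u" by auto
  then show "shift x \<in> Rel" using u' by (auto simp: Rel_def)
qed

text \<open>The union of all the modules \<open>U\<^sub>n\<close>.\<close>
definition tower :: "('a, (nat \<Rightarrow> 'v) set) module" where "tower = quotient_module Vs Rel"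

definition \<iota> :: "nat \<Rightarrow> 'v \<Rightarrow> (nat \<Rightarrow> 'v) set" where "\<iota> n x = Rel +>\<^bsub>Vs\<^esub> single n x"

lemma left_module_tower: "left_module R tower"
  unfolding tower_def by (rule Vs.left_module_quotient[OF Rel])

sublocale T: left_module R tower by (rule left_module_tower)

lemma proj_hom: "(\<lambda>x. Rel +>\<^bsub>Vs\<^esub> x) \<in> mod_hom R Vs tower"
  unfolding tower_def by (rule Vs.left_module_quotient[OF Rel])

lemma \<iota>_hom: "\<iota> n \<in> mod_hom R V tower"
  using mod_hom_comp[OF single_hom proj_hom, of n] by (simp add: \<iota>_def[abs_def])

lemmas \<iota>D = mod_homD[OF \<iota>_hom] mod_hom_minus[OF \<iota>_hom V left_module_tower]

lemma \<iota>_glue: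
  assumes u: "u \<in> carrier U"
  shows "\<iota> (Suc n) (f u) = \<iota> n (h u)"
proof -
  let ?u = "\<lambda>i. if i = n then u else \<zero>\<^bsub>U\<^esub>"
  have "finite {i. ?u i \<noteq> \<zero>\<^bsub>U\<^esub>}" by (rule finite_subset[of _ "{n}"]) auto
  then have u': "?u \<in> carrier Us" using u by (auto simp: Us_simps)
  have sc: "single (Suc n) (f u) \<in> carrier Vs" "single n (h u) \<in> carrier Vs"
    using mod_homD(1)[OF single_hom] u by (auto simp: fD hD)
  have "single n (h u) = relator ?u \<oplus>\<^bsub>Vs\<^esub> single (Suc n) (f u)"
    using u by (auto simp: Vs_simps single_def relator_def fun_eq_iff fD hD a_minus_def V.M.l_neg split: nat.splits)
  moreover have "relator ?u \<in> carrier Vs" by (rule mod_homD(1)[OF relator_hom u'])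
  ultimately have "single n (h u) \<ominus>\<^bsub>Vs\<^esub> single (Suc n) (f u) = relator ?u"
    using sc by (simp add: a_minus_def Vs.M.a_assoc Vs.M.r_neg)
  then have "single n (h u) \<ominus>\<^bsub>Vs\<^esub> single (Suc n) (f u) \<in> Rel" using u' by (auto simp: Rel_def)
  then show ?thesis using Vs.quotient_facts(2)[OF Rel sc(2,1)] by (simp add: \<iota>_def)
qed

text \<open>\<open>rung n\<close> is the copy of \<open>U\<^sub>n\<close> inside the tower.\<close>
fun rung :: "nat \<Rightarrow> (nat \<Rightarrow> 'v) set set" where
  "rung 0 = \<iota> 0 ` f ` carrier U"
| "rung (Suc n) = rung n <+>\<^bsub>tower\<^esub> \<iota> n ` carrier V"

lemma \<iota>_image: "\<iota> n ` carrier V \<in> scalar_subspaces (carrier R) tower (carrier tower)"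
  by (rule scalar_subspaces_image[OF \<iota>_hom V left_module_tower subset_refl V.carrier_scalar_subspace[OF subset_refl]])

lemma f_image: "f ` carrier U \<in> scalar_subspaces (carrier R) V (carrier V)"
  by (rule scalar_subspaces_image[OF f_hom U V subset_refl U.carrier_scalar_subspace[OF subset_refl]])

lemma h_image: "h ` carrier U \<in> scalar_subspaces (carrier R) V (carrier V)"
  by (rule scalar_subspaces_image[OF h_hom U V subset_refl U.carrier_scalar_subspace[OF subset_refl]])

lemma rung: "rung n \<in> scalar_subspaces (carrier R) tower (carrier tower)"
proof (induction n)
  case 0
  show ?case
    using scalar_subspaces_image[OF \<iota>_hom V left_module_tower subset_refl f_image] by simp
next
  case (Suc n)
  then show ?case by (simp add: T.add_scalar_subspace[OF _ \<iota>_image subset_refl])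
qed

lemma rung_Suc: "rung n \<subseteq> rung (Suc n)" "\<iota> n ` carrier V \<subseteq> rung (Suc n)"
  using T.subset_set_add[OF rung \<iota>_image] by simp_all

lemma rung_mono: "m \<le> n \<Longrightarrow> rung m \<subseteq> rung n"
  by (rule lift_Suc_mono_le[of rung]) (use rung_Suc in auto)

text \<open>The condition at \<open>n\<close> treats \<open>n = 0\<close> and \<open>n > 0\<close> uniformly: by the gluing relation an element \<open>f u\<close> in copy
\<open>n\<close> lies in the previous rung already.\<close>
lemma rung_rep:
  "z \<in> rung n \<Longrightarrow> \<exists>x\<in>carrier Vs. z = Rel +>\<^bsub>Vs\<^esub> x \<and> x n \<in> f ` carrier U \<and> (\<forall>i>n. x i = \<zero>\<^bsub>V\<^esub>)"
proof (induction n arbitrary: z)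
  case 0
  then obtain u where u: "u \<in> carrier U" "z = \<iota> 0 (f u)" by auto
  then show ?case
    using mod_homD(1)[OF single_hom fD(1)[OF u(1)], of 0]
    by (intro bexI[of _ "single 0 (f u)"]) (auto simp: \<iota>_def single_def)
next
  case (Suc n)
  then obtain w v where w: "w \<in> rung n" and v: "v \<in> carrier V" and z: "z = w \<oplus>\<^bsub>tower\<^esub> \<iota> n v"
    by (auto simp: T.mem_set_add)
  obtain x where x: "x \<in> carrier Vs" "w = Rel +>\<^bsub>Vs\<^esub> x" "\<forall>i>n. x i = \<zero>\<^bsub>V\<^esub>"
    using Suc.IH[OF w] by blast
  have s: "single n v \<in> carrier Vs" by (rule mod_homD(1)[OF single_hom v])
  have "z = Rel +>\<^bsub>Vs\<^esub> (x \<oplus>\<^bsub>Vs\<^esub> single n v)"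
    unfolding z x(2) \<iota>_def using mod_homD(2)[OF proj_hom x(1) s] by simp
  moreover have "(x \<oplus>\<^bsub>Vs\<^esub> single n v) i = \<zero>\<^bsub>V\<^esub>" if "i > n" for i
    using x(3) that by (simp add: Vs_simps single_def)
  moreover have "\<zero>\<^bsub>V\<^esub> \<in> f ` carrier U" using scalar_subspacesD(2)[OF f_image] .
  moreover have "x \<oplus>\<^bsub>Vs\<^esub> single n v \<in> carrier Vs" using x(1) s by simp
  ultimately show ?case by (metis Suc_lessD lessI)
qed

text \<open>This identifies the quotient of consecutive rungs with \<open>V / f(U)\<close>. If \<open>v\<close> in copy \<open>n\<close> is congruent to a family
supported below, the relation used has no coordinates beyond \<open>n\<close>. Since \<open>f\<close> is injective,
its last nonzero \<open>u i\<close> would show up in coordinate \<open>i + 1\<close>, so \<open>u i = 0\<close> for \<open>i \<ge> n\<close>, and coordinate \<open>n\<close>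
of the relation is in the image of \<open>f\<close>.\<close>
lemma \<iota>_in_rung_iff:
  assumes v: "v \<in> carrier V"
  shows "\<iota> n v \<in> rung n \<longleftrightarrow> v \<in> f ` carrier U"
proof
  assume "\<iota> n v \<in> rung n"
  then obtain x where x: "x \<in> carrier Vs" "\<iota> n v = Rel +>\<^bsub>Vs\<^esub> x" "x n \<in> f ` carrier U"
    and x0: "\<And>i. i > n \<Longrightarrow> x i = \<zero>\<^bsub>V\<^esub>" using rung_rep by blast
  have s: "single n v \<in> carrier Vs" by (rule mod_homD(1)[OF single_hom v])
  have "single n v \<ominus>\<^bsub>Vs\<^esub> x \<in> Rel" using Vs.quotient_facts(2)[OF Rel s x(1)] x(2) by (simp add: \<iota>_def)
  then obtain u where u: "u \<in> carrier Us" "single n v \<ominus>\<^bsub>Vs\<^esub> x = relator u" by (auto simp: Rel_def)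
  have c: "\<And>i. u i \<in> carrier U" and fin: "finite {i. u i \<noteq> \<zero>\<^bsub>U\<^esub>}" using u(1) by (auto simp: Us_simps)
  have xc: "\<And>i. x i \<in> carrier V" using x(1) by (simp add: Vs_simps)
  have sx: "single n v = relator u \<oplus>\<^bsub>Vs\<^esub> x"
    using s x(1) unfolding u(2)[symmetric] by (simp add: a_minus_def Vs.M.a_assoc Vs.M.l_neg)
  have coord: "single n v i = relator u i \<oplus>\<^bsub>V\<^esub> x i" for i using fun_cong[OF sx, of i] by (simp add: Vs_simps)
  have relc: "relator u i \<in> carrier V" for i using mod_homD(1)[OF relator_hom u(1)] by (simp add: Vs_simps)
  have above: "relator u i = \<zero>\<^bsub>V\<^esub>" if "i > n" for i
    using coord[of i] that x0[OF that] relc[of i] by (simp add: single_def)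
  have uz: "u i = \<zero>\<^bsub>U\<^esub>" if "i \<ge> n" for i
  proof (rule ccontr)
    assume ne: "u i \<noteq> \<zero>\<^bsub>U\<^esub>"
    \<comment> \<open>The top nonzero index \<open>m\<close> contributes \<open>- f (u m)\<close> in coordinate \<open>m + 1 > n\<close>, where nothing cancels it.\<close>
    define m where "m = Max {i. u i \<noteq> \<zero>\<^bsub>U\<^esub>}"
    have m: "u m \<noteq> \<zero>\<^bsub>U\<^esub>" using Max_in[OF fin] ne by (auto simp: m_def)
    have "i \<le> m" using Max_ge[OF fin] ne by (simp add: m_def)
    moreover have "u (Suc m) = \<zero>\<^bsub>U\<^esub>" using Max_ge[OF fin, of "Suc m"] by (auto simp: m_def[symmetric])
    ultimately have "\<zero>\<^bsub>V\<^esub> \<ominus>\<^bsub>V\<^esub> f (u m) = \<zero>\<^bsub>V\<^esub>"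
      using above[of "Suc m"] that by (simp add: relator_def hD)
    then have "f (u m) = \<zero>\<^bsub>V\<^esub>" using fD(1)[OF c] by (simp add: a_minus_def V.M.minus_equality)
    then show False using f_zero[OF c] m by blast
  qed
  have v': "v = relator u n \<oplus>\<^bsub>V\<^esub> x n" using coord[of n] by (simp add: single_def)
  note fS = scalar_subspacesD[OF f_image]
  have "relator u n \<in> f ` carrier U"
  proof (cases n)
    case 0
    then show ?thesis using uz[of 0] fS(2) by (simp add: relator_def hD a_minus_def)
  next
    case (Suc m)
    have "\<zero>\<^bsub>V\<^esub> \<ominus>\<^bsub>V\<^esub> f (u m) \<in> f ` carrier U" using fS(6)[OF fS(2)] c by blast
    then show ?thesis using uz[of n] Suc by (simp add: relator_def hD)
  qed
  then show "v \<in> f ` carrier U" unfolding v' using fS(3) x(3) by blast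
next
  assume "v \<in> f ` carrier U"
  then obtain u where u: "u \<in> carrier U" "v = f u" by blast
  show "\<iota> n v \<in> rung n"
  proof (cases n)
    case 0
    then show ?thesis using u by auto
  next
    case (Suc m)
    then have "\<iota> n v = \<iota> m (h u)" using \<iota>_glue[OF u(1)] u(2) by simp
    also have "\<dots> \<in> rung n" using rung_Suc(2)[of m] hD(1)[OF u(1)] Suc by blast
    finally show ?thesis .
  qed
qed

lemma shift_exists:
  "\<exists>s \<in> mod_hom R tower tower. inj_on s (carrier tower) \<and> (\<forall>n. \<forall>x\<in>carrier V. s (\<iota> n x) = \<iota> (Suc n) x)"
proof -
  note q = Vs.quotient_facts[OF Rel, folded tower_def]
  have z: "Rel +>\<^bsub>Vs\<^esub> shift x = \<zero>\<^bsub>tower\<^esub> \<longleftrightarrow> x \<in> Rel" if "x \<in> carrier Vs" for x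
    using q(3)[OF mod_homD(1)[OF shift_hom that]] shift_in_Rel_iff[OF that] by simp
  have Rc: "Rel \<subseteq> carrier Vs" using scalar_subspacesD(1) Rel unfolding Vs.submodule_iff by blast
  have "Rel +>\<^bsub>Vs\<^esub> shift x = \<zero>\<^bsub>tower\<^esub>" if "x \<in> Rel" for x using z[OF subsetD[OF Rc that]] that by simp
  from Vs.quotient_lift[where f = "\<lambda>x. Rel +>\<^bsub>Vs\<^esub> shift x",
      OF Rel left_module_tower mod_hom_comp[OF shift_hom proj_hom] this, folded tower_def]
  obtain s where s: "s \<in> mod_hom R tower tower" "\<forall>x\<in>carrier Vs. s (Rel +>\<^bsub>Vs\<^esub> x) = Rel +>\<^bsub>Vs\<^esub> shift x" ..
  have "inj_on s (carrier tower)"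
  proof (rule inj_onI)
    fix a b assume ab: "a \<in> carrier tower" "b \<in> carrier tower" "s a = s b"
    then have "s (a \<ominus>\<^bsub>tower\<^esub> b) = \<zero>\<^bsub>tower\<^esub>"
      using mod_hom_minus(3)[OF s(1) left_module_tower left_module_tower ab(1,2)] mod_homD(1)[OF s(1)]
      by (simp add: a_minus_def T.M.r_neg)
    moreover have "a \<ominus>\<^bsub>tower\<^esub> b \<in> carrier tower" using ab by simp
    then obtain x where x: "x \<in> carrier Vs" "a \<ominus>\<^bsub>tower\<^esub> b = Rel +>\<^bsub>Vs\<^esub> x" unfolding q(1) by blast
    ultimately have "x \<in> Rel" using s(2) z by simp
    then have "a \<ominus>\<^bsub>tower\<^esub> b = \<zero>\<^bsub>tower\<^esub>" using q(3)[OF x(1)] x(2) by simp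
    then show "a = b" using ab by (simp add: T.M.diff_eq_zero_iff)
  qed
  moreover have "s (\<iota> n x) = \<iota> (Suc n) x" if x: "x \<in> carrier V" for n x
  proof -
    have "shift (single n x) = single (Suc n) x"
      by (auto simp: shift_def single_def fun_eq_iff split: nat.splits)
    then show ?thesis using s(2)[THEN bspec, OF mod_homD(1)[OF single_hom x]] by (simp add: \<iota>_def)
  qed
  ultimately show ?thesis using s(1) by blast
qed

text \<open>The second family of maps of the ladder, induced by the shift of copies.\<close>
definition \<sigma> :: "(nat \<Rightarrow> 'v) set \<Rightarrow> (nat \<Rightarrow> 'v) set" where
  "\<sigma> = (SOME s. s \<in> mod_hom R tower tower \<and> inj_on s (carrier tower) \<and> (\<forall>n. \<forall>x\<in>carrier V. s (\<iota> n x) = \<iota> (Suc n) x))"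

lemma \<sigma>_hom: "\<sigma> \<in> mod_hom R tower tower" and \<sigma>_inj: "inj_on \<sigma> (carrier tower)"
  and \<sigma>_\<iota>: "\<And>n x. x \<in> carrier V \<Longrightarrow> \<sigma> (\<iota> n x) = \<iota> (Suc n) x"
proof -
  have "\<exists>s. s \<in> mod_hom R tower tower \<and> inj_on s (carrier tower) \<and> (\<forall>n. \<forall>x\<in>carrier V. s (\<iota> n x) = \<iota> (Suc n) x)"
    using shift_exists by blast
  from someI_ex[OF this, folded \<sigma>_def]
  show "\<sigma> \<in> mod_hom R tower tower" "inj_on \<sigma> (carrier tower)" "\<And>n x. x \<in> carrier V \<Longrightarrow> \<sigma> (\<iota> n x) = \<iota> (Suc n) x"
    by blast+
qed

abbreviation Y :: "('a, 'v set) module" where "Y \<equiv> cokernel_module U V h"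

lemma h_submodule: "submodule (h ` carrier U) R V"
  unfolding V.submodule_iff by (rule h_image)

lemma left_module_Y: "left_module R Y"
  unfolding cokernel_module_def by (rule V.left_module_quotient[OF h_submodule])

lemma \<rho>_exists:
  "\<exists>r \<in> mod_hom R tower Y. \<forall>x\<in>carrier V. r (\<iota> 0 x) = h ` carrier U +>\<^bsub>V\<^esub> x \<and> (\<forall>n. r (\<iota> (Suc n) x) = \<zero>\<^bsub>Y\<^esub>)"
proof -
  interpret Y: left_module R Y by (rule left_module_Y)
  note qY = V.quotient_facts[OF h_submodule, folded cokernel_module_def]
  have hom: "(\<lambda>x. h ` carrier U +>\<^bsub>V\<^esub> x 0) \<in> mod_hom R Vs Y"
    unfolding cokernel_module_def
    by (rule mod_hom_comp[OF finsupp_eval_hom[OF V] V.left_module_quotient(2)[OF h_submodule]])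
  have zero: "h ` carrier U +>\<^bsub>V\<^esub> x 0 = \<zero>\<^bsub>Y\<^esub>" if x: "x \<in> Rel" for x
  proof -
    obtain u where u: "u \<in> carrier Us" "x = relator u" using x by (auto simp: Rel_def)
    then have "x 0 = h (u 0)" "u 0 \<in> carrier U" by (auto simp: Us_simps relator_def hD a_minus_def)
    then show ?thesis using qY(3)[of "x 0"] hD(1) by auto
  qed
  have "\<exists>r \<in> mod_hom R tower Y. \<forall>x\<in>carrier Vs. r (Rel +>\<^bsub>Vs\<^esub> x) = h ` carrier U +>\<^bsub>V\<^esub> x 0"
    unfolding tower_def by (rule Vs.quotient_lift[OF Rel left_module_Y hom]) (rule zero)
  then obtain r where r: "r \<in> mod_hom R tower Y"
    "\<forall>x\<in>carrier Vs. r (Rel +>\<^bsub>Vs\<^esub> x) = h ` carrier U +>\<^bsub>V\<^esub> x 0" ..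
  have "r (\<iota> n x) = h ` carrier U +>\<^bsub>V\<^esub> single n x 0" if x: "x \<in> carrier V" for n x
    using r(2)[THEN bspec, OF mod_homD(1)[OF single_hom x]] by (simp add: \<iota>_def)
  moreover have "h ` carrier U +>\<^bsub>V\<^esub> \<zero>\<^bsub>V\<^esub> = \<zero>\<^bsub>Y\<^esub>"
    using qY(3)[of "\<zero>\<^bsub>V\<^esub>"] scalar_subspacesD(2)[OF h_image] by simp
  ultimately show ?thesis using r(1) by (intro bexI[of _ r]) (auto simp: single_def)
qed

text \<open>The defining recursion adds the last copy of \<open>V\<close> to the previous rung; read from the other end, the same
rung arises by adding the first copy to the shifted previous rung. Together with \<open>\<rho>\<close> this computes
the cokernel of the shift.\<close>
lemma rung_Suc_shift: "rung (Suc n) = \<iota> 0 ` carrier V <+>\<^bsub>tower\<^esub> \<sigma> ` rung n"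
proof (induction n)
  case 0
  have "\<sigma> ` rung 0 \<subseteq> \<iota> 0 ` carrier V"
  proof
    fix z assume "z \<in> \<sigma> ` rung 0"
    then obtain u where u: "u \<in> carrier U" "z = \<sigma> (\<iota> 0 (f u))" by auto
    then have "z = \<iota> 0 (h u)" using \<sigma>_\<iota>[OF fD(1)[OF u(1)], of 0] \<iota>_glue[OF u(1)] by simp
    then show "z \<in> \<iota> 0 ` carrier V" using hD(1)[OF u(1)] by blast
  qed
  moreover have "rung 0 \<subseteq> \<iota> 0 ` carrier V" using fD(1) by auto
  moreover have "B <+>\<^bsub>tower\<^esub> \<iota> 0 ` carrier V = \<iota> 0 ` carrier V" "\<iota> 0 ` carrier V <+>\<^bsub>tower\<^esub> B = \<iota> 0 ` carrier V"
    if "B \<in> scalar_subspaces (carrier R) tower (carrier tower)" "B \<subseteq> \<iota> 0 ` carrier V" for B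
    using T.subset_set_add[OF that(1) \<iota>_image] T.subset_set_add[OF \<iota>_image that(1)]
      set_add_least[OF \<iota>_image that(2) subset_refl] set_add_least[OF \<iota>_image subset_refl that(2)]
    by (metis subset_antisym)+
  moreover have "\<sigma> ` rung 0 \<in> scalar_subspaces (carrier R) tower (carrier tower)"
    by (rule scalar_subspaces_image[OF \<sigma>_hom left_module_tower left_module_tower subset_refl rung])
  ultimately show ?case using rung[of 0] by (metis rung.simps(2))
next
  case (Suc n)
  have "\<sigma> ` rung (Suc n) = \<sigma> ` rung n <+>\<^bsub>tower\<^esub> \<iota> (Suc n) ` carrier V"
  proof -
    have c: "\<And>z. z \<in> rung n \<Longrightarrow> z \<in> carrier tower" using scalar_subspacesD(1)[OF rung] by blast
    have \<sigma>_add: "\<sigma> (z \<oplus>\<^bsub>tower\<^esub> \<iota> n v) = \<sigma> z \<oplus>\<^bsub>tower\<^esub> \<iota> (Suc n) v" if "z \<in> rung n" "v \<in> carrier V" for z v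
      using mod_homD(2)[OF \<sigma>_hom c[OF that(1)] \<iota>D(1)[OF that(2)]] \<sigma>_\<iota>[OF that(2)] by simp
    show ?thesis
    proof (intro equalityI subsetI)
      fix y assume "y \<in> \<sigma> ` rung (Suc n)"
      then obtain z v where "z \<in> rung n" "v \<in> carrier V" "y = \<sigma> (z \<oplus>\<^bsub>tower\<^esub> \<iota> n v)"
        by (auto simp: T.mem_set_add)
      then show "y \<in> \<sigma> ` rung n <+>\<^bsub>tower\<^esub> \<iota> (Suc n) ` carrier V"
        using \<sigma>_add unfolding T.mem_set_add by blast
    next
      fix y assume "y \<in> \<sigma> ` rung n <+>\<^bsub>tower\<^esub> \<iota> (Suc n) ` carrier V"
      then obtain z v where zv: "z \<in> rung n" "v \<in> carrier V" "y = \<sigma> z \<oplus>\<^bsub>tower\<^esub> \<iota> (Suc n) v"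
        by (auto simp: T.mem_set_add)
      have "z \<oplus>\<^bsub>tower\<^esub> \<iota> n v \<in> rung (Suc n)" using zv(1,2) by (auto simp: T.mem_set_add)
      then show "y \<in> \<sigma> ` rung (Suc n)" unfolding zv(3) \<sigma>_add[OF zv(1,2), symmetric] by (rule imageI)
    qed
  qed
  moreover have "(\<iota> 0 ` carrier V <+>\<^bsub>tower\<^esub> \<sigma> ` rung n) <+>\<^bsub>tower\<^esub> \<iota> (Suc n) ` carrier V
      = \<iota> 0 ` carrier V <+>\<^bsub>tower\<^esub> (\<sigma> ` rung n <+>\<^bsub>tower\<^esub> \<iota> (Suc n) ` carrier V)"
  proof -
    have "\<sigma> ` rung n \<subseteq> carrier tower"
      using scalar_subspacesD(1)[OF scalar_subspaces_image[OF \<sigma>_hom left_module_tower left_module_tower subset_refl rung]] .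
    moreover have "\<iota> i ` carrier V \<subseteq> carrier tower" for i using \<iota>D(1) by blast
    ultimately show ?thesis
      unfolding set_add_def using T.add.set_mult_assoc by simp
  qed
  ultimately show ?case using Suc.IH by simp
qed

end

section \<open>The subquotients of the ladder\<close>

context ladder
begin

text \<open>Projection to the coordinate \<open>0\<close> modulo the image of \<open>h\<close>, the cokernel map of the shift.\<close>
definition \<rho> :: "(nat \<Rightarrow> 'v) set \<Rightarrow> 'v set" where
  "\<rho> = (SOME r. r \<in> mod_hom R tower Y \<and>
     (\<forall>x\<in>carrier V. r (\<iota> 0 x) = h ` carrier U +>\<^bsub>V\<^esub> x \<and> (\<forall>n. r (\<iota> (Suc n) x) = \<zero>\<^bsub>Y\<^esub>)))"

lemma \<rho>_hom: "\<rho> \<in> mod_hom R tower Y"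
  and \<rho>_\<iota>0: "\<And>x. x \<in> carrier V \<Longrightarrow> \<rho> (\<iota> 0 x) = h ` carrier U +>\<^bsub>V\<^esub> x"
  and \<rho>_\<iota>: "\<And>n x. x \<in> carrier V \<Longrightarrow> \<rho> (\<iota> (Suc n) x) = \<zero>\<^bsub>Y\<^esub>"
proof -
  have "\<exists>r. r \<in> mod_hom R tower Y \<and>
     (\<forall>x\<in>carrier V. r (\<iota> 0 x) = h ` carrier U +>\<^bsub>V\<^esub> x \<and> (\<forall>n. r (\<iota> (Suc n) x) = \<zero>\<^bsub>Y\<^esub>))"
    using \<rho>_exists by blast
  from someI_ex[OF this, folded \<rho>_def]
  show "\<rho> \<in> mod_hom R tower Y"
    "\<And>x. x \<in> carrier V \<Longrightarrow> \<rho> (\<iota> 0 x) = h ` carrier U +>\<^bsub>V\<^esub> x"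
    "\<And>n x. x \<in> carrier V \<Longrightarrow> \<rho> (\<iota> (Suc n) x) = \<zero>\<^bsub>Y\<^esub>" by blast+
qed

lemma rung_carrier: "z \<in> rung n \<Longrightarrow> z \<in> carrier tower"
  using scalar_subspacesD(1)[OF rung] by blast

lemma \<sigma>_rung: "z \<in> rung n \<Longrightarrow> \<sigma> z \<in> rung (Suc n)"
proof -
  assume z: "z \<in> rung n"
  have "\<sigma> ` rung n \<in> scalar_subspaces (carrier R) tower (carrier tower)"
    by (rule scalar_subspaces_image[OF \<sigma>_hom left_module_tower left_module_tower subset_refl rung])
  from T.subset_set_add(2)[OF \<iota>_image[of 0] this] z show ?thesis unfolding rung_Suc_shift by blast
qed

lemma \<rho>_\<sigma>_rung: "z \<in> rung n \<Longrightarrow> \<rho> (\<sigma> z) = \<zero>\<^bsub>Y\<^esub>"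
proof (induction n arbitrary: z)
  case 0
  then obtain u where u: "u \<in> carrier U" "z = \<iota> 0 (f u)" by auto
  then show ?case using \<rho>_\<iota>[OF fD(1)[OF u(1)], of 0] \<sigma>_\<iota>[OF fD(1)[OF u(1)], of 0] by simp
next
  case (Suc n)
  interpret Y: left_module R Y by (rule left_module_Y)
  obtain w v where w: "w \<in> rung n" and v: "v \<in> carrier V" and z: "z = w \<oplus>\<^bsub>tower\<^esub> \<iota> n v"
    using Suc.prems by (auto simp: T.mem_set_add)
  have "\<sigma> z = \<sigma> w \<oplus>\<^bsub>tower\<^esub> \<iota> (Suc n) v"
    unfolding z using mod_homD(2)[OF \<sigma>_hom rung_carrier[OF w] \<iota>D(1)[OF v]] \<sigma>_\<iota>[OF v] by simp
  then show ?case
    using mod_homD(2)[OF \<rho>_hom mod_homD(1)[OF \<sigma>_hom rung_carrier[OF w]] \<iota>D(1)[OF v], of "Suc n"]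
      Suc.IH[OF w] \<rho>_\<iota>[OF v] by simp
qed

lemma \<rho>_kernel:
  assumes z: "z \<in> rung (Suc n)"
  shows "\<rho> z = \<zero>\<^bsub>Y\<^esub> \<longleftrightarrow> z \<in> \<sigma> ` rung n"
proof
  interpret Y: left_module R Y by (rule left_module_Y)
  assume rz: "\<rho> z = \<zero>\<^bsub>Y\<^esub>"
  obtain v w where v: "v \<in> carrier V" and w: "w \<in> rung n" and zvw: "z = \<iota> 0 v \<oplus>\<^bsub>tower\<^esub> \<sigma> w"
    using z unfolding rung_Suc_shift by (auto simp: T.mem_set_add)
  have "\<rho> z = \<rho> (\<iota> 0 v)"
    unfolding zvw
    using mod_homD(2)[OF \<rho>_hom \<iota>D(1)[OF v] mod_homD(1)[OF \<sigma>_hom rung_carrier[OF w]], of 0]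
      mod_homD(1)[OF \<rho>_hom \<iota>D(1)[OF v], of 0] \<rho>_\<sigma>_rung[OF w] by simp
  then have "h ` carrier U +>\<^bsub>V\<^esub> v = \<zero>\<^bsub>Y\<^esub>" using rz \<rho>_\<iota>0[OF v] by simp
  then have "v \<in> h ` carrier U"
    using V.quotient_facts(3)[OF h_submodule v] unfolding cokernel_module_def by simp
  then obtain u where u: "u \<in> carrier U" "v = h u" by blast
  have fu: "\<iota> 0 (f u) \<in> rung n" using rung_mono[of 0 n] u(1) by auto
  have "\<iota> 0 v = \<sigma> (\<iota> 0 (f u))" using \<iota>_glue[OF u(1)] \<sigma>_\<iota>[OF fD(1)[OF u(1)]] u(2) by simp
  then have "z = \<sigma> (\<iota> 0 (f u) \<oplus>\<^bsub>tower\<^esub> w)"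
    unfolding zvw using mod_homD(2)[OF \<sigma>_hom rung_carrier[OF fu] rung_carrier[OF w]] by simp
  then show "z \<in> \<sigma> ` rung n" using scalar_subspacesD(3)[OF rung fu w] by blast
qed (use \<rho>_\<sigma>_rung in blast)

lemma \<rho>_surj: "\<rho> ` rung (Suc n) = carrier Y"
proof
  show "\<rho> ` rung (Suc n) \<subseteq> carrier Y" using mod_homD(1)[OF \<rho>_hom] rung_carrier by blast
  have "rung (Suc 0) \<subseteq> rung (Suc n)" by (rule rung_mono) simp
  then have sub: "\<iota> 0 ` carrier V \<subseteq> rung (Suc n)" using rung_Suc(2)[of 0] by blast
  show "carrier Y \<subseteq> \<rho> ` rung (Suc n)"
  proof
    fix y assume "y \<in> carrier Y"
    then obtain v where v: "v \<in> carrier V" "y = h ` carrier U +>\<^bsub>V\<^esub> v"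
      using V.quotient_facts(1)[OF h_submodule] unfolding cokernel_module_def by auto
    have "\<iota> 0 v \<in> rung (Suc n)" using sub v(1) by blast
    then show "y \<in> \<rho> ` rung (Suc n)" unfolding v(2) \<rho>_\<iota>0[OF v(1), symmetric] by (rule imageI)
  qed
qed

text \<open>The cokernel map of the inclusion of \<open>rung n\<close> into \<open>rung (Suc n)\<close>: the top coordinate, read in \<open>W\<close>.\<close>
definition \<pi> :: "nat \<Rightarrow> (nat \<Rightarrow> 'v) set \<Rightarrow> 'w" where
  "\<pi> n z = g (SOME v. v \<in> carrier V \<and> (\<exists>a\<in>rung n. z = a \<oplus>\<^bsub>tower\<^esub> \<iota> n v))"

lemma \<pi>_val:
  assumes a: "a \<in> rung n" and v: "v \<in> carrier V"
  shows "\<pi> n (a \<oplus>\<^bsub>tower\<^esub> \<iota> n v) = g v"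
proof -
  let ?P = "\<lambda>v'. v' \<in> carrier V \<and> (\<exists>a'\<in>rung n. a \<oplus>\<^bsub>tower\<^esub> \<iota> n v = a' \<oplus>\<^bsub>tower\<^esub> \<iota> n v')"
  define v' where "v' = (SOME v'. ?P v')"
  have "?P v'" unfolding v'_def by (rule someI_ex) (use a v in blast)
  then obtain a' where v': "v' \<in> carrier V" and a': "a' \<in> rung n"
    and eq: "a \<oplus>\<^bsub>tower\<^esub> \<iota> n v = a' \<oplus>\<^bsub>tower\<^esub> \<iota> n v'" by blast
  note c = rung_carrier[OF a] rung_carrier[OF a'] \<iota>D(1)[OF v, of n] \<iota>D(1)[OF v', of n]
  have "\<iota> n v = \<ominus>\<^bsub>tower\<^esub> a \<oplus>\<^bsub>tower\<^esub> (a \<oplus>\<^bsub>tower\<^esub> \<iota> n v)" using c by (simp add: T.M.r_neg1)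
  also have "\<dots> = (\<ominus>\<^bsub>tower\<^esub> a \<oplus>\<^bsub>tower\<^esub> a') \<oplus>\<^bsub>tower\<^esub> \<iota> n v'" unfolding eq using c by (simp add: T.M.a_assoc)
  finally have "\<iota> n v \<ominus>\<^bsub>tower\<^esub> \<iota> n v' = \<ominus>\<^bsub>tower\<^esub> a \<oplus>\<^bsub>tower\<^esub> a'" using c by simp
  also have "\<dots> \<in> rung n" using scalar_subspacesD(3,4)[OF rung] a a' by blast
  finally have "\<iota> n (v \<ominus>\<^bsub>V\<^esub> v') \<in> rung n" using \<iota>D(6)[OF v v'] by simp
  then have "g (v \<ominus>\<^bsub>V\<^esub> v') = \<zero>\<^bsub>W\<^esub>" using \<iota>_in_rung_iff g_zero_iff v v' by simp
  then have "g v = g v'" using gD(6)[OF v v'] gD(1) v v' by (simp add: W.M.diff_eq_zero_iff)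
  then show ?thesis by (simp add: \<pi>_def v'_def)
qed

lemma rung_SucE:
  assumes "z \<in> rung (Suc n)"
  obtains a v where "a \<in> rung n" "v \<in> carrier V" "z = a \<oplus>\<^bsub>tower\<^esub> \<iota> n v"
  using assms by (auto simp: T.mem_set_add)

abbreviation step :: "nat \<Rightarrow> ('a, (nat \<Rightarrow> 'v) set) module" where
  "step n \<equiv> tower\<lparr>carrier := rung n\<rparr>"

lemma left_module_step: "left_module R (step n)"
  by (rule T.left_module_sub[OF rung])

lemma \<pi>_hom: "\<pi> n \<in> mod_hom R (step (Suc n)) W"
  unfolding mod_hom_def
proof (intro CollectI conjI ballI Pi_I)
  fix z assume "z \<in> carrier (step (Suc n))"
  then have zr: "z \<in> rung (Suc n)" by simp
  obtain a v where z: "a \<in> rung n" "v \<in> carrier V" "z = a \<oplus>\<^bsub>tower\<^esub> \<iota> n v" by (rule rung_SucE[OF zr])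
  note cz = rung_carrier[OF z(1)] \<iota>D(1)[OF z(2), of n]
  show "\<pi> n z \<in> carrier W" using \<pi>_val[OF z(1,2)] z(2,3) gD(1) by simp
  show "\<pi> n (r \<odot>\<^bsub>step (Suc n)\<^esub> z) = r \<odot>\<^bsub>W\<^esub> \<pi> n z" if r: "r \<in> carrier R" for r
  proof -
    have "r \<odot>\<^bsub>tower\<^esub> z = r \<odot>\<^bsub>tower\<^esub> a \<oplus>\<^bsub>tower\<^esub> \<iota> n (r \<odot>\<^bsub>V\<^esub> v)"
      unfolding z(3) using T.smult_r_distr[OF r cz] \<iota>D(3)[OF r z(2)] by simp
    then show ?thesis
      using \<pi>_val[OF scalar_subspacesD(5)[OF rung r z(1)], of "r \<odot>\<^bsub>V\<^esub> v"] \<pi>_val[OF z(1,2)] z(2,3) r gD(3)[OF r z(2)]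
      by simp
  qed
  fix y assume "y \<in> carrier (step (Suc n))"
  then have yr: "y \<in> rung (Suc n)" by simp
  obtain b w where y: "b \<in> rung n" "w \<in> carrier V" "y = b \<oplus>\<^bsub>tower\<^esub> \<iota> n w" by (rule rung_SucE[OF yr])
  note cy = rung_carrier[OF y(1)] \<iota>D(1)[OF y(2), of n]
  have "z \<oplus>\<^bsub>tower\<^esub> y = (a \<oplus>\<^bsub>tower\<^esub> b) \<oplus>\<^bsub>tower\<^esub> \<iota> n (v \<oplus>\<^bsub>V\<^esub> w)"
    unfolding z(3) y(3) using cz cy \<iota>D(2)[OF z(2) y(2)] by (simp add: T.M.a_ac)
  then show "\<pi> n (z \<oplus>\<^bsub>step (Suc n)\<^esub> y) = \<pi> n z \<oplus>\<^bsub>W\<^esub> \<pi> n y"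
    using \<pi>_val[OF scalar_subspacesD(3)[OF rung z(1) y(1)], of "v \<oplus>\<^bsub>V\<^esub> w"] \<pi>_val[OF z(1,2)] \<pi>_val[OF y(1,2)]
      z(2,3) y(2,3) gD(2)[OF z(2) y(2)] by simp
qed

lemma \<pi>_diff:
  assumes x: "x \<in> rung (Suc n)" and y: "y \<in> rung (Suc n)"
  shows "\<pi> n (x \<ominus>\<^bsub>tower\<^esub> y) = \<pi> n x \<ominus>\<^bsub>W\<^esub> \<pi> n y"
  using mod_hom_minus(3)[OF \<pi>_hom left_module_step W, of x n y] x y T.minus_sub[OF rung y]
  by (simp add: a_minus_def)

lemma \<pi>_add:
  "x \<in> rung (Suc n) \<Longrightarrow> y \<in> rung (Suc n) \<Longrightarrow> \<pi> n (x \<oplus>\<^bsub>tower\<^esub> y) = \<pi> n x \<oplus>\<^bsub>W\<^esub> \<pi> n y"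
  using mod_homD(2)[OF \<pi>_hom, of x n y] by simp

lemma \<pi>_closed: "x \<in> rung (Suc n) \<Longrightarrow> \<pi> n x \<in> carrier W"
  using mod_homD(1)[OF \<pi>_hom, of x n] by simp

lemma \<pi>_zero_iff:
  assumes z: "z \<in> rung (Suc n)"
  shows "\<pi> n z = \<zero>\<^bsub>W\<^esub> \<longleftrightarrow> z \<in> rung n"
proof -
  obtain a v where zav: "a \<in> rung n" "v \<in> carrier V" "z = a \<oplus>\<^bsub>tower\<^esub> \<iota> n v" by (rule rung_SucE[OF z])
  note c = rung_carrier[OF zav(1)] \<iota>D(1)[OF zav(2), of n]
  have "\<pi> n z = \<zero>\<^bsub>W\<^esub> \<longleftrightarrow> \<iota> n v \<in> rung n"
    using \<pi>_val[OF zav(1,2)] zav(3) g_zero_iff[OF zav(2)] \<iota>_in_rung_iff[OF zav(2)] by simp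
  also have "\<dots> \<longleftrightarrow> z \<in> rung n"
  proof
    show "z \<in> rung n" if "\<iota> n v \<in> rung n" unfolding zav(3) by (rule scalar_subspacesD(3)[OF rung zav(1) that])
    show "\<iota> n v \<in> rung n" if "z \<in> rung n"
    proof -
      have "\<iota> n v = z \<ominus>\<^bsub>tower\<^esub> a" unfolding zav(3) using c by (simp add: T.M.a_comm[of a])
      then show ?thesis using scalar_subspacesD(6)[OF rung that zav(1)] by simp
    qed
  qed
  finally show ?thesis .
qed

lemma \<pi>_surj: "\<pi> n ` rung (Suc n) = carrier W"
proof
  show "\<pi> n ` rung (Suc n) \<subseteq> carrier W" using \<pi>_closed by blast
  show "carrier W \<subseteq> \<pi> n ` rung (Suc n)"
  proof
    fix w assume "w \<in> carrier W"
    then obtain v where v: "v \<in> carrier V" "w = g v" using g_surj by blast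
    have z: "\<zero>\<^bsub>tower\<^esub> \<in> rung n" by (rule scalar_subspacesD(2)[OF rung])
    have "\<zero>\<^bsub>tower\<^esub> \<oplus>\<^bsub>tower\<^esub> \<iota> n v \<in> rung (Suc n)" using z v(1) unfolding rung.simps T.mem_set_add by blast
    then show "w \<in> \<pi> n ` rung (Suc n)" using \<pi>_val[OF z v(1)] v(2) by (metis imageI)
  qed
qed

text \<open>An induction along the filtration with subquotients \<open>U\<close> and \<open>V / f(U)\<close>. The set \<open>D\<close> is kept general
because the condition is needed both over \<open>k\<close> and, for finite length, over the algebra.\<close>
lemma chain_cond_rung:
  assumes D: "D \<subseteq> carrier R" and ccU: "chain_cond up (scalar_subspaces D U (carrier U))"
    and ccV: "chain_cond up (scalar_subspaces D V (carrier V))"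
  shows "chain_cond up (scalar_subspaces D tower (rung n))"
proof (induction n)
  case 0
  have hom: "(\<lambda>u. \<iota> 0 (f u)) \<in> mod_hom R U tower" by (rule mod_hom_comp[OF f_hom \<iota>_hom])
  show ?case
  proof (rule chain_cond_inj[OF ccU])
    fix N assume N: "N \<in> scalar_subspaces D tower (rung 0)"
    show "{u \<in> carrier U. \<iota> 0 (f u) \<in> N} \<in> scalar_subspaces D U (carrier U)"
      by (rule scalar_subspaces_vimage[OF hom U left_module_tower D N U.carrier_scalar_subspace[OF D]])
    fix N' assume N': "N' \<in> scalar_subspaces D tower (rung 0)"
      and eq: "{u \<in> carrier U. \<iota> 0 (f u) \<in> N} = {u \<in> carrier U. \<iota> 0 (f u) \<in> N'}"
    show "N' \<subseteq> N"
    proof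
      fix x assume x: "x \<in> N'"
      then obtain u where u: "u \<in> carrier U" "x = \<iota> 0 (f u)" using scalar_subspacesD(1)[OF N'] by auto
      then have "u \<in> {u \<in> carrier U. \<iota> 0 (f u) \<in> N'}" using x by simp
      then show "x \<in> N" unfolding eq[symmetric] using u(2) by simp
    qed
  qed auto
next
  case (Suc n)
  have sub: "rung n \<in> scalar_subspaces D tower (carrier tower)" for n
    by (rule scalar_subspaces_superset[OF rung D subset_refl])
  show ?case
    unfolding rung.simps
  proof (rule T.chain_cond_set_add[OF sub _ Suc ccV])
    show "\<iota> n ` carrier V \<subseteq> carrier tower" using \<iota>D(1) by blast
    fix N assume N: "N \<in> scalar_subspaces D tower (rung n <+>\<^bsub>tower\<^esub> \<iota> n ` carrier V)"
    have "N \<in> scalar_subspaces D tower (carrier tower)"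
      by (rule scalar_subspaces_superset[OF N subset_refl]) (use scalar_subspacesD(1)[OF rung, of "Suc n"] in simp)
    from T.add_scalar_subspace[OF this sub D]
    show "{v \<in> carrier V. \<iota> n v \<in> N <+>\<^bsub>tower\<^esub> rung n} \<in> scalar_subspaces D V (carrier V)"
      by (rule scalar_subspaces_vimage[OF \<iota>_hom V left_module_tower D _ V.carrier_scalar_subspace[OF D]])
  qed
qed

lemma chain_cond_Y:
  assumes ccV: "chain_cond up (scalar_subspaces (carrier R) V (carrier V))"
  shows "chain_cond up (scalar_subspaces (carrier R) Y (carrier Y))"
proof (rule chain_cond_inj[OF ccV])
  have hom: "(\<lambda>x. h ` carrier U +>\<^bsub>V\<^esub> x) \<in> mod_hom R V Y"
    unfolding cokernel_module_def by (rule V.left_module_quotient(2)[OF h_submodule])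
  have carY: "carrier Y = (\<lambda>x. h ` carrier U +>\<^bsub>V\<^esub> x) ` carrier V"
    unfolding cokernel_module_def by (rule V.quotient_facts(1)[OF h_submodule])
  fix N assume N: "N \<in> scalar_subspaces (carrier R) Y (carrier Y)"
  show "{x \<in> carrier V. h ` carrier U +>\<^bsub>V\<^esub> x \<in> N} \<in> scalar_subspaces (carrier R) V (carrier V)"
    by (rule scalar_subspaces_vimage[OF hom V left_module_Y subset_refl N V.carrier_scalar_subspace[OF subset_refl]])
  fix N' assume N': "N' \<in> scalar_subspaces (carrier R) Y (carrier Y)"
    and eq: "{x \<in> carrier V. h ` carrier U +>\<^bsub>V\<^esub> x \<in> N} = {x \<in> carrier V. h ` carrier U +>\<^bsub>V\<^esub> x \<in> N'}"
  show "N' \<subseteq> N"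
  proof
    fix y assume y: "y \<in> N'"
    then obtain x where x: "x \<in> carrier V" "y = h ` carrier U +>\<^bsub>V\<^esub> x"
      using scalar_subspacesD(1)[OF N'] unfolding carY by blast
    then have "x \<in> {x \<in> carrier V. h ` carrier U +>\<^bsub>V\<^esub> x \<in> N'}" using y by simp
    then show "y \<in> N" unfolding eq[symmetric] using x(2) by simp
  qed
qed auto

end

section \<open>Splitting far up the ladder\<close>

context artin_alg
begin

text \<open>The part of the free cover that is spanned by the basis elements in \<open>X\<close>. Working inside the
free cover of all elements makes the hypothesis on \<open>Ext\<^sup>1\<close> directly applicable.\<close>
abbreviation fin_cover :: "('a, 'b, 'm) module_scheme \<Rightarrow> 'b set \<Rightarrow> ('b \<Rightarrow> 'a) set" where
  "fin_cover M X \<equiv> supported (carrier M) (regular_module \<Lambda>) X (carrier \<Lambda>)"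

lemma left_module_regular_\<Lambda>: "left_module \<Lambda> (regular_module \<Lambda>)"
  by (rule left_module_regular[OF ring_\<Lambda>])

lemma regular_subspace: "D \<subseteq> carrier \<Lambda> \<Longrightarrow> carrier \<Lambda> \<in> scalar_subspaces D (regular_module \<Lambda>) (carrier (regular_module \<Lambda>))"
  using left_module.carrier_scalar_subspace[OF left_module_regular_\<Lambda>, of D] by (simp add: regular_module_def)

lemma fin_cover_subspace:
  "D \<subseteq> carrier \<Lambda> \<Longrightarrow> fin_cover M X \<in> scalar_subspaces D (free_cover \<Lambda> M) (carrier (free_cover \<Lambda> M))"
  unfolding free_cover_eq by (rule supported_subspace[OF left_module_regular_\<Lambda> regular_subspace])

lemma chain_cond_fin_cover:
  "finite X \<Longrightarrow> chain_cond False (scalar_subspaces scal (free_cover \<Lambda> M) (fin_cover M X))"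
  unfolding free_cover_eq
  by (rule chain_cond_supported[OF left_module_regular_\<Lambda> regular_subspace[OF scal] scal chain_cond_regular])

lemma finitely_generated:
  assumes M: "left_module \<Lambda> M" and cc: "chain_cond True (scalar_subspaces scal M (carrier M))"
  shows "\<exists>X. finite X \<and> X \<subseteq> carrier M \<and> free_cover_map \<Lambda> M ` fin_cover M X = carrier M"
proof -
  let ?p = "free_cover_map \<Lambda> M"
  note F = left_module_free_cover[OF ring_\<Lambda>, of M]
  let ?G = "(\<lambda>X. ?p ` fin_cover M X) ` {X. finite X \<and> X \<subseteq> carrier M}"
  have sub: "?p ` fin_cover M X \<in> scalar_subspaces scal M (carrier M)" for X
    by (rule scalar_subspaces_image[OF free_cover_map_hom[OF M] F M scal fin_cover_subspace[OF scal]])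
  have "\<exists>N\<in>?G. \<forall>N'\<in>?G. beyond True N N' \<longrightarrow> N' = N"
    by (rule chain_cond_extremal[OF cc]) (use sub in blast)+
  then obtain N where N: "N \<in> ?G" and max: "\<forall>N'\<in>?G. beyond True N N' \<longrightarrow> N' = N" ..
  obtain X where X: "finite X" "X \<subseteq> carrier M" "N = ?p ` fin_cover M X" using N by blast
  have "carrier M \<subseteq> N"
  proof
    fix x assume x: "x \<in> carrier M"
    have mono: "fin_cover M X \<subseteq> fin_cover M (insert x X)"
      using ring.ring_simprules(2)[OF ring_\<Lambda>] by (auto simp: supported_def regular_module_def)
    have "?p ` fin_cover M (insert x X) = N"
      using max[THEN bspec, of "?p ` fin_cover M (insert x X)"] X x image_mono[OF mono, of ?p]
      by (simp add: beyond_def)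
    moreover have "basis_elt \<Lambda> x \<in> fin_cover M (insert x X)"
      using basis_elt_closed[OF ring_\<Lambda> x] x X(2)
      unfolding supported_def free_cover_eq by (auto simp: basis_elt_def regular_module_def)
    ultimately have "?p (basis_elt \<Lambda> x) \<in> N" by blast
    then show "x \<in> N" using free_cover_map_basis[OF M x] by simp
  qed
  moreover have "N \<subseteq> carrier M" using scalar_subspacesD(1)[OF sub] X(3) by simp
  ultimately show ?thesis using X by blast
qed

text \<open>Centrality of \<open>\<phi>\<close> makes homomorphism groups \<open>k\<close>-modules.\<close>
lemma mod_hom_scal_map:
  assumes N: "left_module \<Lambda> N" and f: "f \<in> mod_hom \<Lambda> M N" and r: "r \<in> carrier k"
  shows "(\<lambda>x. \<phi> r \<odot>\<^bsub>N\<^esub> f x) \<in> mod_hom \<Lambda> M N"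
proof -
  interpret N: left_module \<Lambda> N by fact
  have "\<phi> r \<odot>\<^bsub>N\<^esub> (a \<odot>\<^bsub>N\<^esub> y) = a \<odot>\<^bsub>N\<^esub> (\<phi> r \<odot>\<^bsub>N\<^esub> y)" if "a \<in> carrier \<Lambda>" "y \<in> carrier N" for a y
    using that r central[OF r that(1)] by (simp add: N.smult_assoc1[symmetric])
  then show ?thesis
    using mod_homD[OF f] r by (auto simp: mod_hom_def N.smult_r_distr)
qed

end

locale artin_ladder = artin_alg k \<phi> \<Lambda> + ladder \<Lambda> U V W f h g
  for k :: "('k, 'r) ring_scheme" and \<phi> :: "'k \<Rightarrow> 'a" and \<Lambda> :: "('a, 's) ring_scheme"
    and U :: "('a, 'u, 'm1) module_scheme" and V :: "('a, 'v, 'm2) module_scheme"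
    and W :: "('a, 'w, 'm3) module_scheme" and f h :: "'u \<Rightarrow> 'v" and g :: "'v \<Rightarrow> 'w" +
  assumes flU: "finite_length \<Lambda> U" and flV: "finite_length \<Lambda> V" and flW: "finite_length \<Lambda> W"
    and Ext: "trivial_group (Ext1 \<Lambda> W W)"
begin

abbreviation F :: "('a, 'w \<Rightarrow> 'a) module" where "F \<equiv> free_cover \<Lambda> W"
abbreviation p :: "('w \<Rightarrow> 'a) \<Rightarrow> 'w" where "p \<equiv> free_cover_map \<Lambda> W"
abbreviation S :: "('w \<Rightarrow> 'a) set" where "S \<equiv> carrier (syzygy \<Lambda> W)"

lemma left_module_F: "left_module \<Lambda> F" by (rule left_module_free_cover[OF ring_\<Lambda>])
lemma p_hom: "p \<in> mod_hom \<Lambda> F W" by (rule free_cover_map_hom[OF W])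
lemma S_F: "c \<in> S \<Longrightarrow> c \<in> carrier F" using left_module_syzygy(2)[OF W] by blast

declare rung.simps [simp del]

lemma step_hom_iff: "z \<in> mod_hom \<Lambda> F (step n) \<longleftrightarrow> z \<in> mod_hom \<Lambda> F tower \<and> z ` carrier F \<subseteq> rung n"
  by (rule mod_hom_sub[OF scalar_subspacesD(1)[OF rung]])

text \<open>One use of \<open>Ext\<^sup>1(W, W) = 0\<close>: the map that \<open>\<Phi>\<close> induces from the syzygy to \<open>rung (Suc n) / rung n = W\<close> extends
to the free cover, and the extension lifts to \<open>rung (Suc n)\<close> by projectivity.\<close>
lemma push_down_step:
  assumes \<Phi>: "\<Phi> \<in> mod_hom \<Lambda> F tower" and S: "\<Phi> ` S \<subseteq> rung (Suc n)"
  shows "\<exists>z \<in> mod_hom \<Lambda> F tower. z ` carrier F \<subseteq> rung (Suc n) \<and> (\<forall>c\<in>S. \<Phi> c \<ominus>\<^bsub>tower\<^esub> z c \<in> rung n)"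
proof -
  have S': "\<Phi> c \<in> rung (Suc n)" if "c \<in> S" for c using S that by blast
  have "\<Phi> \<in> mod_hom \<Lambda> (syzygy \<Lambda> W) (step (Suc n))"
    using mod_homD[OF \<Phi>] S_F S' by (auto simp: mod_hom_def syzygy_simps(2,3))
  then have "(\<lambda>c. \<pi> n (\<Phi> c)) \<in> mod_hom \<Lambda> (syzygy \<Lambda> W) W" by (rule mod_hom_comp[OF _ \<pi>_hom])
  then obtain \<Psi> where \<Psi>: "\<Psi> \<in> mod_hom \<Lambda> F W" "\<And>c. c \<in> S \<Longrightarrow> \<Psi> c = \<pi> n (\<Phi> c)"
    using Ext1_trivial_extend[OF W W Ext] by blast
  have surj: "\<pi> n ` carrier (step (Suc n)) = carrier W" using \<pi>_surj by simp
  obtain z where z: "z \<in> mod_hom \<Lambda> F (step (Suc n))" "\<And>c. c \<in> carrier F \<Longrightarrow> \<pi> n (z c) = \<Psi> c"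
    using free_cover_projective[OF left_module_step W \<pi>_hom surj \<Psi>(1)] by blast
  have z': "z \<in> mod_hom \<Lambda> F tower" "z ` carrier F \<subseteq> rung (Suc n)"
    using z(1) unfolding step_hom_iff by auto
  have "\<Phi> c \<ominus>\<^bsub>tower\<^esub> z c \<in> rung n" if c: "c \<in> S" for c
  proof -
    have zc: "z c \<in> rung (Suc n)" using z'(2) S_F[OF c] by blast
    have d: "\<Phi> c \<ominus>\<^bsub>tower\<^esub> z c \<in> rung (Suc n)" by (rule scalar_subspacesD(6)[OF rung S'[OF c] zc])
    have "\<pi> n (\<Phi> c \<ominus>\<^bsub>tower\<^esub> z c) = \<zero>\<^bsub>W\<^esub>"
      unfolding \<pi>_diff[OF S'[OF c] zc] using z(2)[OF S_F[OF c]] \<Psi>(2)[OF c] \<pi>_closed[OF S'[OF c]] by simp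
    then show ?thesis using \<pi>_zero_iff[OF d] by simp
  qed
  then show ?thesis using z' by blast
qed

text \<open>Descending through the filtration, every extension of \<open>W\<close> by \<open>rung n\<close> is the pushout of one by \<open>rung 0\<close>.\<close>
lemma push_down:
  assumes "\<Phi> \<in> mod_hom \<Lambda> F tower" "\<Phi> ` S \<subseteq> rung n"
  shows "\<exists>z \<in> mod_hom \<Lambda> F tower. z ` carrier F \<subseteq> rung n \<and> (\<forall>c\<in>S. \<Phi> c \<ominus>\<^bsub>tower\<^esub> z c \<in> rung 0)"
  using assms
proof (induction n arbitrary: \<Phi>)
  case 0
  have "(\<lambda>_. \<zero>\<^bsub>tower\<^esub>) \<in> mod_hom \<Lambda> F tower" by (rule mod_hom_zero_map[OF left_module_tower])
  moreover have "\<Phi> c \<ominus>\<^bsub>tower\<^esub> \<zero>\<^bsub>tower\<^esub> \<in> rung 0" if "c \<in> S" for c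
    using 0 that mod_homD(1)[OF 0(1) S_F[OF that]] by auto
  moreover have "(\<lambda>_. \<zero>\<^bsub>tower\<^esub>) ` carrier F \<subseteq> rung 0" using scalar_subspacesD(2)[OF rung, of 0] by blast
  ultimately show ?case by blast
next
  case (Suc n)
  obtain z1 where z1: "z1 \<in> mod_hom \<Lambda> F tower" "z1 ` carrier F \<subseteq> rung (Suc n)"
    "\<And>c. c \<in> S \<Longrightarrow> \<Phi> c \<ominus>\<^bsub>tower\<^esub> z1 c \<in> rung n"
    using push_down_step[OF Suc.prems] by blast
  have hom: "(\<lambda>c. \<Phi> c \<ominus>\<^bsub>tower\<^esub> z1 c) \<in> mod_hom \<Lambda> F tower"
    by (rule mod_hom_diff_map[OF left_module_tower Suc.prems(1) z1(1)])
  have img: "(\<lambda>c. \<Phi> c \<ominus>\<^bsub>tower\<^esub> z1 c) ` S \<subseteq> rung n" using z1(3) by (rule image_subsetI)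
  from Suc.IH[OF hom img] obtain z2 where z20: "z2 \<in> mod_hom \<Lambda> F tower" "z2 ` carrier F \<subseteq> rung n \<and>
    (\<forall>c\<in>S. (\<Phi> c \<ominus>\<^bsub>tower\<^esub> z1 c) \<ominus>\<^bsub>tower\<^esub> z2 c \<in> rung 0)" ..
  then have z2: "z2 \<in> mod_hom \<Lambda> F tower" "z2 ` carrier F \<subseteq> rung n"
    "\<And>c. c \<in> S \<Longrightarrow> (\<Phi> c \<ominus>\<^bsub>tower\<^esub> z1 c) \<ominus>\<^bsub>tower\<^esub> z2 c \<in> rung 0" by simp_all
  have "(\<lambda>c. z1 c \<oplus>\<^bsub>tower\<^esub> z2 c) \<in> mod_hom \<Lambda> F tower" by (rule mod_hom_add_map[OF left_module_tower z1(1) z2(1)])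
  moreover have "(\<lambda>c. z1 c \<oplus>\<^bsub>tower\<^esub> z2 c) ` carrier F \<subseteq> rung (Suc n)"
  proof (rule image_subsetI)
    fix c assume c: "c \<in> carrier F"
    have "z1 c \<in> rung (Suc n)" "z2 c \<in> rung (Suc n)" using z1(2) z2(2) c rung_Suc(1)[of n] by blast+
    then show "z1 c \<oplus>\<^bsub>tower\<^esub> z2 c \<in> rung (Suc n)" by (rule scalar_subspacesD(3)[OF rung])
  qed
  moreover have "\<Phi> c \<ominus>\<^bsub>tower\<^esub> (z1 c \<oplus>\<^bsub>tower\<^esub> z2 c) \<in> rung 0" if c: "c \<in> S" for c
  proof -
    have "\<Phi> c \<ominus>\<^bsub>tower\<^esub> (z1 c \<oplus>\<^bsub>tower\<^esub> z2 c) = (\<Phi> c \<ominus>\<^bsub>tower\<^esub> z1 c) \<ominus>\<^bsub>tower\<^esub> z2 c"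
      using mod_homD(1)[OF Suc.prems(1) S_F[OF c]] mod_homD(1)[OF z1(1) S_F[OF c]] mod_homD(1)[OF z2(1) S_F[OF c]]
      by (simp add: a_minus_def T.M.minus_add T.M.a_assoc)
    then show ?thesis using z2(3)[OF c] by simp
  qed
  ultimately show ?case by blast
qed

text \<open>The class of \<open>0 \<rightarrow> rung n \<rightarrow> rung (Suc n) \<rightarrow> W \<rightarrow> 0\<close> comes from a class over \<open>rung 0\<close>. If \<open>\<Phi>\<close> vanished on
the syzygy, it would induce a section of \<open>\<pi> n\<close>.\<close>
lemma approximate_section:
  "\<exists>\<Phi> \<in> mod_hom \<Lambda> F tower. \<Phi> ` carrier F \<subseteq> rung (Suc n) \<and> \<Phi> ` S \<subseteq> rung 0 \<and> (\<forall>c\<in>carrier F. \<pi> n (\<Phi> c) = p c)"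
proof -
  have surj: "\<pi> n ` carrier (step (Suc n)) = carrier W" using \<pi>_surj by simp
  obtain \<Phi>0 where \<Phi>0: "\<Phi>0 \<in> mod_hom \<Lambda> F (step (Suc n))" "\<And>c. c \<in> carrier F \<Longrightarrow> \<pi> n (\<Phi>0 c) = p c"
    using free_cover_projective[OF left_module_step W \<pi>_hom surj p_hom] by blast
  have \<Phi>1: "\<Phi>0 \<in> mod_hom \<Lambda> F tower" "\<And>c. c \<in> carrier F \<Longrightarrow> \<Phi>0 c \<in> rung (Suc n)"
    using \<Phi>0(1) unfolding step_hom_iff by auto
  have "\<Phi>0 ` S \<subseteq> rung n"
  proof (rule image_subsetI)
    fix c assume c: "c \<in> S"
    have "\<pi> n (\<Phi>0 c) = \<zero>\<^bsub>W\<^esub>" using \<Phi>0(2)[OF S_F[OF c]] c by (simp add: syzygy_simps(1))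
    then show "\<Phi>0 c \<in> rung n" using \<pi>_zero_iff[OF \<Phi>1(2)[OF S_F[OF c]]] by simp
  qed
  from push_down[OF \<Phi>1(1) this] obtain z where z0: "z \<in> mod_hom \<Lambda> F tower"
    "z ` carrier F \<subseteq> rung n \<and> (\<forall>c\<in>S. \<Phi>0 c \<ominus>\<^bsub>tower\<^esub> z c \<in> rung 0)" ..
  then have z: "z \<in> mod_hom \<Lambda> F tower" "z ` carrier F \<subseteq> rung n"
    "\<And>c. c \<in> S \<Longrightarrow> \<Phi>0 c \<ominus>\<^bsub>tower\<^esub> z c \<in> rung 0" by simp_all
  have zn: "z c \<in> rung n" "z c \<in> rung (Suc n)" if "c \<in> carrier F" for c
    using z(2) that rung_Suc(1)[of n] by blast+
  let ?\<Phi> = "\<lambda>c. \<Phi>0 c \<ominus>\<^bsub>tower\<^esub> z c"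
  have "?\<Phi> \<in> mod_hom \<Lambda> F tower" by (rule mod_hom_diff_map[OF left_module_tower \<Phi>1(1) z(1)])
  moreover have "?\<Phi> ` carrier F \<subseteq> rung (Suc n)"
    using scalar_subspacesD(6)[OF rung \<Phi>1(2) zn(2)] by blast
  moreover have "?\<Phi> ` S \<subseteq> rung 0" using z(3) by blast
  moreover have "\<pi> n (?\<Phi> c) = p c" if c: "c \<in> carrier F" for c
    unfolding \<pi>_diff[OF \<Phi>1(2)[OF c] zn(2)[OF c]]
    using \<Phi>0(2)[OF c] \<pi>_zero_iff[OF zn(2)[OF c]] zn(1)[OF c] mod_homD(1)[OF p_hom c] by simp
  ultimately show ?thesis by blast
qed

lemma ccU: "chain_cond up (scalar_subspaces scal U (carrier U))"
  and ccV: "chain_cond up (scalar_subspaces scal V (carrier V))"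
  and ccW: "chain_cond up (scalar_subspaces scal W (carrier W))"
  by (rule finite_length_chain_cond[OF U flU] finite_length_chain_cond[OF V flV] finite_length_chain_cond[OF W flW])+

lemma cc_rung: "chain_cond up (scalar_subspaces scal tower (rung n))"
  by (rule chain_cond_rung[OF scal ccU ccV])

text \<open>Let \<open>Z n\<close> be the maps from the free cover to \<open>rung n\<close> that send the syzygy to \<open>rung 0\<close>. The restrictions of
\<open>Z n\<close> to the relations among finitely many generators increase with \<open>n\<close> and become stationary. At such an
\<open>n\<close> the approximate section \<open>\<Phi>\<close> agrees on the relations with some \<open>\<Psi>\<close> in \<open>Z n\<close>. The difference kills the
relations, and it is still a lift of the projection because \<open>\<pi> n\<close> vanishes on the values of \<open>\<Psi>\<close>.\<close>
lemma split_rung: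
  "\<exists>n. \<exists>t \<in> mod_hom \<Lambda> W tower. t ` carrier W \<subseteq> rung (Suc n) \<and> (\<forall>w\<in>carrier W. \<pi> n (t w) = w)"
proof -
  interpret F: left_module \<Lambda> F by (rule left_module_F)
  obtain X where X: "finite X" "X \<subseteq> carrier W" and gen: "p ` fin_cover W X = carrier W"
    using finitely_generated[OF W ccW] by blast
  let ?P = "fin_cover W X"
  have P: "?P \<in> scalar_subspaces (carrier \<Lambda>) F (carrier F)" and Pk: "?P \<in> scalar_subspaces scal F (carrier F)"
    by (rule fin_cover_subspace[OF subset_refl] fin_cover_subspace[OF scal])+
  have PF: "\<And>c. c \<in> ?P \<Longrightarrow> c \<in> carrier F" using scalar_subspacesD(1)[OF P] by blast
  define K where "K = {c \<in> ?P. p c \<in> {\<zero>\<^bsub>W\<^esub>}}"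
  have KP: "K \<in> scalar_subspaces scal F ?P"
    unfolding K_def
    by (rule scalar_subspaces_vimage[OF p_hom left_module_F W scal W.zero_scalar_subspace[OF scal] Pk])
  have K: "K \<in> scalar_subspaces scal F (carrier F)"
    by (rule scalar_subspaces_superset[OF KP subset_refl scalar_subspacesD(1)[OF P]])
  have KS: "c \<in> S" if "c \<in> K" for c using that PF by (simp add: K_def syzygy_simps(1))
  have dccK: "chain_cond False (scalar_subspaces scal F K)"
    by (rule chain_cond_subset[OF chain_cond_fin_cover[OF X(1)]])
      (use scalar_subspaces_mono[OF subset_refl scalar_subspacesD(1)[OF KP]] in blast)
  have R0: "rung 0 \<in> scalar_subspaces scal tower (carrier tower)"
    by (rule scalar_subspaces_superset[OF rung scal subset_refl])
  define H where "H = {\<Phi> \<in> mod_hom \<Lambda> F tower. \<Phi> ` K \<subseteq> rung 0}"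
  have HH: "H \<subseteq> mod_hom \<Lambda> F tower" "\<And>\<Phi> c. \<Phi> \<in> H \<Longrightarrow> c \<in> K \<Longrightarrow> \<Phi> c \<in> rung 0" by (auto simp: H_def)
  have "\<exists>C. finite C \<and> C \<subseteq> K \<and>
    (\<forall>\<Phi>\<in>H. (\<forall>c\<in>C. \<Phi> c = \<zero>\<^bsub>tower\<^esub>) \<longrightarrow> (\<forall>c\<in>K. \<Phi> c = \<zero>\<^bsub>tower\<^esub>))"
    by (rule finite_determining_set[OF left_module_F left_module_tower scal K R0 dccK cc_rung HH(1)]) (rule HH(2))
  then obtain C where C0: "finite C \<and> C \<subseteq> K \<and>
    (\<forall>\<Phi>\<in>H. (\<forall>c\<in>C. \<Phi> c = \<zero>\<^bsub>tower\<^esub>) \<longrightarrow> (\<forall>c\<in>K. \<Phi> c = \<zero>\<^bsub>tower\<^esub>))" ..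
  then have C: "finite C" "C \<subseteq> K" by simp_all
  \<comment> \<open>Restriction to \<open>C\<close> places the maps in a finite power of \<open>rung 0\<close>, where ascending chains stop.\<close>
  define res where "res \<Phi> = (\<lambda>c. if c \<in> C then \<Phi> c else \<zero>\<^bsub>tower\<^esub>)" for \<Phi> :: "('w \<Rightarrow> 'a) \<Rightarrow> (nat \<Rightarrow> 'v) set"
  define Z where "Z n = {\<Phi> \<in> mod_hom \<Lambda> F tower. \<Phi> ` carrier F \<subseteq> rung n \<and> \<Phi> ` S \<subseteq> rung 0}" for n
  have ZD: "\<Phi> \<in> mod_hom \<Lambda> F tower" "\<And>c. c \<in> carrier F \<Longrightarrow> \<Phi> c \<in> rung n" "\<And>c. c \<in> S \<Longrightarrow> \<Phi> c \<in> rung 0"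
    if "\<Phi> \<in> Z n" for \<Phi> n using that by (auto simp: Z_def)
  have ZI: "\<Phi> \<in> Z n" if "\<Phi> \<in> mod_hom \<Lambda> F tower" "\<And>c. c \<in> carrier F \<Longrightarrow> \<Phi> c \<in> rung n" "\<And>c. c \<in> S \<Longrightarrow> \<Phi> c \<in> rung 0"
    for \<Phi> n using that by (auto simp: Z_def)
  interpret TC: left_module \<Lambda> "finsupp C tower" by (rule left_module_finsupp[OF left_module_tower])
  have CS: "c \<in> S" if "c \<in> C" for c using C(2) that KS by blast
  have res_val: "res \<Phi> \<in> supported C tower C (rung 0)" if \<Phi>: "\<Phi> \<in> Z n" for \<Phi> n
  proof -
    have fin: "finite {c. res \<Phi> c \<noteq> \<zero>\<^bsub>tower\<^esub>}"
      by (rule finite_subset[OF _ C(1)]) (auto simp: res_def)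
    have "res \<Phi> c \<in> rung 0 \<and> res \<Phi> c \<in> carrier tower" if "c \<in> C" for c
      using ZD(3)[OF \<Phi> CS[OF that]] rung_carrier that by (simp add: res_def )
    with fin show ?thesis by (simp add: supported_def finsupp_def res_def )
  qed
  have resS: "res ` Z n \<in> scalar_subspaces scal (finsupp C tower) (supported C tower C (rung 0))" for n
  proof (rule scalar_subspacesI)
    show "res ` Z n \<subseteq> supported C tower C (rung 0)" using res_val by blast
    have "(\<lambda>_. \<zero>\<^bsub>tower\<^esub>) \<in> Z n"
      by (rule ZI[OF mod_hom_zero_map[OF left_module_tower]]) (rule scalar_subspacesD(2)[OF rung])+
    moreover have "\<zero>\<^bsub>finsupp C tower\<^esub> = res (\<lambda>_. \<zero>\<^bsub>tower\<^esub>)" by (simp add: res_def finsupp_def)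
    ultimately show "\<zero>\<^bsub>finsupp C tower\<^esub> \<in> res ` Z n" by blast
  next
    fix x y assume "x \<in> res ` Z n" "y \<in> res ` Z n"
    then obtain \<Phi> \<Psi> where \<Phi>: "\<Phi> \<in> Z n" "x = res \<Phi>" and \<Psi>: "\<Psi> \<in> Z n" "y = res \<Psi>" by blast
    have "(\<lambda>c. \<Phi> c \<oplus>\<^bsub>tower\<^esub> \<Psi> c) \<in> Z n"
      by (rule ZI[OF mod_hom_add_map[OF left_module_tower]])
        (use ZD[OF \<Phi>(1)] ZD[OF \<Psi>(1)] scalar_subspacesD(3)[OF rung] in blast)+
    moreover have "x \<oplus>\<^bsub>finsupp C tower\<^esub> y = res (\<lambda>c. \<Phi> c \<oplus>\<^bsub>tower\<^esub> \<Psi> c)"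
      by (auto simp: \<Phi>(2) \<Psi>(2) res_def finsupp_def fun_eq_iff)
    ultimately show "x \<oplus>\<^bsub>finsupp C tower\<^esub> y \<in> res ` Z n" by blast
  next
    fix x assume "x \<in> res ` Z n"
    then obtain \<Phi> where \<Phi>: "\<Phi> \<in> Z n" "x = res \<Phi>" by blast
    let ?\<Psi> = "\<lambda>c. \<zero>\<^bsub>tower\<^esub> \<ominus>\<^bsub>tower\<^esub> \<Phi> c"
    have \<Psi>: "?\<Psi> \<in> Z n"
      by (rule ZI[OF mod_hom_diff_map[OF left_module_tower mod_hom_zero_map[OF left_module_tower]]])
        (use ZD[OF \<Phi>(1)] scalar_subspacesD(2,6)[OF rung] in blast)+
    have c: "x \<in> carrier (finsupp C tower)" "res ?\<Psi> \<in> carrier (finsupp C tower)"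
      using res_val[OF \<Phi>(1)] res_val[OF \<Psi>] \<Phi>(2) by (auto simp: supported_def)
    have \<Phi>c: "\<Phi> c \<in> carrier tower" if "c \<in> C" for c using ZD(3)[OF \<Phi>(1) CS[OF that]] by (rule rung_carrier)
    have "res ?\<Psi> \<oplus>\<^bsub>finsupp C tower\<^esub> x = \<zero>\<^bsub>finsupp C tower\<^esub>"
      using \<Phi>c by (auto simp: \<Phi>(2) res_def finsupp_def fun_eq_iff a_minus_def T.M.l_neg)
    then have "\<ominus>\<^bsub>finsupp C tower\<^esub> x = res ?\<Psi>" using TC.M.minus_equality c by simp
    then show "\<ominus>\<^bsub>finsupp C tower\<^esub> x \<in> res ` Z n" using \<Psi> by blast
  next
    fix d x assume "d \<in> scal" "x \<in> res ` Z n"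
    then obtain r \<Phi> where r: "r \<in> carrier k" "d = \<phi> r" and \<Phi>: "\<Phi> \<in> Z n" "x = res \<Phi>" by blast
    have "(\<lambda>c. \<phi> r \<odot>\<^bsub>tower\<^esub> \<Phi> c) \<in> Z n"
      by (rule ZI[OF mod_hom_scal_map[OF left_module_tower ZD(1)[OF \<Phi>(1)] r(1)]])
        (use ZD[OF \<Phi>(1)] scalar_subspacesD(5)[OF rung] r(1) str.hom_closed in blast)+
    moreover have "d \<odot>\<^bsub>finsupp C tower\<^esub> x = res (\<lambda>c. \<phi> r \<odot>\<^bsub>tower\<^esub> \<Phi> c)"
      by (auto simp: \<Phi>(2) r(2) res_def finsupp_def fun_eq_iff)
    ultimately show "d \<odot>\<^bsub>finsupp C tower\<^esub> x \<in> res ` Z n" by blast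
  qed
  have acc: "chain_cond True (scalar_subspaces scal (finsupp C tower) (supported C tower C (rung 0)))"
    by (rule chain_cond_supported[OF left_module_tower R0 scal cc_rung C(1)])
  have Zmono: "Z n \<subseteq> Z (Suc n)" for n unfolding Z_def using rung_Suc(1)[of n] by blast
  have "\<exists>n. res ` Z (Suc n) = res ` Z n"
    by (rule chain_cond_stationary[OF acc, of "\<lambda>n. res ` Z n"]) (rule resS, rule image_mono[OF Zmono])
  then obtain n where n: "res ` Z (Suc n) = res ` Z n" ..
  from approximate_section[of n] obtain \<Phi> where \<Phi>0: "\<Phi> \<in> mod_hom \<Lambda> F tower"
    "\<Phi> ` carrier F \<subseteq> rung (Suc n) \<and> \<Phi> ` S \<subseteq> rung 0 \<and> (\<forall>c\<in>carrier F. \<pi> n (\<Phi> c) = p c)" ..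
  then have \<Phi>: "\<Phi> \<in> Z (Suc n)" and \<pi>\<Phi>: "\<And>c. c \<in> carrier F \<Longrightarrow> \<pi> n (\<Phi> c) = p c"
    by (simp_all add: Z_def)
  have "res \<Phi> \<in> res ` Z n" using n \<Phi> by blast
  then obtain \<Psi> where \<Psi>: "\<Psi> \<in> Z n" "res \<Phi> = res \<Psi>" by blast
  define \<Delta> where "\<Delta> c = \<Phi> c \<ominus>\<^bsub>tower\<^esub> \<Psi> c" for c
  have \<Delta>: "\<Delta> \<in> mod_hom \<Lambda> F tower"
    unfolding \<Delta>_def[abs_def] by (rule mod_hom_diff_map[OF left_module_tower ZD(1)[OF \<Phi>] ZD(1)[OF \<Psi>(1)]])
  have "\<Delta> c \<in> rung 0" if "c \<in> K" for c
    unfolding \<Delta>_def by (rule scalar_subspacesD(6)[OF rung ZD(3)[OF \<Phi> KS[OF that]] ZD(3)[OF \<Psi>(1) KS[OF that]]])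
  then have \<Delta>H: "\<Delta> \<in> H" using \<Delta> by (auto simp: H_def)
  have \<Delta>C: "\<forall>c\<in>C. \<Delta> c = \<zero>\<^bsub>tower\<^esub>"
  proof
    fix c assume c: "c \<in> C"
    have "\<Phi> c = \<Psi> c" using fun_cong[OF \<Psi>(2), of c] c by (simp add: res_def)
    moreover have "\<Psi> c \<in> carrier tower" using ZD(3)[OF \<Psi>(1) CS[OF c]] by (rule rung_carrier)
    ultimately show "\<Delta> c = \<zero>\<^bsub>tower\<^esub>" by (simp add: \<Delta>_def)
  qed
  have \<Delta>0: "\<forall>c\<in>K. \<Delta> c = \<zero>\<^bsub>tower\<^esub>"
    using C0[THEN conjunct2, THEN conjunct2, THEN bspec, OF \<Delta>H] \<Delta>C by (rule mp)
  have \<Psi>n: "\<Psi> c \<in> rung (Suc n)" if "c \<in> carrier F" for c using ZD(2)[OF \<Psi>(1) that] rung_Suc(1)[of n] by blast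
  have \<Delta>n: "\<Delta> c \<in> rung (Suc n)" if "c \<in> carrier F" for c
    unfolding \<Delta>_def by (rule scalar_subspacesD(6)[OF rung ZD(2)[OF \<Phi> that] \<Psi>n[OF that]])
  have \<pi>\<Delta>: "\<pi> n (\<Delta> c) = p c" if c: "c \<in> carrier F" for c
    unfolding \<Delta>_def \<pi>_diff[OF ZD(2)[OF \<Phi> c] \<Psi>n[OF c]]
    using \<pi>\<Phi>[OF c] \<pi>_zero_iff[OF \<Psi>n[OF c]] ZD(2)[OF \<Psi>(1) c] mod_homD(1)[OF p_hom c] by simp
  define t where "t w = \<Delta> (SOME c. c \<in> ?P \<and> p c = w)" for w
  have t: "t (p c) = \<Delta> c" if c: "c \<in> ?P" for c
  proof -
    define d where "d = (SOME d. d \<in> ?P \<and> p d = p c)"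
    have "\<exists>d. d \<in> ?P \<and> p d = p c" using c by blast
    from someI_ex[OF this] have d: "d \<in> ?P \<and> p d = p c" by (simp only: d_def)
    have dc: "d \<in> ?P" "d \<in> carrier F" "c \<in> carrier F" using d c PF by auto
    have "p (d \<ominus>\<^bsub>F\<^esub> c) = \<zero>\<^bsub>W\<^esub>"
      using mod_hom_minus(3)[OF p_hom left_module_F W dc(2,3)] d mod_homD(1)[OF p_hom dc(3)] by simp
    then have "d \<ominus>\<^bsub>F\<^esub> c \<in> K" using scalar_subspacesD(6)[OF P dc(1) c] by (simp add: K_def)
    then have "\<Delta> d \<ominus>\<^bsub>tower\<^esub> \<Delta> c = \<zero>\<^bsub>tower\<^esub>"
      using \<Delta>0 mod_hom_minus(3)[OF \<Delta> left_module_F left_module_tower dc(2,3)] by simp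
    then have "\<Delta> d = \<Delta> c" using T.M.diff_eq_zero_iff mod_homD(1)[OF \<Delta>] dc by simp
    then show ?thesis by (simp add: t_def d_def)
  qed
  have lift: "\<exists>c. c \<in> ?P \<and> w = p c" if "w \<in> carrier W" for w using that gen by blast
  note P' = scalar_subspacesD[OF P]
  have "t \<in> mod_hom \<Lambda> W tower"
    unfolding mod_hom_def
  proof (intro CollectI conjI ballI Pi_I)
    fix w assume "w \<in> carrier W"
    then obtain c where c: "c \<in> ?P" "w = p c" using lift by blast
    show "t w \<in> carrier tower" using t[OF c(1)] c mod_homD(1)[OF \<Delta> PF[OF c(1)]] by simp
    show "t (a \<odot>\<^bsub>W\<^esub> w) = a \<odot>\<^bsub>tower\<^esub> t w" if a: "a \<in> carrier \<Lambda>" for a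
      using t[OF c(1)] t[OF P'(5)[OF a c(1)]] mod_homD(3)[OF \<Delta> a PF[OF c(1)]] mod_homD(3)[OF p_hom a PF[OF c(1)]] c(2)
      by simp
    fix v assume "v \<in> carrier W"
    then obtain d where d: "d \<in> ?P" "v = p d" using lift by blast
    show "t (w \<oplus>\<^bsub>W\<^esub> v) = t w \<oplus>\<^bsub>tower\<^esub> t v"
      using t[OF c(1)] t[OF d(1)] t[OF P'(3)[OF c(1) d(1)]] mod_homD(2)[OF \<Delta> PF[OF c(1)] PF[OF d(1)]]
        mod_homD(2)[OF p_hom PF[OF c(1)] PF[OF d(1)]] c(2) d(2) by simp
  qed
  moreover have "t w \<in> rung (Suc n)" "\<pi> n (t w) = w" if w: "w \<in> carrier W" for w
  proof -
    obtain c where c: "c \<in> ?P" "w = p c" using lift[OF w] by blast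
    show "t w \<in> rung (Suc n)" using t[OF c(1)] c(2) \<Delta>n[OF PF[OF c(1)]] by simp
    show "\<pi> n (t w) = w" using t[OF c(1)] c(2) \<pi>\<Delta>[OF PF[OF c(1)]] by simp
  qed
  ultimately show ?thesis by blast
qed

text \<open>A section \<open>t\<close> of \<open>\<pi> n\<close> decomposes \<open>rung (Suc n)\<close> as \<open>W \<oplus> rung n\<close>; through this decomposition the exact
sequence formed by \<open>\<sigma>\<close> and \<open>\<rho>\<close> becomes the one required.\<close>
lemma degeneration_cokernel: "degeneration \<Lambda> W Y"
proof -
  interpret Y: left_module \<Lambda> Y by (rule left_module_Y)
  obtain n t where t: "t \<in> mod_hom \<Lambda> W tower" and tr: "\<And>w. w \<in> carrier W \<Longrightarrow> t w \<in> rung (Suc n)"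
    and \<pi>t: "\<And>w. w \<in> carrier W \<Longrightarrow> \<pi> n (t w) = w"
    using split_rung by blast
  note r = scalar_subspacesD[OF rung]
  have inc: "\<And>z. z \<in> rung n \<Longrightarrow> z \<in> rung (Suc n)" using rung_Suc(1)[of n] by blast
  \<comment> \<open>The projection to the complement \<open>rung n\<close> of the image of \<open>t\<close>.\<close>
  define u where "u y = y \<ominus>\<^bsub>tower\<^esub> t (\<pi> n y)" for y
  have \<pi>0: "\<pi> n z = \<zero>\<^bsub>W\<^esub>" if "z \<in> rung n" for z using \<pi>_zero_iff[OF inc[OF that]] that by simp
  have u: "u y \<in> rung n" if y: "y \<in> rung (Suc n)" for y
  proof -
    note ty = tr[OF \<pi>_closed[OF y]]
    have "\<pi> n (u y) = \<zero>\<^bsub>W\<^esub>" unfolding u_def \<pi>_diff[OF y ty] \<pi>t[OF \<pi>_closed[OF y]] using \<pi>_closed[OF y] by simp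
    then show ?thesis using \<pi>_zero_iff r(6)[OF y ty] unfolding u_def by blast
  qed
  have decomp: "t (\<pi> n y) \<oplus>\<^bsub>tower\<^esub> u y = y" if y: "y \<in> rung (Suc n)" for y
    using rung_carrier[OF y] rung_carrier[OF tr[OF \<pi>_closed[OF y]]]
    by (simp add: u_def T.M.a_comm[of "t (\<pi> n y)"])
  have recomp: "\<pi> n (t w \<oplus>\<^bsub>tower\<^esub> z) = w" "u (t w \<oplus>\<^bsub>tower\<^esub> z) = z" if w: "w \<in> carrier W" and z: "z \<in> rung n" for w z
  proof -
    show 1: "\<pi> n (t w \<oplus>\<^bsub>tower\<^esub> z) = w" using \<pi>_add[OF tr[OF w] inc[OF z]] \<pi>t[OF w] \<pi>0[OF z] w by simp
    show "u (t w \<oplus>\<^bsub>tower\<^esub> z) = z"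
      unfolding u_def 1 using rung_carrier[OF tr[OF w]] rung_carrier[OF z] by (simp add: T.M.a_comm[of "t w"])
  qed
  have \<sigma>: "\<And>z. z \<in> rung n \<Longrightarrow> \<sigma> z \<in> rung (Suc n)" by (rule \<sigma>_rung)
  have u_add: "u (x \<oplus>\<^bsub>tower\<^esub> y) = u x \<oplus>\<^bsub>tower\<^esub> u y" if x: "x \<in> rung (Suc n)" and y: "y \<in> rung (Suc n)" for x y
    using \<pi>_add[OF x y] mod_homD(2)[OF t \<pi>_closed[OF x] \<pi>_closed[OF y]] rung_carrier[OF x] rung_carrier[OF y]
      mod_homD(1)[OF t \<pi>_closed[OF x]] mod_homD(1)[OF t \<pi>_closed[OF y]]
    by (simp add: u_def a_minus_def T.M.minus_add T.M.a_ac)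
  have \<pi>_smult: "\<pi> n (a \<odot>\<^bsub>tower\<^esub> x) = a \<odot>\<^bsub>W\<^esub> \<pi> n x" if "a \<in> carrier \<Lambda>" "x \<in> rung (Suc n)" for a x
    using mod_homD(3)[OF \<pi>_hom that(1), of x n] that(2) by simp
  have u_smult: "u (a \<odot>\<^bsub>tower\<^esub> x) = a \<odot>\<^bsub>tower\<^esub> u x" if a: "a \<in> carrier \<Lambda>" and x: "x \<in> rung (Suc n)" for a x
    using \<pi>_smult[OF a x] mod_homD(3)[OF t a \<pi>_closed[OF x]] rung_carrier[OF x] mod_homD(1)[OF t \<pi>_closed[OF x]] a
    by (simp add: u_def T.smult_r_diff)
  note \<sigma>D = mod_homD[OF \<sigma>_hom] and \<rho>D = mod_homD[OF \<rho>_hom] and tD = mod_homD[OF t]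
  define \<alpha> where "\<alpha> z = (\<pi> n (\<sigma> z), u (\<sigma> z))" for z
  define \<beta> where "\<beta> = (\<lambda>(w, z). \<rho> (t w \<oplus>\<^bsub>tower\<^esub> z))"
  have \<alpha>_hom: "\<alpha> \<in> mod_hom \<Lambda> (step n) (direct_sum W (step n))"
    by (auto simp: mod_hom_def direct_sum_def \<alpha>_def \<pi>_closed \<sigma> u \<sigma>D(2,3) rung_carrier
        \<pi>_add u_add \<pi>_smult u_smult)
  have \<alpha>_inj: "inj_on \<alpha> (carrier (step n))"
  proof (rule inj_onI)
    fix x y assume "x \<in> carrier (step n)" "y \<in> carrier (step n)" and eq: "\<alpha> x = \<alpha> y"
    then have x: "x \<in> rung n" and y: "y \<in> rung n" by simp_all
    have eq': "\<pi> n (\<sigma> x) = \<pi> n (\<sigma> y)" "u (\<sigma> x) = u (\<sigma> y)" using eq by (simp_all add: \<alpha>_def)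
    have "\<sigma> x = t (\<pi> n (\<sigma> x)) \<oplus>\<^bsub>tower\<^esub> u (\<sigma> x)" by (rule decomp[OF \<sigma>[OF x], symmetric])
    also have "\<dots> = \<sigma> y" unfolding eq' by (rule decomp[OF \<sigma>[OF y]])
    finally have "\<sigma> x = \<sigma> y" .
    then show "x = y" by (rule inj_onD[OF \<sigma>_inj _ rung_carrier[OF x] rung_carrier[OF y]])
  qed
  have tz: "t w \<oplus>\<^bsub>tower\<^esub> z \<in> rung (Suc n)" if "w \<in> carrier W" "z \<in> rung n" for w z
    by (rule r(3)[OF tr[OF that(1)] inc[OF that(2)]])
  have \<beta>_hom: "\<beta> \<in> mod_hom \<Lambda> (direct_sum W (step n)) Y"
    unfolding mod_hom_def
  proof (intro CollectI conjI ballI Pi_I)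
    fix a assume "a \<in> carrier (direct_sum W (step n))"
    then obtain w z where a: "a = (w, z)" "w \<in> carrier W" "z \<in> rung n" by (auto simp: direct_sum_def)
    note ca = tD(1)[OF a(2)] rung_carrier[OF a(3)]
    show "\<beta> a \<in> carrier Y" using \<rho>D(1) ca by (simp add: \<beta>_def a(1))
    show "\<beta> (s \<odot>\<^bsub>direct_sum W (step n)\<^esub> a) = s \<odot>\<^bsub>Y\<^esub> \<beta> a" if s: "s \<in> carrier \<Lambda>" for s
      using \<rho>D(3)[OF s, of "t w \<oplus>\<^bsub>tower\<^esub> z"] ca s tD(3)[OF s a(2)]
      by (simp add: \<beta>_def a(1) direct_sum_def T.smult_r_distr)
    fix b assume "b \<in> carrier (direct_sum W (step n))"
    then obtain w' z' where b: "b = (w', z')" "w' \<in> carrier W" "z' \<in> rung n" by (auto simp: direct_sum_def)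
    note cb = tD(1)[OF b(2)] rung_carrier[OF b(3)]
    have "t (w \<oplus>\<^bsub>W\<^esub> w') \<oplus>\<^bsub>tower\<^esub> (z \<oplus>\<^bsub>tower\<^esub> z') = (t w \<oplus>\<^bsub>tower\<^esub> z) \<oplus>\<^bsub>tower\<^esub> (t w' \<oplus>\<^bsub>tower\<^esub> z')"
      using tD(2)[OF a(2) b(2)] ca cb by (simp add: T.M.a_ac)
    then show "\<beta> (a \<oplus>\<^bsub>direct_sum W (step n)\<^esub> b) = \<beta> a \<oplus>\<^bsub>Y\<^esub> \<beta> b"
      using \<rho>D(2)[of "t w \<oplus>\<^bsub>tower\<^esub> z" "t w' \<oplus>\<^bsub>tower\<^esub> z'"] ca cb by (simp add: \<beta>_def a(1) b(1) direct_sum_def)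
  qed
  have ker: "\<alpha> ` carrier (step n) = a_kernel (direct_sum W (step n)) Y \<beta>"
  proof (intro equalityI subsetI)
    fix a assume "a \<in> \<alpha> ` carrier (step n)"
    then obtain z where z: "z \<in> rung n" "a = \<alpha> z" by auto
    have "\<beta> a = \<rho> (\<sigma> z)" using decomp[OF \<sigma>[OF z(1)]] by (simp add: z(2) \<alpha>_def \<beta>_def)
    then show "a \<in> a_kernel (direct_sum W (step n)) Y \<beta>"
      using \<rho>_\<sigma>_rung[OF z(1)] \<pi>_closed[OF \<sigma>[OF z(1)]] u[OF \<sigma>[OF z(1)]]
      by (simp add: a_kernel_iff z(2) \<alpha>_def direct_sum_def)
  next
    fix a assume "a \<in> a_kernel (direct_sum W (step n)) Y \<beta>"
    then obtain w z where a: "a = (w, z)" "w \<in> carrier W" "z \<in> rung n" "\<rho> (t w \<oplus>\<^bsub>tower\<^esub> z) = \<zero>\<^bsub>Y\<^esub>"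
      by (auto simp: a_kernel_iff direct_sum_def \<beta>_def)
    obtain x where x: "x \<in> rung n" "t w \<oplus>\<^bsub>tower\<^esub> z = \<sigma> x" using \<rho>_kernel[OF tz[OF a(2,3)]] a(4) by blast
    have "a = \<alpha> x" using recomp[OF a(2,3)] by (simp add: a(1) \<alpha>_def x(2))
    then show "a \<in> \<alpha> ` carrier (step n)" using x(1) by simp
  qed
  have surj: "\<beta> ` carrier (direct_sum W (step n)) = carrier Y"
  proof
    show "\<beta> ` carrier (direct_sum W (step n)) \<subseteq> carrier Y" using mod_homD(1)[OF \<beta>_hom] by blast
    show "carrier Y \<subseteq> \<beta> ` carrier (direct_sum W (step n))"
    proof
      fix y assume "y \<in> carrier Y"
      then obtain x where x: "x \<in> rung (Suc n)" "y = \<rho> x" using \<rho>_surj[of n] by blast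
      have "y = \<beta> (\<pi> n x, u x)" using decomp[OF x(1)] by (simp add: \<beta>_def x(2))
      moreover have "(\<pi> n x, u x) \<in> carrier (direct_sum W (step n))"
        using \<pi>_closed[OF x(1)] u[OF x(1)] by (simp add: direct_sum_def)
      ultimately show "y \<in> \<beta> ` carrier (direct_sum W (step n))" by blast
    qed
  qed
  have flS: "finite_length \<Lambda> (step n)"
    by (rule T.finite_lengthI[OF rung])
      (rule chain_cond_subset[OF cc_rung scalar_subspaces_mono[OF scal subset_refl]])+
  have "finite_length \<Lambda> (Y\<lparr>carrier := carrier Y\<rparr>)"
    by (rule Y.finite_lengthI[OF Y.carrier_scalar_subspace[OF subset_refl]])
      (rule chain_cond_Y[OF chain_cond_subset[OF ccV scalar_subspaces_mono[OF scal subset_refl]]])+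
  then have flY: "finite_length \<Lambda> Y" by simp
  have "short_exact \<Lambda> (step n) (direct_sum W (step n)) Y \<alpha> \<beta>"
    unfolding short_exact_def mod_mono_def using \<alpha>_hom \<alpha>_inj \<beta>_hom ker surj by blast
  then show ?thesis by (rule degenerationI[OF W flW left_module_Y flY left_module_step flS])
qed

end

theorem mainTheorem9:
  fixes k :: "'k ring" and \<phi> :: "'k \<Rightarrow> 'a" and \<Lambda> :: "'a ring"
    and U :: "('a, 'u) module" and V :: "('a, 'v) module" and W :: "('a, 'w) module"
    and f :: "'u \<Rightarrow> 'v" and g :: "'v \<Rightarrow> 'w" and h :: "'u \<Rightarrow> 'v"
  assumes "artin_algebra k \<phi> \<Lambda>"
    and "left_module \<Lambda> U" and "finite_length \<Lambda> U"
    and "left_module \<Lambda> V" and "finite_length \<Lambda> V"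
    and "left_module \<Lambda> W" and "finite_length \<Lambda> W"
    and "trivial_group (Ext1 \<Lambda> W W)"
    and "short_exact \<Lambda> U V W f g"
    and "h \<in> mod_mono \<Lambda> U V"
  shows "degeneration \<Lambda> W (cokernel_module U V h)"
proof -
  interpret artin_ladder k \<phi> \<Lambda> U V W f h g
    by (intro artin_ladder.intro artin_alg.intro ladder.intro artin_ladder_axioms.intro) (fact assms)+
  show ?thesis by (rule degeneration_cokernel)
qed

end
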